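(* Suppose $W=\sum_{i=1}^n\gamma_i x^{v_i}$ is a complete generalised Puiseux polynomial over $\mathbf K_{>0}$ on the split torus $T$. Then $W$ has a unique critical point $p_{\mathrm{crit}}$ in $T(\mathbf K_{>0})$, and the valuation $\operatorname{Val}_T(p_{\mathrm{crit}})\in N_{\mathbb R}$ of $p_{\mathrm{crit}}$ is the canonical point $d_{\mathrm{crit}}(\Xi_W)$ of the split complete Newton datum $\Xi_W=(M_{\mathbb R},\mathbb R\oplus M_{\mathbb R},\eta,\beta,\{(c_i,v_i)\mid i=1,\dots,n\})$, where $c_i=\operatorname{Val}_{\mathbf K}(\gamma_i)$.
   Context: Field. $\mathbf K$ is the field of generalised Puiseux series $c(t)=\sum_k c_{\mu_k}t^{\mu_k}$, $c_{\mu_k}\in\mathbb C$, with real exponents $\mu_0<\mu_1<\cdots$ forming a strictly increasing sequence that is finite or tends to $+\infty$. $\operatorname{Val}_{\mathbf K}$ is the lowest exponent with nonzero coefficient; $\mathfrak m=\{c\mid\operatorname{Val}_{\mathbf K}(c)>0\}$ (including $0$); $\mathbf K_{>0}$ is the set of nonzero series with leading coefficient in $\mathbb R_{>0}$. Torus. $T$ is a split torus over $\mathbf K$ of dimension $r$ with character lattice $M\cong\mathbb Z^r$, cocharacter lattice $N$, dual pairing $\langle\ ,\ \rangle$, $M_{\mathbb R}=M\otimes\mathbb R$, $N_{\mathbb R}=N\otimes\mathbb R$; $T(\mathbf K_{>0})=\operatorname{Hom}(M,\mathbf K_{>0})$, and $p^v\in \mathbf K_{>0}$ is the value of $p$ on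 $v\in M$. $\operatorname{Val}_T(p)\in N_{\mathbb R}$ is determined by $\operatorname{Val}_{\mathbf K}(p^v)=\langle v,\operatorname{Val}_T(p)\rangle$ for all $v\in M$. Every $p\in T(\mathbf K_{>0})$ is uniquely of the form $p=e^ut^d\exp_T(w)$ with $u,d\in N_{\mathbb R}$, $w\in N\otimes\mathfrak m$, meaning $p^v=e^{\langle v,u\rangle}t^{\langle v,d\rangle}\exp(\langle v,w\rangle)$ for $v\in M$; the same formula defines $p^v$ for $v\in M_{\mathbb R}$. Generalised Puiseux polynomials. A generalised Puiseux polynomial over $\mathbf K_{>0}$ is $W=\sum_{i=1}^n\gamma_ix^{v_i}$ with $\gamma_i\in\mathbf K_{>0}$ and distinct $v_i\in M_{\mathbb R}$; it defines a map $T(\mathbf K_{>0})\to\mathbf K_{>0}$, $p\mapsto\sum\gamma_ip^{v_i}$. It is complete if $\operatorname{ConvexHull}(\{v_i\})\subset M_{\mathbb R}$ is full-dimensional with $0$ in its interior. A point $p\in T(\mathbf K_{>0})$ is a critical point of $W$ if $\partial_uW(p):=\sum_i\gamma_i\langle v_i,u\rangle p^{v_i}=0$ for all $u\in N_{\mathbb R}$. Newton data. A Newton datum is a tuple $\Xi=(U,V,\eta,\beta,\mathcal W)$ with $U,V$ finite-dimensional real vector spaces, a short exact sequence $0\to\mathbb R\overset{\eta}\to V\overset{\beta}\to U\to0$, and a finite subset $\mathcal W\subset V$. It is complete if $\operatorname{ConvexHull}(\beta(\mathcal W))$ is full-dimensional in $U$ and contains $0$ in its interior. It is split if a splitting $\tilde\beta:U\to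 V$ ($\beta\circ\tilde\beta=\mathrm{id}$) is given. Recursion step. Let $\Xi$ be complete with $\dim U>0$. Put $\overline{\mathcal W}=\{w\in\mathcal W\mid\beta(w)\ne0\}$, $\overline\Delta=\operatorname{ConvexHull}(\overline{\mathcal W})$, $\bar\tau=\min\{c\in\mathbb R\mid\eta(c)\in\overline\Delta\}$; let $F$ be the minimal face of $\overline\Delta$ containing $\eta(\bar\tau)$ ($\overline\Delta$ itself is allowed as a face if it is not full-dimensional), and let $E$ be the linear span of $F-\eta(\bar\tau)$. Define $\Xi'=(U/\beta(E),V/E,\eta',\beta',\sigma(\overline{\mathcal W}))$, where $\sigma:V\to V/E$ is the projection and $\eta',\beta'$ are induced by $\eta,\beta$. This is again a complete Newton datum, with $\dim(U/\beta(E))<\dim U$. Canonical point. Given a complete $\Xi$, put $\Xi_1=\Xi$ and $\Xi_{k+1}=(\Xi_k)'$ as long as $\dim U_k>0$, with projections $\sigma_k:V_k\to V_{k+1}$; let $m$ be the first index with $\dim U_m=0$, so $\eta_m:\mathbb R\to V_m$ is an isomorphism. Then $\tilde d_{\mathrm{crit}}(\Xi):=\eta_m^{-1}\circ\sigma_{m-1}\circ\cdots\circ\sigma_1\in V^*$. If $\Xi$ is split by $\tilde\beta$, its canonical point is $d_{\mathrm{crit}}(\Xi):=\tilde\beta^*(\tilde d_{\mathrm{crit}}(\Xi))=\tilde d_{\mathrm{crit}}(\Xi)\circ\tilde\beta\in U^*$. The datum $\Xi_W$. Here $\eta(c)=(c,0)$, $\beta(c,v)=v$, the splitting is $\tilde\beta(v)=(0,v)$,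 and $M_{\mathbb R}^*$ is identified with $N_{\mathbb R}$. *)

theory Defs
  imports "HOL-Analysis.Analysis"
begin

section \<open>Generalised Puiseux series\<close>

definition puiseux_support :: "real set \<Rightarrow> bool" where
  "puiseux_support S \<longleftrightarrow>
     finite S \<or> (\<exists>\<mu>::nat \<Rightarrow> real. strict_mono \<mu> \<and> filterlim \<mu> at_top sequentially \<and> S = range \<mu>)"

lemma puiseux_support_iff: "puiseux_support S \<longleftrightarrow> (\<forall>b. finite (S \<inter> {..b}))"
proof
  assume S: "puiseux_support S"
  show "\<forall>b. finite (S \<inter> {..b})"
  proof (cases "finite S")
    case False
    then obtain \<mu> :: "nat \<Rightarrow> real" where \<mu>: "filterlim \<mu> at_top sequentially" "S = range \<mu>"
      using S by (auto simp: puiseux_support_def)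
    have "finite (S \<inter> {..b})" for b
    proof -
      obtain N where N: "\<And>n. n \<ge> N \<Longrightarrow> \<mu> n \<ge> b + 1"
        using \<mu>(1) by (auto simp: filterlim_at_top eventually_sequentially)
      have "S \<inter> {..b} \<subseteq> \<mu> ` {..<N}"
      proof
        fix x assume "x \<in> S \<inter> {..b}"
        then obtain n where n: "x = \<mu> n" "\<mu> n \<le> b" using \<mu>(2) by auto
        then have "n < N" using N[of n] by (cases "n < N") auto
        then show "x \<in> \<mu> ` {..<N}" using n by auto
      qed
      then show ?thesis by (rule finite_subset) auto
    qed
    then show ?thesis by blast
  qed auto
next
  assume fin: "\<forall>b. finite (S \<inter> {..b})"
  show "puiseux_support S"
  proof (cases "finite S")
    case True
    then show ?thesis by (simp add: puiseux_support_def)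
  next
    case False
    have least: "\<exists>x\<in>A. \<forall>y\<in>A. x \<le> y" if A: "A \<subseteq> S" "A \<noteq> {}" for A
    proof -
      obtain a where a: "a \<in> A" using A by blast
      have f: "finite (A \<inter> {..a})"
        using fin A(1) by (meson finite_subset inf_mono order_refl)
      have ne: "A \<inter> {..a} \<noteq> {}" using a by auto
      have "Min (A \<inter> {..a}) \<in> A \<inter> {..a}" using f ne by (rule Min_in)
      moreover have "Min (A \<inter> {..a}) \<le> y" if "y \<in> A" for y
      proof (cases "y \<le> a")
        case True
        then show ?thesis using f that by (intro Min_le) auto
      next
        case False
        then show ?thesis using calculation by auto
      qed
      ultimately show ?thesis by blast
    qed
    have nx: "\<exists>x. x \<in> S \<and> b < x \<and> (\<forall>y\<in>S. b < y \<longrightarrow> x \<le> y)" for b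
    proof -
      have "S \<inter> {b<..} \<noteq> {}"
      proof
        assume "S \<inter> {b<..} = {}"
        then have "S \<subseteq> S \<inter> {..b}" by force
        then show False using fin False finite_subset by blast
      qed
      then show ?thesis using least[of "S \<inter> {b<..}"] by auto
    qed
    obtain nxt where nxt: "\<And>b. nxt b \<in> S" "\<And>b. b < nxt b"
        "\<And>b y. y \<in> S \<Longrightarrow> b < y \<Longrightarrow> nxt b \<le> y"
      using nx by metis
    have "S \<noteq> {}" using False by auto
    then obtain x0 where x0: "x0 \<in> S" "\<And>y. y \<in> S \<Longrightarrow> x0 \<le> y" using least[of S] by auto
    define \<mu> where "\<mu> = rec_nat x0 (\<lambda>_. nxt)"
    have \<mu>0: "\<mu> 0 = x0" and \<mu>Suc: "\<mu> (Suc k) = nxt (\<mu> k)" for k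
      by (auto simp: \<mu>_def)
    have mono: "strict_mono \<mu>"
      by (rule strict_monoI_Suc) (simp add: \<mu>Suc nxt)
    have inS: "\<mu> k \<in> S" for k
      by (cases k) (auto simp: \<mu>0 \<mu>Suc nxt x0)
    have bdd: "finite {k. \<mu> k \<le> b}" for b
    proof (rule finite_imageD)
      have "\<mu> ` {k. \<mu> k \<le> b} \<subseteq> S \<inter> {..b}" using inS by auto
      then show "finite (\<mu> ` {k. \<mu> k \<le> b})" using fin finite_subset by blast
      show "inj_on \<mu> {k. \<mu> k \<le> b}"
        using mono strict_mono_imp_inj_on inj_on_subset by blast
    qed
    have lim: "filterlim \<mu> at_top sequentially"
      unfolding filterlim_at_top
    proof
      fix b
      have "finite {k. \<not> b \<le> \<mu> k}"
        by (rule finite_subset[OF _ bdd[of b]]) auto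
      then show "\<forall>\<^sub>F k in sequentially. b \<le> \<mu> k"
        by (simp add: eventually_cofinite flip: cofinite_eq_sequentially)
    qed
    have "S = range \<mu>"
    proof (intro equalityI subsetI)
      fix x assume x: "x \<in> S"
      show "x \<in> range \<mu>"
      proof (rule ccontr)
        assume nr: "x \<notin> range \<mu>"
        have "\<mu> k \<le> x" for k
        proof (induction k)
          case (Suc k)
          then have "\<mu> k < x" using nr by (metis order_le_less rangeI)
          then show ?case using nxt(3) x by (simp add: \<mu>Suc)
        qed (simp add: \<mu>0 x0 x)
        then have "{k. \<mu> k \<le> x} = UNIV" by auto
        then show False using bdd[of x] by simp
      qed
    qed (use inS in auto)
    then show ?thesis using mono lim by (auto simp: puiseux_support_def)
  qed
qed

text \<open>A series \<open>\<Sum>c\<^sub>\<mu> t\<^sup>\<mu>\<close> is represented by its coefficient function \<open>\<mu> \<mapsto> c\<^sub>\<mu>\<close>.\<close>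

typedef puiseux = "{f :: real \<Rightarrow> complex. puiseux_support {x. f x \<noteq> 0}}"
  morphisms pcoeff Abs_puiseux
  by (rule exI[of _ "\<lambda>_. 0"]) (simp add: puiseux_support_def)

setup_lifting type_definition_puiseux

abbreviation psupp :: "puiseux \<Rightarrow> real set" where
  "psupp c \<equiv> {x. pcoeff c x \<noteq> 0}"

lemma puiseux_eqI: "(\<And>x. pcoeff f x = pcoeff g x) \<Longrightarrow> f = g"
  by (metis ext pcoeff_inject)

lemma finite_psupp: "finite (psupp f \<inter> {..b})"
  using pcoeff[of f] by (simp add: puiseux_support_iff)

lemma psupp_bounded_below: "\<exists>a. \<forall>x\<in>psupp f. a \<le> x"
proof -
  let ?A = "psupp f \<inter> {..0}"
  have "\<forall>x\<in>psupp f. Min (insert 0 ?A) \<le> x"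
  proof
    fix x assume "x \<in> psupp f"
    then show "Min (insert 0 ?A) \<le> x"
      using finite_psupp[of f 0] by (cases "x \<le> 0") (auto simp: Min_le_iff)
  qed
  then show ?thesis by blast
qed

definition Val :: "puiseux \<Rightarrow> real" where
  "Val c = (LEAST x. pcoeff c x \<noteq> 0)"

lemma Val_lemmas:
  assumes "c \<noteq> Abs_puiseux (\<lambda>_. 0)"
  shows "pcoeff c (Val c) \<noteq> 0" and "\<And>x. pcoeff c x \<noteq> 0 \<Longrightarrow> Val c \<le> x"
proof -
  have "pcoeff (Abs_puiseux (\<lambda>_. 0)) x = 0" for x
    by (subst Abs_puiseux_inverse) (simp_all add: puiseux_support_def)
  then obtain a where a: "pcoeff c a \<noteq> 0" using assms puiseux_eqI by metis
  let ?A = "psupp c \<inter> {..a}"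
  have f: "finite ?A" "?A \<noteq> {}" using a finite_psupp by auto
  have m: "Min ?A \<in> ?A" using f by (rule Min_in)
  have le: "Min ?A \<le> x" if "pcoeff c x \<noteq> 0" for x
    using that f m by (cases "x \<le> a") (auto simp: Min_le_iff)
  have "Val c = Min ?A" unfolding Val_def using m le by (intro Least_equality) auto
  then show "pcoeff c (Val c) \<noteq> 0" "\<And>x. pcoeff c x \<noteq> 0 \<Longrightarrow> Val c \<le> x"
    using m le by auto
qed

lift_definition monom :: "complex \<Rightarrow> real \<Rightarrow> puiseux" is "\<lambda>a \<mu> x. if x = \<mu> then a else 0"
  by (auto simp: puiseux_support_def)

instantiation puiseux :: ab_group_add
begin

lift_definition zero_puiseux :: puiseux is "\<lambda>_. 0"
  by (simp add: puiseux_support_def)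

lift_definition plus_puiseux :: "puiseux \<Rightarrow> puiseux \<Rightarrow> puiseux" is "\<lambda>f g x. f x + g x"
proof -
  fix f g :: "real \<Rightarrow> complex"
  assume "puiseux_support {x. f x \<noteq> 0}" "puiseux_support {x. g x \<noteq> 0}"
  moreover have "{x. f x + g x \<noteq> 0} \<inter> {..b} \<subseteq> ({x. f x \<noteq> 0} \<inter> {..b}) \<union> ({x. g x \<noteq> 0} \<inter> {..b})" for b
    by auto
  ultimately show "puiseux_support {x. f x + g x \<noteq> 0}"
    unfolding puiseux_support_iff by (meson finite_UnI finite_subset)
qed

lift_definition uminus_puiseux :: "puiseux \<Rightarrow> puiseux" is "\<lambda>f x. - f x"
  by simp

definition minus_puiseux :: "puiseux \<Rightarrow> puiseux \<Rightarrow> puiseux" where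
  "f - g = f + (- g)" for f g :: puiseux

instance
  by standard (auto simp: minus_puiseux_def intro!: puiseux_eqI simp: zero_puiseux.rep_eq
      plus_puiseux.rep_eq uminus_puiseux.rep_eq add_ac)

end

lemma pcoeff_0 [simp]: "pcoeff 0 x = 0"
  by (simp add: zero_puiseux.rep_eq)

lemma pcoeff_add [simp]: "pcoeff (f + g) x = pcoeff f x + pcoeff g x"
  by (simp add: plus_puiseux.rep_eq)

lemma pcoeff_minus [simp]: "pcoeff (- f) x = - pcoeff f x"
  by (simp add: uminus_puiseux.rep_eq)

lemma pcoeff_diff [simp]: "pcoeff (f - g) x = pcoeff f x - pcoeff g x"
  using pcoeff_add[of f "- g" x] by simp

lemma pcoeff_monom: "pcoeff (monom a \<mu>) x = (if x = \<mu> then a else 0)"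
  by (simp add: monom.rep_eq)

lemma pcoeff_sum: "pcoeff (sum f A) x = (\<Sum>i\<in>A. pcoeff (f i) x)"
  by (induction A rule: infinite_finite_induct) auto

lemma pcoeff_Val: "c \<noteq> 0 \<Longrightarrow> pcoeff c (Val c) \<noteq> 0"
  using Val_lemmas(1)[of c] by (simp add: zero_puiseux_def)

lemma Val_le: "pcoeff c x \<noteq> 0 \<Longrightarrow> Val c \<le> x"
proof -
  assume *: "pcoeff c x \<noteq> 0"
  then have "c \<noteq> 0" by auto
  then show ?thesis using Val_lemmas(2)[of c x] * by (simp add: zero_puiseux_def)
qed

definition pmult_coeff :: "(real \<Rightarrow> complex) \<Rightarrow> (real \<Rightarrow> complex) \<Rightarrow> real \<Rightarrow> complex" where
  "pmult_coeff f g x = (\<Sum>y | f y \<noteq> 0 \<and> g (x - y) \<noteq> 0. f y * g (x - y))"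

lemma finite_conv: "finite {y. pcoeff f y \<noteq> 0 \<and> pcoeff g (x - y) \<noteq> 0}"
proof -
  obtain b where b: "\<forall>z\<in>psupp g. b \<le> z" using psupp_bounded_below by blast
  have "{y. pcoeff f y \<noteq> 0 \<and> pcoeff g (x - y) \<noteq> 0} \<subseteq> psupp f \<inter> {..x - b}"
    using b by fastforce
  then show ?thesis using finite_psupp finite_subset by blast
qed

lemma pmult_coeff_eq:
  assumes "finite A" "\<And>y. pcoeff f y \<noteq> 0 \<Longrightarrow> pcoeff g (x - y) \<noteq> 0 \<Longrightarrow> y \<in> A"
  shows "pmult_coeff (pcoeff f) (pcoeff g) x = (\<Sum>y\<in>A. pcoeff f y * pcoeff g (x - y))"
  unfolding pmult_coeff_def using assms by (intro sum.mono_neutral_left) auto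

lemma pmult_coeff_nz:
  assumes "pmult_coeff f g x \<noteq> 0"
  shows "\<exists>y. f y \<noteq> 0 \<and> g (x - y) \<noteq> 0"
proof (rule ccontr)
  assume "\<not> ?thesis"
  then have "{y. f y \<noteq> 0 \<and> g (x - y) \<noteq> 0} = {}" by auto
  then have "pmult_coeff f g x = 0" unfolding pmult_coeff_def by (simp only: sum.empty)
  then show False using assms by simp
qed

lemma finite_sumset: "finite {y + z |y z. y \<in> psupp f \<and> z \<in> psupp g \<and> y + z \<le> x}"
proof -
  obtain a b where ab: "\<forall>z\<in>psupp f. a \<le> z" "\<forall>z\<in>psupp g. b \<le> z"
    using psupp_bounded_below by metis
  have "{y + z |y z. y \<in> psupp f \<and> z \<in> psupp g \<and> y + z \<le> x} \<subseteq>
      (\<lambda>(y, z). y + z) ` ((psupp f \<inter> {..x - b}) \<times> (psupp g \<inter> {..x - a}))"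
  proof
    fix s assume "s \<in> {y + z |y z. y \<in> psupp f \<and> z \<in> psupp g \<and> y + z \<le> x}"
    then obtain y z where yz: "s = y + z" "y \<in> psupp f" "z \<in> psupp g" "y + z \<le> x" by blast
    then have "a \<le> y" "b \<le> z" using ab by blast+
    then have "y \<in> psupp f \<inter> {..x - b}" "z \<in> psupp g \<inter> {..x - a}" using yz by auto
    then show "s \<in> (\<lambda>(y, z). y + z) ` ((psupp f \<inter> {..x - b}) \<times> (psupp g \<inter> {..x - a}))"
      using yz(1) by (intro image_eqI[of _ _ "(y, z)"]) auto
  qed
  then show ?thesis by (rule finite_subset) (intro finite_imageI finite_cartesian_product finite_psupp)
qed

instantiation puiseux :: comm_ring_1
begin

definition one_puiseux :: puiseux where
  "1 = monom 1 0"

lift_definition times_puiseux :: "puiseux \<Rightarrow> puiseux \<Rightarrow> puiseux" is pmult_coeff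
proof -
  fix f g :: "real \<Rightarrow> complex"
  assume *: "puiseux_support {x. f x \<noteq> 0}" "puiseux_support {x. g x \<noteq> 0}"
  define F G where "F = Abs_puiseux f" and "G = Abs_puiseux g"
  have FG: "f = pcoeff F" "g = pcoeff G"
    using * by (simp_all add: F_def G_def Abs_puiseux_inverse)
  have "{x. pmult_coeff f g x \<noteq> 0} \<inter> {..b} \<subseteq> {y + z |y z. y \<in> psupp F \<and> z \<in> psupp G \<and> y + z \<le> b}" for b
  proof
    fix x assume x: "x \<in> {x. pmult_coeff f g x \<noteq> 0} \<inter> {..b}"
    then obtain y where "f y \<noteq> 0" "g (x - y) \<noteq> 0" using pmult_coeff_nz by blast
    then show "x \<in> {y + z |y z. y \<in> psupp F \<and> z \<in> psupp G \<and> y + z \<le> b}"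
      using x FG by (intro CollectI exI[of _ y] exI[of _ "x - y"]) auto
  qed
  then show "puiseux_support {x. pmult_coeff f g x \<noteq> 0}"
    unfolding puiseux_support_iff using finite_sumset finite_subset by blast
qed

lemma pcoeff_times:
  assumes "finite A" "\<And>y. pcoeff f y \<noteq> 0 \<Longrightarrow> pcoeff g (x - y) \<noteq> 0 \<Longrightarrow> y \<in> A"
  shows "pcoeff (f * g) x = (\<Sum>y\<in>A. pcoeff f y * pcoeff g (x - y))"
  using pmult_coeff_eq[OF assms] by (simp add: times_puiseux.rep_eq)

instance
proof
  fix f g h :: puiseux
  show comm: "f * g = g * f" for f g :: puiseux
  proof (rule puiseux_eqI)
    fix x
    let ?A = "{y. pcoeff f y \<noteq> 0 \<and> pcoeff g (x - y) \<noteq> 0}"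
    have "pcoeff (f * g) x = (\<Sum>y\<in>?A. pcoeff f y * pcoeff g (x - y))"
      by (rule pcoeff_times) (auto intro: finite_conv)
    also have "\<dots> = (\<Sum>z\<in>(\<lambda>y. x - y) ` ?A. pcoeff g z * pcoeff f (x - z))"
      by (subst sum.reindex) (auto simp: inj_on_def mult.commute)
    also have "\<dots> = pcoeff (g * f) x"
    proof (rule pcoeff_times[symmetric])
      show "finite ((\<lambda>y. x - y) ` ?A)" using finite_conv by blast
      fix y assume "pcoeff g y \<noteq> 0" "pcoeff f (x - y) \<noteq> 0"
      then show "y \<in> (\<lambda>y. x - y) ` ?A" by (intro image_eqI[of _ _ "x - y"]) auto
    qed
    finally show "pcoeff (f * g) x = pcoeff (g * f) x" .
  qed
  show "f * g * h = f * (g * h)"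
  proof (rule puiseux_eqI)
    fix x
    obtain a b c where abc: "\<forall>z\<in>psupp f. a \<le> z" "\<forall>z\<in>psupp g. b \<le> z" "\<forall>z\<in>psupp h. c \<le> z"
      using psupp_bounded_below by metis
    let ?S = "{y + z |y z. y \<in> psupp f \<and> z \<in> psupp g \<and> y + z \<le> x - c}"
    let ?A = "psupp f \<inter> {..x - b - c}"
    have fS: "finite ?S" by (rule finite_sumset)
    have fA: "finite ?A" by (rule finite_psupp)
    have "pcoeff (f * g * h) x = (\<Sum>s\<in>?S. pcoeff (f * g) s * pcoeff h (x - s))"
    proof (rule pcoeff_times[OF fS])
      fix s assume s: "pcoeff (f * g) s \<noteq> 0" "pcoeff h (x - s) \<noteq> 0"
      obtain y where "pcoeff f y \<noteq> 0" "pcoeff g (s - y) \<noteq> 0"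
        using s(1) pmult_coeff_nz unfolding times_puiseux.rep_eq by blast
      moreover have "s \<le> x - c" using s(2) abc(3) by fastforce
      ultimately show "s \<in> ?S" by (intro CollectI exI[of _ y] exI[of _ "s - y"]) auto
    qed
    also have "\<dots> = (\<Sum>s\<in>?S. (\<Sum>y\<in>?A. pcoeff f y * pcoeff g (s - y)) * pcoeff h (x - s))"
    proof (intro sum.cong refl arg_cong2[where f = "(*)"] pcoeff_times[OF fA])
      fix s y assume s: "s \<in> ?S" "pcoeff f y \<noteq> 0" "pcoeff g (s - y) \<noteq> 0"
      have "b \<le> s - y" using abc(2) s(3) by blast
      moreover have "s \<le> x - c" using s(1) by auto
      ultimately show "y \<in> ?A" using s(2) by auto
    qed
    also have "\<dots> = (\<Sum>y\<in>?A. pcoeff f y * (\<Sum>s\<in>?S. pcoeff g (s - y) * pcoeff h (x - s)))"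
      unfolding sum_distrib_left sum_distrib_right by (subst sum.swap) (simp add: mult.assoc)
    also have "\<dots> = (\<Sum>y\<in>?A. pcoeff f y * pcoeff (g * h) (x - y))"
    proof (intro sum.cong refl arg_cong2[where f = "(*)"])
      fix y assume y: "y \<in> ?A"
      have "pcoeff (g * h) (x - y) = (\<Sum>z\<in>(\<lambda>s. s - y) ` ?S. pcoeff g z * pcoeff h (x - y - z))"
      proof (rule pcoeff_times)
        show "finite ((\<lambda>s. s - y) ` ?S)" using fS by blast
        fix z assume z: "pcoeff g z \<noteq> 0" "pcoeff h (x - y - z) \<noteq> 0"
        have "c \<le> x - y - z" using abc(3) z(2) by blast
        then have "y + z \<in> ?S" using y z by (intro CollectI exI[of _ y] exI[of _ z]) auto
        then show "z \<in> (\<lambda>s. s - y) ` ?S" by (intro image_eqI[of _ _ "y + z"]) auto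
      qed
      also have "\<dots> = (\<Sum>s\<in>?S. pcoeff g (s - y) * pcoeff h (x - s))"
        by (subst sum.reindex) (auto simp: inj_on_def)
      finally show "(\<Sum>s\<in>?S. pcoeff g (s - y) * pcoeff h (x - s)) = pcoeff (g * h) (x - y)"
        by simp
    qed
    also have "\<dots> = pcoeff (f * (g * h)) x"
    proof (rule pcoeff_times[OF fA, symmetric])
      fix y assume y: "pcoeff f y \<noteq> 0" "pcoeff (g * h) (x - y) \<noteq> 0"
      obtain z where "pcoeff g z \<noteq> 0" "pcoeff h (x - y - z) \<noteq> 0"
        using y(2) pmult_coeff_nz unfolding times_puiseux.rep_eq by blast
      then have "b \<le> z" "c \<le> x - y - z" using abc by blast+
      then show "y \<in> ?A" using y(1) by auto
    qed
    finally show "pcoeff (f * g * h) x = pcoeff (f * (g * h)) x" .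
  qed
  show "1 * f = f"
  proof (rule puiseux_eqI)
    fix x
    have "pcoeff (1 * f) x = (\<Sum>y\<in>{0}. pcoeff 1 y * pcoeff f (x - y))"
      by (rule pcoeff_times) (auto simp: one_puiseux_def pcoeff_monom split: if_splits)
    then show "pcoeff (1 * f) x = pcoeff f x" by (simp add: one_puiseux_def pcoeff_monom)
  qed
  show "(f + g) * h = f * h + g * h"
  proof (rule puiseux_eqI)
    fix x
    let ?A = "{y. pcoeff f y \<noteq> 0 \<and> pcoeff h (x - y) \<noteq> 0} \<union> {y. pcoeff g y \<noteq> 0 \<and> pcoeff h (x - y) \<noteq> 0}"
    have A: "finite ?A" by (simp add: finite_conv)
    have "pcoeff ((f + g) * h) x = (\<Sum>y\<in>?A. pcoeff (f + g) y * pcoeff h (x - y))"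
      using A by (rule pcoeff_times) auto
    moreover have "pcoeff (f * h) x = (\<Sum>y\<in>?A. pcoeff f y * pcoeff h (x - y))"
      using A by (rule pcoeff_times) auto
    moreover have "pcoeff (g * h) x = (\<Sum>y\<in>?A. pcoeff g y * pcoeff h (x - y))"
      using A by (rule pcoeff_times) auto
    ultimately show "pcoeff ((f + g) * h) x = pcoeff (f * h + g * h) x"
      by (simp add: sum.distrib distrib_right)
  qed
  have "pcoeff 0 0 \<noteq> pcoeff 1 0" by (simp add: one_puiseux_def pcoeff_monom)
  then show "(0::puiseux) \<noteq> 1" by metis
qed

end

lemma pcoeff_monom_mult [simp]: "pcoeff (monom a \<mu> * f) x = a * pcoeff f (x - \<mu>)"
proof -
  have "pcoeff (monom a \<mu> * f) x = (\<Sum>y\<in>{\<mu>}. pcoeff (monom a \<mu>) y * pcoeff f (x - y))"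
    by (rule pcoeff_times) (auto simp: pcoeff_monom split: if_splits)
  then show ?thesis by (simp add: pcoeff_monom)
qed

instantiation puiseux :: real_algebra_1
begin

definition scaleR_puiseux :: "real \<Rightarrow> puiseux \<Rightarrow> puiseux" where
  "scaleR_puiseux r f = monom (complex_of_real r) 0 * f"

instance
proof
  fix a b :: real and f g :: puiseux
  show "a *\<^sub>R (f + g) = a *\<^sub>R f + a *\<^sub>R g"
    by (simp add: scaleR_puiseux_def distrib_left)
  show "(a + b) *\<^sub>R f = a *\<^sub>R f + b *\<^sub>R f"
    by (rule puiseux_eqI) (simp add: scaleR_puiseux_def distrib_right)
  show "a *\<^sub>R b *\<^sub>R f = (a * b) *\<^sub>R f"
    by (rule puiseux_eqI) (simp add: scaleR_puiseux_def)
  show "1 *\<^sub>R f = f"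
    by (rule puiseux_eqI) (simp add: scaleR_puiseux_def)
  show "a *\<^sub>R f * g = a *\<^sub>R (f * g)" "f * a *\<^sub>R g = a *\<^sub>R (f * g)"
    by (simp_all add: scaleR_puiseux_def mult_ac)
qed

end

lemma pcoeff_scaleR [simp]: "pcoeff (r *\<^sub>R f) x = r *\<^sub>R pcoeff f x"
  by (simp add: scaleR_puiseux_def scaleR_conv_of_real)

definition max_ideal :: "puiseux set" where
  "max_ideal = {c. c = 0 \<or> Val c > 0}"

lemma max_ideal_coeff:
  assumes "c \<in> max_ideal"
  shows "\<exists>\<epsilon>>0. \<forall>x<\<epsilon>. pcoeff c x = 0"
proof (cases "c = 0")
  case True
  then show ?thesis by (intro exI[of _ 1]) simp
next
  case False
  have "pcoeff c x = 0" if "x < Val c" for x using Val_le[of c x] that by linarith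
  then show ?thesis using False assms by (intro exI[of _ "Val c"]) (simp add: max_ideal_def)
qed

text \<open>\<open>\<Sum>\<^sub>k a\<^sub>k c\<^sup>k\<close> for \<open>c \<in> \<mm>\<close>. Each power of \<open>t\<close> occurs in only finitely many of
  the \<open>c\<^sup>k\<close>, so the coefficients of this series are finite sums.\<close>

definition power_series_coeff :: "(nat \<Rightarrow> complex) \<Rightarrow> puiseux \<Rightarrow> real \<Rightarrow> complex" where
  "power_series_coeff a c x = (\<Sum>k | pcoeff (c ^ k) x \<noteq> 0. a k * pcoeff (c ^ k) x)"

definition power_series :: "(nat \<Rightarrow> complex) \<Rightarrow> puiseux \<Rightarrow> puiseux" where
  "power_series a c = Abs_puiseux (power_series_coeff a c)"

lemma pcoeff_power_eq_0:
  assumes "\<forall>x<\<epsilon>. pcoeff c x = 0" "x < real k * \<epsilon>"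
  shows "pcoeff (c ^ k) x = 0"
  using assms(2)
proof (induction k arbitrary: x)
  case 0
  then show ?case by (simp add: one_puiseux_def pcoeff_monom)
next
  case (Suc k)
  show ?case
  proof (rule ccontr)
    assume "pcoeff (c ^ Suc k) x \<noteq> 0"
    then obtain y where y: "pcoeff c y \<noteq> 0" "pcoeff (c ^ k) (x - y) \<noteq> 0"
      using pmult_coeff_nz unfolding power_Suc times_puiseux.rep_eq by blast
    have "\<epsilon> \<le> y" "real k * \<epsilon> \<le> x - y" using assms(1) Suc.IH y by force+
    then show False using Suc.prems by (simp add: algebra_simps)
  qed
qed

lemma power_series_coeff_eq:
  assumes "\<epsilon> > 0" "\<forall>x<\<epsilon>. pcoeff c x = 0" "x < real N * \<epsilon>"
  shows "power_series_coeff a c x = (\<Sum>k<N. a k * pcoeff (c ^ k) x)"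
proof -
  have "{k. pcoeff (c ^ k) x \<noteq> 0} \<subseteq> {..<N}"
  proof (intro subsetI)
    fix k assume k: "k \<in> {k. pcoeff (c ^ k) x \<noteq> 0}"
    have "\<not> x < real k * \<epsilon>" using pcoeff_power_eq_0[OF assms(2)] k by blast
    then have "real k * \<epsilon> < real N * \<epsilon>" using assms(3) by linarith
    then show "k \<in> {..<N}" using assms(1) by auto
  qed
  then show ?thesis unfolding power_series_coeff_def by (intro sum.mono_neutral_left) auto
qed

lemma pcoeff_power_series:
  assumes "c \<in> max_ideal"
  shows "pcoeff (power_series a c) x = power_series_coeff a c x"
proof -
  obtain \<epsilon> where \<epsilon>: "\<epsilon> > 0" "\<forall>x<\<epsilon>. pcoeff c x = 0" using max_ideal_coeff assms by blast
  have "finite ({x. power_series_coeff a c x \<noteq> 0} \<inter> {..b})" for b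
  proof -
    obtain N where N: "b / \<epsilon> < real N" using reals_Archimedean2 by blast
    have "b < real N * \<epsilon>" using N \<epsilon>(1) by (simp add: divide_less_eq)
    then have *: "power_series_coeff a c x = (\<Sum>k<N. a k * pcoeff (c ^ k) x)" if "x \<le> b" for x
      using power_series_coeff_eq[OF \<epsilon>] that by simp
    have "{x. power_series_coeff a c x \<noteq> 0} \<inter> {..b} \<subseteq> (\<Union>k<N. psupp (c ^ k) \<inter> {..b})"
    proof
      fix x assume x: "x \<in> {x. power_series_coeff a c x \<noteq> 0} \<inter> {..b}"
      then have "(\<Sum>k<N. a k * pcoeff (c ^ k) x) \<noteq> 0" using * by auto
      then obtain k where "k < N" "a k * pcoeff (c ^ k) x \<noteq> 0"
        using sum.not_neutral_contains_not_neutral by blast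
      then show "x \<in> (\<Union>k<N. psupp (c ^ k) \<inter> {..b})" using x by auto
    qed
    then show ?thesis by (rule finite_subset) (intro finite_UN_I finite_lessThan finite_psupp)
  qed
  then have "puiseux_support {x. power_series_coeff a c x \<noteq> 0}" by (simp add: puiseux_support_iff)
  then show ?thesis by (simp add: power_series_def Abs_puiseux_inverse)
qed

lemma geometric_series:
  assumes "c \<in> max_ideal"
  shows "(1 - c) * power_series (\<lambda>_. 1) c = 1"
proof (rule puiseux_eqI)
  fix x
  let ?P = "power_series (\<lambda>_. 1) c"
  obtain \<epsilon> where \<epsilon>: "\<epsilon> > 0" "\<forall>x<\<epsilon>. pcoeff c x = 0" using max_ideal_coeff assms by blast
  obtain N where N: "x / \<epsilon> < real N" using reals_Archimedean2 by blast
  have xN: "x < real N * \<epsilon>" using N \<epsilon>(1) by (simp add: divide_less_eq)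
  let ?Q = "\<Sum>k<N. c ^ k"
  have eq: "pcoeff ?P z = pcoeff ?Q z" if "z \<le> x" for z
    using power_series_coeff_eq[OF \<epsilon>, of z N "\<lambda>_. 1"] that xN
    by (simp add: pcoeff_power_series[OF assms] pcoeff_sum)
  have low: "pcoeff (1 - c) y = 0" if "y < 0" for y
    using that \<epsilon> by (simp add: one_puiseux_def pcoeff_monom)
  have PQ: "pcoeff ?P (x - y) = pcoeff ?Q (x - y)" if "pcoeff (1 - c) y \<noteq> 0" for y
  proof -
    have "0 \<le> y" using that low[of y] by (cases "y < 0") auto
    then show ?thesis by (intro eq) simp
  qed
  have "pcoeff ((1 - c) * ?P) x = pcoeff ((1 - c) * ?Q) x"
    unfolding times_puiseux.rep_eq pmult_coeff_def using PQ by (intro sum.cong) auto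
  also have "(1 - c) * ?Q = 1 - c ^ N"
    by (simp add: one_diff_power_eq)
  also have "pcoeff (1 - c ^ N) x = pcoeff 1 x"
    using pcoeff_power_eq_0[OF \<epsilon>(2) xN] by simp
  finally show "pcoeff ((1 - c) * ?P) x = pcoeff 1 x" .
qed

lemma puiseux_inverse_exists:
  fixes c :: puiseux
  assumes "c \<noteq> 0"
  shows "\<exists>d. d * c = 1"
proof -
  define a where "a = pcoeff c (Val c)"
  have a: "a \<noteq> 0" using assms pcoeff_Val by (simp add: a_def)
  define u where "u = monom (inverse a) (- Val c)"
  define h where "h = 1 - u * c"
  have "h \<in> max_ideal"
  proof (cases "h = 0")
    case False
    have "pcoeff h x = 0" if "x \<le> 0" for x
    proof (cases "x = 0")
      case True
      then show ?thesis using a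
        by (simp add: h_def u_def one_puiseux_def pcoeff_monom flip: a_def)
    next
      case False
      then have "pcoeff c (x + Val c) = 0" using that Val_le[of c "x + Val c"] by fastforce
      then show ?thesis using False by (simp add: h_def u_def one_puiseux_def pcoeff_monom)
    qed
    then have "Val h > 0" using pcoeff_Val[OF False] by (meson not_le)
    then show ?thesis by (simp add: max_ideal_def)
  qed (simp add: max_ideal_def)
  then have "(u * c) * power_series (\<lambda>_. 1) h = 1"
    using geometric_series[of h] by (simp add: h_def)
  then have "(u * power_series (\<lambda>_. 1) h) * c = 1" by (simp add: mult_ac)
  then show ?thesis by blast
qed

instantiation puiseux :: field
begin

definition inverse_puiseux :: "puiseux \<Rightarrow> puiseux" where
  "inverse_puiseux c = (if c = 0 then 0 else (SOME d. d * c = 1))"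

definition divide_puiseux :: "puiseux \<Rightarrow> puiseux \<Rightarrow> puiseux" where
  "divide_puiseux c d = c * inverse d"

instance
proof
  fix c d :: puiseux
  show "inverse c * c = 1" if "c \<noteq> 0"
    using someI_ex[OF puiseux_inverse_exists[OF that]] that by (simp only: inverse_puiseux_def if_False)
qed (simp_all add: inverse_puiseux_def divide_puiseux_def)

end

definition pexp :: "puiseux \<Rightarrow> puiseux" where
  "pexp = power_series (\<lambda>k. 1 / fact k)"

definition Kpos :: "puiseux set" where
  "Kpos = {c. c \<noteq> 0 \<and> (\<exists>r>0. pcoeff c (Val c) = complex_of_real r)}"

section \<open>The torus\<close>

text \<open>
  The real vector space \<open>M\<^sub>\<real>\<close> is the type \<open>'m\<close> and the character lattice \<open>M\<close> is the
  \<open>\<int>\<close>-span of a basis of it, so \<open>r\<close> is the size of that basis (the class of normed spaces, unlike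
  that of Euclidean spaces, permits \<open>r = 0\<close>). The norm on \<open>'m\<close> only serves to provide the
  topology for interiors; on a finite-dimensional space the topology does not depend on it.
  The space \<open>N\<^sub>\<real>\<close> is the dual of \<open>M\<^sub>\<real>\<close>, its elements being the linear functionals
  \<open>u :: 'm \<Rightarrow> real\<close>, with \<open>\<langle>v,u\<rangle> = u v\<close>. Similarly \<open>N \<otimes> \<mm>\<close> consists of the linear maps
  \<open>w :: 'm \<Rightarrow> puiseux\<close> with values in \<open>\<mm>\<close>, and \<open>\<langle>v,w\<rangle> = w v\<close>.\<close>

definition character_lattice :: "'m::real_normed_vector set \<Rightarrow> bool" where
  "character_lattice M \<longleftrightarrow>
     (\<exists>B. finite B \<and> independent B \<and> span B = UNIV \<and>
          M = {\<Sum>b\<in>B. real_of_int (k b) *\<^sub>R b | k. True})"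

text \<open>\<open>T(\<^bold>K\<^sub>>\<^sub>0) = Hom(M, \<^bold>K\<^sub>>\<^sub>0)\<close>; a point \<open>p\<close> is \<open>undefined\<close> outside \<open>M\<close>, and for
  \<open>v \<in> M\<close> the value \<open>p\<^sup>v\<close> is \<open>p v\<close>.\<close>

definition torus_pos :: "'m::real_normed_vector set \<Rightarrow> ('m \<Rightarrow> puiseux) set" where
  "torus_pos M = {p \<in> M \<rightarrow>\<^sub>E Kpos. \<forall>v\<in>M. \<forall>w\<in>M. p (v + w) = p v * p w}"

definition Val_T :: "'m::real_normed_vector set \<Rightarrow> ('m \<Rightarrow> puiseux) \<Rightarrow> 'm \<Rightarrow> real" where
  "Val_T M p = (THE \<delta>. linear \<delta> \<and> (\<forall>v\<in>M. Val (p v) = \<delta> v))"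

definition torus_exp ::
    "('m::real_normed_vector \<Rightarrow> real) \<Rightarrow> ('m \<Rightarrow> real) \<Rightarrow> ('m \<Rightarrow> puiseux) \<Rightarrow> 'm \<Rightarrow> puiseux" where
  "torus_exp u d w v = monom (complex_of_real (exp (u v))) (d v) * pexp (w v)"

definition torus_rep ::
    "'m::real_normed_vector set \<Rightarrow> ('m \<Rightarrow> puiseux) \<Rightarrow>
     ('m \<Rightarrow> real) \<times> ('m \<Rightarrow> real) \<times> ('m \<Rightarrow> puiseux) \<Rightarrow> bool" where
  "torus_rep M p = (\<lambda>(u, d, w). linear u \<and> linear d \<and> linear w \<and> range w \<subseteq> max_ideal \<and>
     (\<forall>v\<in>M. p v = torus_exp u d w v))"

text \<open>\<open>p\<^sup>v\<close> for \<open>v \<in> M\<^sub>\<real>\<close>.\<close>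

definition torus_pow :: "'m::real_normed_vector set \<Rightarrow> ('m \<Rightarrow> puiseux) \<Rightarrow> 'm \<Rightarrow> puiseux" where
  "torus_pow M p v = (case (THE x. torus_rep M p x) of (u, d, w) \<Rightarrow> torus_exp u d w v)"

section \<open>Generalised Puiseux polynomials\<close>

definition gen_puiseux_poly :: "nat \<Rightarrow> (nat \<Rightarrow> puiseux) \<Rightarrow> (nat \<Rightarrow> 'm::real_normed_vector) \<Rightarrow> bool" where
  "gen_puiseux_poly n \<gamma> v \<longleftrightarrow> (\<forall>i\<in>{1..n}. \<gamma> i \<in> Kpos) \<and> inj_on v {1..n}"

definition complete_poly :: "nat \<Rightarrow> (nat \<Rightarrow> 'm::real_normed_vector) \<Rightarrow> bool" where
  "complete_poly n v \<longleftrightarrow>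
     affine hull (v ` {1..n}) = UNIV \<and> 0 \<in> interior (convex hull (v ` {1..n}))"

definition poly_deriv ::
    "'m::real_normed_vector set \<Rightarrow> nat \<Rightarrow> (nat \<Rightarrow> puiseux) \<Rightarrow> (nat \<Rightarrow> 'm) \<Rightarrow>
     ('m \<Rightarrow> real) \<Rightarrow> ('m \<Rightarrow> puiseux) \<Rightarrow> puiseux" where
  "poly_deriv M n \<gamma> v u p = (\<Sum>i=1..n. \<gamma> i * of_real (u (v i)) * torus_pow M p (v i))"

definition critical_point ::
    "'m::real_normed_vector set \<Rightarrow> nat \<Rightarrow> (nat \<Rightarrow> puiseux) \<Rightarrow> (nat \<Rightarrow> 'm) \<Rightarrow>
     ('m \<Rightarrow> puiseux) \<Rightarrow> bool" where
  "critical_point M n \<gamma> v p \<longleftrightarrow>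
     p \<in> torus_pos M \<and> (\<forall>u. linear u \<longrightarrow> poly_deriv M n \<gamma> v u p = 0)"

section \<open>Newton data\<close>

text \<open>The spaces \<open>U\<close> and \<open>V\<close> are finite-dimensional subspaces of real vector spaces, and only the
  values of \<open>\<beta>\<close> on \<open>V\<close> matter. Requiring \<open>\<beta>\<close> to be linear on the whole type is harmless,
  because every linear map on a subspace extends.\<close>

record ('u, 'v) newton_datum =
  nd_U :: "'u set"
  nd_V :: "'v set"
  nd_eta :: "real \<Rightarrow> 'v"
  nd_beta :: "'v \<Rightarrow> 'u"
  nd_pts :: "'v set"

definition newton_datum :: "('u::real_vector, 'v::real_vector) newton_datum \<Rightarrow> bool" where
  "newton_datum \<Xi> \<longleftrightarrow>
     subspace (nd_U \<Xi>) \<and> (\<exists>B. finite B \<and> span B = nd_U \<Xi>) \<and>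
     subspace (nd_V \<Xi>) \<and> (\<exists>B. finite B \<and> span B = nd_V \<Xi>) \<and>
     linear (nd_eta \<Xi>) \<and> inj (nd_eta \<Xi>) \<and> linear (nd_beta \<Xi>) \<and>
     range (nd_eta \<Xi>) = {x \<in> nd_V \<Xi>. nd_beta \<Xi> x = 0} \<and> nd_beta \<Xi> ` nd_V \<Xi> = nd_U \<Xi> \<and>
     finite (nd_pts \<Xi>) \<and> nd_pts \<Xi> \<subseteq> nd_V \<Xi>"

definition complete_newton_datum ::
    "('u::real_normed_vector, 'v::real_vector) newton_datum \<Rightarrow> bool" where
  "complete_newton_datum \<Xi> \<longleftrightarrow> newton_datum \<Xi> \<and>
     affine hull (nd_beta \<Xi> ` nd_pts \<Xi>) = nd_U \<Xi> \<and>
     0 \<in> (top_of_set (nd_U \<Xi>)) interior_of (convex hull (nd_beta \<Xi> ` nd_pts \<Xi>))"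

definition newton_splitting ::
    "('u::real_vector, 'v::real_vector) newton_datum \<Rightarrow> ('u \<Rightarrow> 'v) \<Rightarrow> bool" where
  "newton_splitting \<Xi> s \<longleftrightarrow>
     linear s \<and> s ` nd_U \<Xi> \<subseteq> nd_V \<Xi> \<and> (\<forall>x\<in>nd_U \<Xi>. nd_beta \<Xi> (s x) = x)"

text \<open>
  A quotient map by a subspace \<open>E\<close>. To keep the iterated quotients inside one type, \<open>V/E\<close> is
  realised by a system of representatives of the cosets which is itself a subspace, and the
  projection sends a vector to the representative of its coset (lemma \<open>quot_map\<close>).
  Which system is chosen is irrelevant up to canonical isomorphism.\<close>

definition quot_map :: "'a::real_vector set \<Rightarrow> 'a \<Rightarrow> 'a" where
  "quot_map E = (SOME q. linear q \<and> q \<circ> q = q \<and> {x. q x = 0} = E)"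

lemma quot_map:
  assumes "subspace E"
  shows "linear (quot_map E)"
    and "quot_map E (quot_map E x) = quot_map E x"
    and "quot_map E x = quot_map E y \<longleftrightarrow> x - y \<in> E"
    and "x - quot_map E x \<in> E"
    and "subspace V \<Longrightarrow> E \<subseteq> V \<Longrightarrow> quot_map E ` V \<subseteq> V"
proof -
  obtain B where B: "B \<subseteq> E" "independent B" "E \<subseteq> span B"
    using maximal_independent_subset[of E] by blast
  have spB: "span B = E" using B assms by (simp add: span_minimal subset_antisym)
  obtain g :: "'a \<Rightarrow> 'a" where g: "range g \<subseteq> span B" "linear g" "\<forall>x\<in>B. g x = x"
    using linear_independent_extend_subspace[OF B(2), of id] by auto
  have gE: "g x = x" if "x \<in> E" for x
    using linear_eq_on_span[OF g(2) linear_id, of B x] g(3) that spB by auto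
  have gg: "g (g x) = g x" for x using gE g(1) spB by blast
  have lin: "linear (\<lambda>x. x - g x)" 
    by (rule linear_compose_sub[OF linear_id[unfolded id_def] g(2)])
  have "\<exists>q. linear q \<and> q \<circ> q = q \<and> {x. q x = 0} = E"
  proof (intro exI[of _ "\<lambda>x. x - g x"] conjI)
    show "(\<lambda>x. x - g x) \<circ> (\<lambda>x. x - g x) = (\<lambda>x. x - g x)"
      by (auto simp: fun_eq_iff linear_diff[OF g(2)] gg)
    show "{x. x - g x = 0} = E"
    proof (intro equalityI subsetI)
      fix x assume "x \<in> {x. x - g x = 0}"
      then have "x = g x" by simp
      then show "x \<in> E" using g(1) spB by (metis rangeI subsetD)
    qed (simp add: gE)
  qed (rule lin)
  from someI_ex[OF this] have q: "linear (quot_map E)" "quot_map E \<circ> quot_map E = quot_map E"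
      "{x. quot_map E x = 0} = E"
    unfolding quot_map_def by blast+
  show "linear (quot_map E)" by (rule q)
  show idem: "quot_map E (quot_map E x) = quot_map E x" for x
    using fun_cong[OF q(2), of x] by simp
  show eq: "quot_map E x = quot_map E y \<longleftrightarrow> x - y \<in> E" for x y
  proof -
    have "x - y \<in> E \<longleftrightarrow> quot_map E (x - y) = 0" using q(3) by blast
    then show ?thesis by (simp add: linear_diff[OF q(1)])
  qed
  show mem: "x - quot_map E x \<in> E" for x
    using eq[of x "quot_map E x"] idem[of x] by simp
  show "quot_map E ` V \<subseteq> V" if "subspace V" "E \<subseteq> V"
  proof
    fix y assume "y \<in> quot_map E ` V"
    then obtain x where x: "y = quot_map E x" "x \<in> V" by blast
    have "x - (x - quot_map E x) \<in> V" using that x mem subspace_diff by blast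
    then show "y \<in> V" by (simp add: x)
  qed
qed

definition nd_pts' :: "('u::real_vector, 'v::real_vector) newton_datum \<Rightarrow> 'v set" where
  "nd_pts' \<Xi> = {w \<in> nd_pts \<Xi>. nd_beta \<Xi> w \<noteq> 0}"

definition nd_Delta :: "('u::real_vector, 'v::real_vector) newton_datum \<Rightarrow> 'v set" where
  "nd_Delta \<Xi> = convex hull (nd_pts' \<Xi>)"

definition nd_tau :: "('u::real_vector, 'v::real_vector) newton_datum \<Rightarrow> real" where
  "nd_tau \<Xi> = (LEAST c. nd_eta \<Xi> c \<in> nd_Delta \<Xi>)"

text \<open>The predicate \<open>face_of\<close> admits the whole polytope as a face, which is excluded here when the
  polytope is full-dimensional. \<open>LEAST\<close> on sets is with respect to inclusion.\<close>

definition nd_face :: "('u::real_vector, 'v::real_vector) newton_datum \<Rightarrow> 'v set" where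
  "nd_face \<Xi> = (LEAST F. F face_of nd_Delta \<Xi> \<and> nd_eta \<Xi> (nd_tau \<Xi>) \<in> F \<and>
     (F = nd_Delta \<Xi> \<longrightarrow> affine hull (nd_Delta \<Xi>) \<noteq> nd_V \<Xi>))"

definition nd_E :: "('u::real_vector, 'v::real_vector) newton_datum \<Rightarrow> 'v set" where
  "nd_E \<Xi> = span ((\<lambda>x. x - nd_eta \<Xi> (nd_tau \<Xi>)) ` nd_face \<Xi>)"

definition nd_sigma :: "('u::real_vector, 'v::real_vector) newton_datum \<Rightarrow> 'v \<Rightarrow> 'v" where
  "nd_sigma \<Xi> = quot_map (nd_E \<Xi>)"

definition nd_rho :: "('u::real_vector, 'v::real_vector) newton_datum \<Rightarrow> 'u \<Rightarrow> 'u" where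
  "nd_rho \<Xi> = quot_map (nd_beta \<Xi> ` nd_E \<Xi>)"

text \<open>The projections are \<open>\<sigma> : V \<rightarrow> V/E\<close> and \<open>\<rho> : U \<rightarrow> U/\<beta>(E)\<close>; lemma
  \<open>newton_step_beta\<close> shows that \<open>\<rho> \<circ> \<beta>\<close>, applied to representatives, is the map induced
  by \<open>\<beta>\<close>.\<close>

definition newton_step ::
    "('u::real_vector, 'v::real_vector) newton_datum \<Rightarrow> ('u, 'v) newton_datum" where
  "newton_step \<Xi> =
     \<lparr>nd_U = nd_rho \<Xi> ` nd_U \<Xi>,
      nd_V = nd_sigma \<Xi> ` nd_V \<Xi>,
      nd_eta = nd_sigma \<Xi> \<circ> nd_eta \<Xi>,
      nd_beta = nd_rho \<Xi> \<circ> nd_beta \<Xi>,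
      nd_pts = nd_sigma \<Xi> ` nd_pts' \<Xi>\<rparr>"

lemma newton_step_beta:
  assumes "linear (nd_beta \<Xi>)"
  shows "nd_beta (newton_step \<Xi>) (nd_sigma \<Xi> x) = nd_rho \<Xi> (nd_beta \<Xi> x)"
proof -
  have E: "subspace (nd_E \<Xi>)" by (simp add: nd_E_def)
  have \<beta>E: "subspace (nd_beta \<Xi> ` nd_E \<Xi>)" using assms E by (rule linear_subspace_image)
  have "x - nd_sigma \<Xi> x \<in> nd_E \<Xi>" unfolding nd_sigma_def by (rule quot_map(4)[OF E])
  then have "nd_beta \<Xi> x - nd_beta \<Xi> (nd_sigma \<Xi> x) \<in> nd_beta \<Xi> ` nd_E \<Xi>"
    using linear_diff[OF assms] by (metis imageI)
  then have "nd_rho \<Xi> (nd_beta \<Xi> x) = nd_rho \<Xi> (nd_beta \<Xi> (nd_sigma \<Xi> x))"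
    unfolding nd_rho_def by (simp add: quot_map(3)[OF \<beta>E])
  then show ?thesis by (simp add: newton_step_def)
qed

text \<open>Numbering starts at 0: \<open>newton_iter \<Xi> k\<close> is \<open>\<Xi>\<^sub>k\<^sub>+\<^sub>1\<close>, and \<open>newton_proj \<Xi> k\<close> is
  \<open>\<sigma>\<^sub>k \<circ> \<dots> \<circ> \<sigma>\<^sub>1\<close>.\<close>

definition newton_iter ::
    "('u::real_vector, 'v::real_vector) newton_datum \<Rightarrow> nat \<Rightarrow> ('u, 'v) newton_datum" where
  "newton_iter \<Xi> k = (newton_step ^^ k) \<Xi>"

primrec newton_proj ::
    "('u::real_vector, 'v::real_vector) newton_datum \<Rightarrow> nat \<Rightarrow> 'v \<Rightarrow> 'v" where
  "newton_proj \<Xi> 0 = id"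
| "newton_proj \<Xi> (Suc k) = nd_sigma (newton_iter \<Xi> k) \<circ> newton_proj \<Xi> k"

definition newton_length :: "('u::real_vector, 'v::real_vector) newton_datum \<Rightarrow> nat" where
  "newton_length \<Xi> = (LEAST k. dim (nd_U (newton_iter \<Xi> k)) = 0)"

text \<open>An element of \<open>V\<^sup>*\<close>; only its values on \<open>nd_V \<Xi>\<close> are meaningful.\<close>

definition d_crit_tilde :: "('u::real_vector, 'v::real_vector) newton_datum \<Rightarrow> 'v \<Rightarrow> real" where
  "d_crit_tilde \<Xi> =
     inv (nd_eta (newton_iter \<Xi> (newton_length \<Xi>))) \<circ> newton_proj \<Xi> (newton_length \<Xi>)"

definition d_crit ::
    "('u::real_vector, 'v::real_vector) newton_datum \<Rightarrow> ('u \<Rightarrow> 'v) \<Rightarrow> 'u \<Rightarrow> real" where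
  "d_crit \<Xi> s = d_crit_tilde \<Xi> \<circ> s"

section \<open>The Newton datum of a generalised Puiseux polynomial\<close>

definition newton_of_poly ::
    "nat \<Rightarrow> (nat \<Rightarrow> puiseux) \<Rightarrow> (nat \<Rightarrow> 'm::real_normed_vector) \<Rightarrow> ('m, real \<times> 'm) newton_datum" where
  "newton_of_poly n \<gamma> v =
     \<lparr>nd_U = UNIV, nd_V = UNIV, nd_eta = (\<lambda>c. (c, 0)), nd_beta = snd,
      nd_pts = (\<lambda>i. (Val (\<gamma> i), v i)) ` {1..n}\<rparr>"

definition poly_splitting :: "'m::real_normed_vector \<Rightarrow> real \<times> 'm" where
  "poly_splitting v = (0, v)"

lemma complete_newton_of_poly:
  assumes "character_lattice (M :: 'm::real_normed_vector set)" "complete_poly n (v :: nat \<Rightarrow> 'm)"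
  shows "complete_newton_datum (newton_of_poly n \<gamma> v)"
    and "newton_splitting (newton_of_poly n \<gamma> v) poly_splitting"
proof -
  obtain B :: "'m set" where B: "finite B" "span B = UNIV"
    using assms(1) by (auto simp: character_lattice_def)
  have "span ({0} \<times> B \<union> {(1::real, 0)}) = (UNIV :: (real \<times> 'm) set)"
  proof -
    have 1: "(0::real, x) \<in> span ({0} \<times> B)" for x
    proof -
      have "linear (\<lambda>x::'m. (0::real, x))" by (intro linearI) auto
      then have "span ((\<lambda>x. (0::real, x)) ` B) = (\<lambda>x. (0, x)) ` UNIV"
        using B(2) linear_span_image by metis
      moreover have "(\<lambda>x. (0::real, x)) ` B = {0} \<times> B" by auto
      ultimately show ?thesis by auto
    qed
    have "(c, x) \<in> span ({0} \<times> B \<union> {(1, 0)})" for c :: real and x :: 'm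
    proof -
      have "(0, x) \<in> span ({0} \<times> B \<union> {(1::real, 0)})"
        using span_mono[of "{0} \<times> B" "{0} \<times> B \<union> {(1::real, 0)}"] 1[of x] by blast
      then have "(0, x) + c *\<^sub>R (1, 0) \<in> span ({0} \<times> B \<union> {(1::real, 0)})"
        by (intro span_add span_scale) (auto intro: span_base)
      then show ?thesis by simp
    qed
    then show ?thesis by auto
  qed
  then have "\<exists>C. finite C \<and> span C = (UNIV :: (real \<times> 'm) set)"
    using B(1) by (intro exI[of _ "{0} \<times> B \<union> {(1::real, 0)}"]) auto
  moreover have "linear (\<lambda>c. (c, 0) :: real \<times> 'm)" by (intro linearI) auto
  moreover have "range (\<lambda>c. (c, 0) :: real \<times> 'm) = {x. snd x = 0}"
    by (auto simp: image_iff prod_eq_iff)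
  ultimately have "newton_datum (newton_of_poly n \<gamma> v)"
    using B by (auto simp: newton_datum_def newton_of_poly_def inj_on_def linear_snd)
  then show "complete_newton_datum (newton_of_poly n \<gamma> v)"
    using assms(2)
    by (auto simp: complete_newton_datum_def newton_of_poly_def complete_poly_def image_image
        interior_of_def interior_def)
  show "newton_splitting (newton_of_poly n \<gamma> v) poly_splitting"
    by (auto simp: newton_splitting_def newton_of_poly_def poly_splitting_def intro!: linearI)
qed

end

theory Submission
  imports Defs
begin

text \<open>
  Write \<open>p = e\<^sup>u t\<^sup>d exp(w)\<close> and \<open>\<nu>\<^sub>i = Val \<gamma>\<^sub>i + d(v\<^sub>i)\<close>. The leading terms of the critical
  point equations, read successively modulo the span of the \<open>v\<^sub>i\<close> already used, give a flag of
  subspaces: at a stage \<open>L\<close>, the vectors \<open>v\<^sub>i \<notin> L\<close> with minimal \<open>\<nu>\<^sub>i\<close> satisfy a positive linear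
  relation modulo \<open>L\<close>. Each step of this flag is a step of the Newton recursion, because the
  functional \<open>(c, x) \<mapsto> c + d x\<close> vanishes on \<open>E\<close> and so descends to the quotient; hence
  \<open>d\<close> is the canonical point. Conversely, a \<open>d\<close> with such a flag is obtained from linear programming
  duality, \<open>u\<close> from minimising sums of exponentials stage by stage, and \<open>w\<close> from Hensel's lemma: in a
  basis adapted to the flag the linearised equations are block triangular with definite diagonal
  blocks. The same block structure gives the uniqueness of \<open>u\<close> and \<open>w\<close>.\<close>

section \<open>The valuation filtration\<close>

text \<open>The field has no compactness, so a critical point cannot be found by minimising W
  itself: only finite real problems are minimised, and all terms above the leading ones come from an
  ultrametric iteration. The main obstacle is that the critical point equations have no common
  leading order. The equation dual to a basis vector \<open>b\<close> starts at its own exponent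
  \<open>\<mu> b\<close>, and a usable Jacobian appears only after each equation is rescaled by its
  own power of t. The adaptedness of the basis keeps the rescaled equations free of negative
  exponents. Injectivity of the Jacobian is established for all positive weights at once, because
  two kinds occur: \<open>g i * exp (u (v i))\<close> when solving for \<open>w\<close>, and the
  same times a difference quotient of \<open>exp\<close> when two candidates for \<open>u\<close>
  are compared. The flag stays in the fixed space of characters, whereas the recursion passes to
  quotients. The two are matched by taking \<open>L\<close> to be the kernel of the projection from
  that space to the current U.\<close>

definition vge :: "real \<Rightarrow> puiseux \<Rightarrow> bool" where
  "vge a c \<longleftrightarrow> (\<forall>x<a. pcoeff c x = 0)"

lemma vgeD: "vge a c \<Longrightarrow> pcoeff c x \<noteq> 0 \<Longrightarrow> a \<le> x"
  by (meson not_le vge_def)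

text \<open>Zero lies in every step of the filtration, whereas \<open>Val 0\<close> is a
  \<open>LEAST\<close> over an empty set. Estimates are therefore stated with \<open>vge\<close> and
  not with \<open>Val\<close>.\<close>

lemma vge_0 [simp]: "vge a 0"
  by (simp add: vge_def)

lemma vge_add: "vge a c \<Longrightarrow> vge a d \<Longrightarrow> vge a (c + d)"
  by (simp add: vge_def)

lemma vge_diff: "vge a c \<Longrightarrow> vge a d \<Longrightarrow> vge a (c - d)"
  by (simp add: vge_def)

lemma vge_minus: "vge a c \<Longrightarrow> vge a (- c)"
  by (simp add: vge_def)

lemma vge_minus_commute: "vge a (c - d) \<longleftrightarrow> vge a (d - c)"
  by (simp add: vge_def) (metis eq_iff_diff_eq_0)

lemma vge_scaleR: "vge a c \<Longrightarrow> vge a (r *\<^sub>R c)"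
  by (simp add: vge_def)

lemma vge_sum: "(\<And>i. i \<in> A \<Longrightarrow> vge a (f i)) \<Longrightarrow> vge a (sum f A)"
  by (simp add: vge_def pcoeff_sum)

lemma vge_mono: "vge b c \<Longrightarrow> a \<le> b \<Longrightarrow> vge a c"
  by (simp add: vge_def)

lemma vge_min1: "vge a c \<Longrightarrow> vge (min a b) c"
  and vge_min2: "vge b c \<Longrightarrow> vge (min a b) c"
  by (simp_all add: vge_def)

lemma vge_mult:
  assumes "vge a c" "vge b d"
  shows "vge (a + b) (c * d)"
  unfolding vge_def
proof (intro allI impI, rule ccontr)
  fix x assume x: "x < a + b" "pcoeff (c * d) x \<noteq> 0"
  then obtain y where y: "pcoeff c y \<noteq> 0" "pcoeff d (x - y) \<noteq> 0"
    using pmult_coeff_nz unfolding times_puiseux.rep_eq by blast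
  then have "a \<le> y" "b \<le> x - y" using assms vgeD by blast+
  then show False using x(1) by simp
qed

lemma vge_mult_left: "vge 0 c \<Longrightarrow> vge a d \<Longrightarrow> vge a (c * d)"
  using vge_mult[of 0 c a d] by simp

lemma vge_one: "vge 0 1"
  by (simp add: vge_def one_puiseux_def pcoeff_monom)

lemma vge_monom: "vge a (monom r a)"
  by (simp add: vge_def pcoeff_monom)

lemma vge_power: "vge a c \<Longrightarrow> vge (real n * a) (c ^ n)"
proof (induction n)
  case (Suc n)
  then have "vge (a + real n * a) (c * c ^ n)" by (intro vge_mult) auto
  then show ?case by (simp add: algebra_simps)
qed (simp add: vge_one)

text \<open>The filtration is separated: exponents are real, so multiples of \<delta> pass every one
  of them. This turns estimates to all orders into identities.\<close>

lemma vge_eq_0: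
  assumes "\<delta> > 0" "\<And>n::nat. vge (real n * \<delta>) c"
  shows "c = 0"
proof (rule puiseux_eqI)
  fix x
  obtain N where "x / \<delta> < real N" using reals_Archimedean2 by blast
  then have "x < real N * \<delta>" using assms(1) by (simp add: divide_less_eq)
  then show "pcoeff c x = pcoeff 0 x" using assms(2)[of N] by (simp add: vge_def)
qed

lemma pcoeff_mult_lowest:
  assumes "vge a c" "vge b d"
  shows "pcoeff (c * d) (a + b) = pcoeff c a * pcoeff d b"
proof -
  have "pcoeff (c * d) (a + b) = (\<Sum>y\<in>{a}. pcoeff c y * pcoeff d (a + b - y))"
  proof (rule pcoeff_times)
    fix y assume y: "pcoeff c y \<noteq> 0" "pcoeff d (a + b - y) \<noteq> 0"
    then have "a \<le> y" "b \<le> a + b - y" using assms vgeD by blast+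
    then show "y \<in> {a}" by simp
  qed simp
  then show ?thesis by simp
qed

lemma vge_Val: "vge (Val c) c"
  unfolding vge_def using Val_le by (meson not_le)

lemma Val_eqI: "vge a c \<Longrightarrow> pcoeff c a \<noteq> 0 \<Longrightarrow> Val c = a"
  unfolding Val_def by (rule Least_equality) (auto simp: vge_def not_less[symmetric])

lemma max_ideal_iff: "c \<in> max_ideal \<longleftrightarrow> (\<exists>\<epsilon>>0. vge \<epsilon> c)"
proof
  assume "c \<in> max_ideal"
  then show "\<exists>\<epsilon>>0. vge \<epsilon> c" using max_ideal_coeff by (simp add: vge_def)
next
  assume "\<exists>\<epsilon>>0. vge \<epsilon> c"
  then obtain \<epsilon> where e: "\<epsilon> > 0" "vge \<epsilon> c" by blast
  show "c \<in> max_ideal"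
  proof (cases "c = 0")
    case False
    then have "\<epsilon> \<le> Val c" using e pcoeff_Val vgeD by blast
    then show ?thesis using e by (simp add: max_ideal_def)
  qed (simp add: max_ideal_def)
qed

lemma subspace_max_ideal: "subspace max_ideal"
  unfolding subspace_def
proof (intro conjI ballI allI)
  show "0 \<in> max_ideal" by (simp add: max_ideal_def)
  show "x + y \<in> max_ideal" if xy: "x \<in> max_ideal" "y \<in> max_ideal" for x y
  proof -
    obtain a b where "a > 0" "vge a x" "b > 0" "vge b y" using xy max_ideal_iff by auto
    then have "vge (min a b) (x + y)" "min a b > 0" by (auto intro!: vge_add intro: vge_min1 vge_min2)
    then show ?thesis using max_ideal_iff by blast
  qed
  show "r *\<^sub>R x \<in> max_ideal" if "x \<in> max_ideal" for r x
    using that vge_scaleR by (auto simp: max_ideal_iff)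
qed

text \<open>Finitely many elements of the maximal ideal share a positive lower bound; it becomes the
  gain per step of the iterations below.\<close>

lemma common_vge:
  assumes "finite A" "\<And>i. i \<in> A \<Longrightarrow> f i \<in> max_ideal"
  shows "\<exists>\<epsilon>>0. \<forall>i\<in>A. vge \<epsilon> (f i)"
  using assms
proof (induction A rule: finite_induct)
  case (insert i A)
  then obtain a b where "a > 0" "\<forall>i\<in>A. vge a (f i)" "b > 0" "vge b (f i)"
    using max_ideal_iff by (metis insertCI)
  then have "min a b > 0" "\<forall>i\<in>insert i A. vge (min a b) (f i)" by (auto intro: vge_min1 vge_min2)
  then show ?case by blast
qed (auto intro: exI[of _ 1])

text \<open>On series without negative exponents, reduction modulo the maximal ideal is the
  coefficient at exponent 0.\<close>

lemma vge_0_split: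
  assumes "vge 0 c"
  shows "c - monom (pcoeff c 0) 0 \<in> max_ideal"
proof (cases "c - monom (pcoeff c 0) 0 = 0")
  case False
  let ?h = "c - monom (pcoeff c 0) 0"
  have "pcoeff ?h x = 0" if "x \<le> 0" for x
    using that assms by (cases "x = 0") (auto simp: vge_def pcoeff_monom)
  then have "Val ?h > 0" using pcoeff_Val[OF False] by (meson not_le)
  then show ?thesis by (simp add: max_ideal_def)
qed (simp add: max_ideal_def)

section \<open>Exponential and logarithm\<close>

text \<open>Identities for \<open>pexp\<close> are checked on these truncations, where the ring laws
  and the binomial theorem apply to finite sums.\<close>

definition texp :: "nat \<Rightarrow> puiseux \<Rightarrow> puiseux" where
  "texp N c = (\<Sum>k<N. (1 / fact k) *\<^sub>R c ^ k)"

lemma pexp_approx: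
  assumes "\<epsilon> > 0" "vge \<epsilon> c"
  shows "vge (real N * \<epsilon>) (pexp c - texp N c)"
  unfolding vge_def
proof (intro allI impI)
  fix x assume x: "x < real N * \<epsilon>"
  have c: "c \<in> max_ideal" using assms max_ideal_iff by blast
  have "pcoeff (pexp c) x = (\<Sum>k<N. 1 / fact k * pcoeff (c ^ k) x)"
    using power_series_coeff_eq[OF assms(1), of c x N] x assms(2)
    by (simp add: pexp_def pcoeff_power_series[OF c] vge_def)
  also have "\<dots> = pcoeff (texp N c) x"
    by (simp add: texp_def pcoeff_sum)
        (simp add: scaleR_conv_of_real)
  finally show "pcoeff (pexp c - texp N c) x = 0" by simp
qed

lemma vge_texp:
  assumes "\<epsilon> > 0" "vge \<epsilon> c"
  shows "vge 0 (texp N c)"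
  unfolding texp_def
proof (intro vge_sum vge_scaleR)
  show "vge 0 (c ^ k)" for k
    by (rule vge_mono[OF vge_power[OF assms(2)]]) (use assms in simp)
qed

lemma vge_pexp:
  assumes "\<epsilon> > 0" "vge \<epsilon> c"
  shows "vge 0 (pexp c)"
  using vge_add[OF pexp_approx[OF assms, of 0, simplified] vge_texp[OF assms, of 0]] by simp

lemma vge_pexp_1:
  assumes "\<epsilon> > 0" "vge \<epsilon> c"
  shows "vge \<epsilon> (pexp c - 1)"
  using pexp_approx[OF assms, of 1] by (simp add: texp_def)

lemma vge_pexp_2:
  assumes "\<epsilon> > 0" "vge \<epsilon> c"
  shows "vge (2 * \<epsilon>) (pexp c - 1 - c)"
  using pexp_approx[OF assms, of 2] by (simp add: texp_def numeral_2_eq_2 algebra_simps)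

text \<open>The binomial theorem accounts for the index pairs with i + j < N. The remaining pairs of
  the square have i + j \<ge> N, so their terms have order at least N times \<epsilon>.\<close>

lemma texp_add:
  assumes "\<epsilon> > 0" "vge \<epsilon> a" "vge \<epsilon> b"
  shows "vge (real N * \<epsilon>) (texp N a * texp N b - texp N (a + b))"
proof -
  define f where "f = (\<lambda>(i, j). (1 / (fact i * fact j) :: real) *\<^sub>R (a ^ i * b ^ j))"
  let ?T = "{(i, j). i + j < N}"
  let ?S = "{..<N} \<times> {..<N}"
  have TS: "?T \<subseteq> ?S" by auto
  have "texp N a * texp N b = sum f ?S"
    by (simp add: texp_def f_def sum_product sum.cartesian_product mult.commute)
  moreover have "texp N (a + b) = sum f ?T"
  proof -
    have "(1 / fact k) *\<^sub>R (a + b) ^ k = (\<Sum>i\<le>k. f (i, k - i))" for k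
    proof -
      have "(1 / fact k) *\<^sub>R (a + b) ^ k
          = (\<Sum>i\<le>k. (1 / fact k) *\<^sub>R (of_nat (k choose i) * a ^ i * b ^ (k - i)))"
        by (simp add: binomial_ring scaleR_right.sum)
      also have "\<dots> = (\<Sum>i\<le>k. f (i, k - i))"
      proof (rule sum.cong[OF refl])
        fix i assume "i \<in> {..k}"
        then have "real (k choose i) = fact k / (fact i * fact (k - i))"
          by (simp add: binomial_fact)
        moreover have "of_nat (k choose i) * a ^ i * b ^ (k - i) = real (k choose i) *\<^sub>R (a ^ i * b ^ (k - i))"
          by (simp add: scaleR_conv_of_real mult.assoc)
        ultimately show "(1 / fact k) *\<^sub>R (of_nat (k choose i) * a ^ i * b ^ (k - i)) = f (i, k - i)"
          by (simp add: f_def)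
      qed
      finally show ?thesis .
    qed
    then have "texp N (a + b) = (\<Sum>k<N. \<Sum>i\<le>k. f (i, k - i))" by (simp add: texp_def)
    also have "\<dots> = sum f ?T"
      using sum.triangle_reindex[of "\<lambda>i j. f (i, j)" N] by simp
    finally show ?thesis .
  qed
  ultimately have "texp N a * texp N b - texp N (a + b) = sum f (?S - ?T)"
    using TS by (simp add: sum_diff)
  also have "vge (real N * \<epsilon>) \<dots>"
  proof (rule vge_sum)
    fix p assume p: "p \<in> ?S - ?T"
    obtain i j where ij: "p = (i, j)" by (cases p)
    have "vge (real i * \<epsilon> + real j * \<epsilon>) (f p)"
      unfolding f_def ij using assms by (auto intro!: vge_scaleR vge_mult vge_power)
    moreover have "real N * \<epsilon> \<le> real i * \<epsilon> + real j * \<epsilon>"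
      using p ij assms(1) by (auto simp flip: distrib_right of_nat_add)
    ultimately show "vge (real N * \<epsilon>) (f p)" by (rule vge_mono)
  qed
  finally show ?thesis .
qed

lemma pexp_add:
  assumes "a \<in> max_ideal" "b \<in> max_ideal"
  shows "pexp (a + b) = pexp a * pexp b"
proof -
  obtain \<epsilon> where e: "\<epsilon> > 0" "vge \<epsilon> a" "vge \<epsilon> b"
    using common_vge[of "{a, b}" id] assms by auto
  note ab = vge_add[OF e(2,3)]
  have "pexp a * pexp b - pexp (a + b) = 0"
  proof (rule vge_eq_0[OF e(1)])
    fix N
    let ?E = "\<lambda>c. pexp c - texp N c"
    have "pexp a * pexp b - pexp (a + b) =
        pexp a * ?E b + texp N b * ?E a + (texp N a * texp N b - texp N (a + b)) - ?E (a + b)"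
      by (simp add: algebra_simps)
    also have "vge (real N * \<epsilon>) \<dots>"
      using e ab by (intro vge_add vge_diff vge_mult_left texp_add pexp_approx) (auto intro: vge_pexp vge_texp)
    finally show "vge (real N * \<epsilon>) (pexp a * pexp b - pexp (a + b))" .
  qed
  then show ?thesis by simp
qed

lemma pexp_0 [simp]: "pexp 0 = 1"
proof -
  have "pexp 0 - 1 = 0"
      proof (rule vge_eq_0[of 1])
    show "vge (real n * 1) (pexp 0 - 1)" for n
      \<comment> \<open>Zero has every positive order, so the estimate may be used with a bound that
        grows with \<open>n\<close>.\<close>
      by (rule vge_mono[OF vge_pexp_1[of "real n + 1" 0]]) auto
  qed simp
  then show ?thesis by simp
qed

text \<open>The derivative of \<open>pexp\<close> at a point of the maximal ideal is 1 modulo that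
  ideal, so replacing a difference of exponentials by the difference of the arguments gains
  \<epsilon>. Every contraction below rests on this gain.\<close>

lemma pexp_diff_estimate:
  assumes "\<epsilon> > 0" "vge \<epsilon> a" "vge \<epsilon> b" "\<epsilon> \<le> \<alpha>" "vge \<alpha> (a - b)"
  shows "vge (\<alpha> + \<epsilon>) (pexp a - pexp b - (a - b))"
proof -
  have m: "b \<in> max_ideal" "a - b \<in> max_ideal"
    using assms max_ideal_iff[of b] max_ideal_iff[of "a - b"] by (auto intro: order_less_le_trans)
  have "pexp a = pexp b * pexp (a - b)" using pexp_add[OF m] by simp
  then have "pexp a - pexp b - (a - b) =
      pexp b * (pexp (a - b) - 1 - (a - b)) + (a - b) * (pexp b - 1)"
    by (simp add: algebra_simps)
  also have "vge (\<alpha> + \<epsilon>) \<dots>"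
  proof (rule vge_add)
    have "vge (2 * \<alpha>) (pexp (a - b) - 1 - (a - b))" using assms(1,4,5) by (intro vge_pexp_2) auto
    then have "vge (\<alpha> + \<epsilon>) (pexp (a - b) - 1 - (a - b))"
      by (rule vge_mono) (use assms(4) in simp)
    then show "vge (\<alpha> + \<epsilon>) (pexp b * (pexp (a - b) - 1 - (a - b)))"
      using vge_pexp[OF assms(1,3)] by (intro vge_mult_left)
    show "vge (\<alpha> + \<epsilon>) ((a - b) * (pexp b - 1))"
      using vge_mult[OF assms(5) vge_pexp_1[OF assms(1,3)]] .
  qed
  finally show ?thesis .
qed

lemma pcoeff_pexp_0:
  assumes "c \<in> max_ideal"
  shows "pcoeff (pexp c) 0 = 1"
proof -
  obtain \<epsilon> where "\<epsilon> > 0" "vge \<epsilon> c" using assms max_ideal_iff by blast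
  then have "pcoeff (pexp c - 1) 0 = 0" using vge_pexp_1 unfolding vge_def by blast
  then show ?thesis by (simp add: one_puiseux_def pcoeff_monom)
qed

text \<open>Banach's fixed point theorem for the valuation: a contraction is a map that raises the
  order of a difference by a fixed \<epsilon>. Completeness holds because each coefficient of the
  iterates is eventually constant.\<close>

lemma ultrametric_fixed_point:
  fixes \<Phi> :: "('j \<Rightarrow> puiseux) \<Rightarrow> 'j \<Rightarrow> puiseux"
  assumes e: "\<epsilon> > 0"
    and self: "\<And>x. (\<And>j. vge \<epsilon> (x j)) \<Longrightarrow> (\<And>j. vge \<epsilon> (\<Phi> x j))"
    and contr: "\<And>x y \<alpha>. (\<And>j. vge \<epsilon> (x j)) \<Longrightarrow> (\<And>j. vge \<epsilon> (y j)) \<Longrightarrow> \<epsilon> \<le> \<alpha> \<Longrightarrow>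
        (\<And>j. vge \<alpha> (x j - y j)) \<Longrightarrow> (\<And>j. vge (\<alpha> + \<epsilon>) (\<Phi> x j - \<Phi> y j))"
  shows "\<exists>x. (\<forall>j. vge \<epsilon> (x j)) \<and> \<Phi> x = x"
proof -
  define s where "s n = (\<Phi> ^^ n) (\<lambda>_. 0)" for n
  have sSuc: "s (Suc n) = \<Phi> (s n)" for n by (simp add: s_def)
  have sv: "vge \<epsilon> (s n j)" for n j
    by (induction n arbitrary: j) (auto simp: sSuc intro!: self simp: s_def[of 0])
  have step: "vge (real (Suc n) * \<epsilon>) (s (Suc n) j - s n j)" for n j
  proof (induction n arbitrary: j)
    case 0
    then show ?case using sv by (auto intro!: vge_diff)
  next
    case (Suc n)
    have "vge (real (Suc n) * \<epsilon> + \<epsilon>) (\<Phi> (s (Suc n)) j - \<Phi> (s n) j)"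
      by (rule contr) (use sv Suc e in auto)
    then show ?case by (simp add: sSuc algebra_simps)
  qed
  have steps: "vge (real (Suc n) * \<epsilon>) (s (n + k) j - s n j)" for n k j
  proof (induction k)
    case (Suc k)
    have "vge (real (Suc n) * \<epsilon>) (s (Suc (n + k)) j - s (n + k) j)"
      by (rule vge_mono[OF step]) (use e in auto)
    from vge_add[OF this Suc] show ?case by simp
  qed simp
  have "\<exists>n. x < real n * \<epsilon>" for x
    using reals_Archimedean2[of "x / \<epsilon>"] e by (simp add: divide_less_eq)
  then obtain N where N: "\<And>x. x < real (N x) * \<epsilon>" by metis
  have stable: "pcoeff (s n j) x = pcoeff (s m j) x" if "x < real n * \<epsilon>" "n \<le> m" for n m j x
  proof -
    have "vge (real n * \<epsilon>) (s m j - s n j)"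
      using vge_mono[OF steps[of n "m - n" j], of "real n * \<epsilon>"] that e by auto
    then show ?thesis using that(1) by (simp add: vge_def)
  qed
  \<comment> \<open>The coefficient at \<open>x\<close> is read off from an iterate in which it no
    longer changes. Below a bound \<open>b\<close> all these coefficients agree with those of the
    single iterate \<open>s (N b)\<close>, so the support is admissible.\<close>
  define L where "L j = Abs_puiseux (\<lambda>x. pcoeff (s (N x) j) x)" for j
  have N': "pcoeff (s (N x) j) x = pcoeff (s n j) x" if "x < real n * \<epsilon>" for n j x
    using stable[of x n "N x" j] stable[of x "N x" n j] that N by (metis nle_le)
  have L: "pcoeff (L j) x = pcoeff (s (N x) j) x" for j x
  proof -
    have "finite ({x. pcoeff (s (N x) j) x \<noteq> 0} \<inter> {..b})" for b
    proof (rule finite_subset[OF _ finite_psupp[of "s (N b) j" b]])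
      show "{x. pcoeff (s (N x) j) x \<noteq> 0} \<inter> {..b} \<subseteq> psupp (s (N b) j) \<inter> {..b}"
      proof
        fix x assume "x \<in> {x. pcoeff (s (N x) j) x \<noteq> 0} \<inter> {..b}"
        moreover have "x < real (N b) * \<epsilon>" if "x \<le> b" using N[of b] that by simp
        ultimately show "x \<in> psupp (s (N b) j) \<inter> {..b}" using N'[of x "N b" j] by auto
      qed
    qed
    then have "puiseux_support {x. pcoeff (s (N x) j) x \<noteq> 0}" by (simp add: puiseux_support_iff)
    then show ?thesis by (simp add: L_def Abs_puiseux_inverse)
  qed
  have Ls: "vge (real n * \<epsilon>) (L j - s n j)" for n j
    using N' by (simp add: vge_def L)
  have Lv: "vge \<epsilon> (L j)" for j
    using vge_add[OF Ls[of 1 j, simplified] sv[of 1 j]] by simp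
  have "\<Phi> L j - L j = 0" for j
  proof (rule vge_eq_0[OF e])
    fix n
    have "vge (real (Suc n) * \<epsilon> + \<epsilon>) (\<Phi> L j - \<Phi> (s (Suc n)) j)"
      by (rule contr) (use Lv sv Ls[of "Suc n"] e in auto)
    then have "vge (real (Suc n) * \<epsilon> + \<epsilon>) (\<Phi> L j - s (Suc (Suc n)) j)"
      by (simp only: sSuc)
    then have "vge (real n * \<epsilon>) (\<Phi> L j - s (Suc (Suc n)) j)"
      by (rule vge_mono) (use e in \<open>simp add: algebra_simps\<close>)
    moreover have "vge (real n * \<epsilon>) (L j - s (Suc (Suc n)) j)"
      by (rule vge_mono[OF Ls]) (use e in auto)
    ultimately show "vge (real n * \<epsilon>) (\<Phi> L j - L j)"
      using vge_diff[of "real n * \<epsilon>" "\<Phi> L j - s (Suc (Suc n)) j" "L j - s (Suc (Suc n)) j"] by simp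
  qed
  then show ?thesis using Lv by (intro exI[of _ L]) (auto simp: fun_eq_iff)
qed

text \<open>The logarithm is obtained as the fixed point of w = h - (pexp w - 1 - w), whose
  right-hand side contracts because the bracket is of second order. The index type
  \<open>unit\<close> expresses a single unknown.\<close>

lemma pexp_surj:
  assumes "h \<in> max_ideal"
  shows "\<exists>w\<in>max_ideal. pexp w = 1 + h"
proof -
  obtain \<epsilon> where e: "\<epsilon> > 0" "vge \<epsilon> h" using assms max_ideal_iff by blast
  have "\<exists>x. (\<forall>j::unit. vge \<epsilon> (x j)) \<and> (\<lambda>j. h - (pexp (x j) - 1 - x j)) = x"
  proof (rule ultrametric_fixed_point[OF e(1)])
    fix x :: "unit \<Rightarrow> puiseux" and j assume x: "\<And>j. vge \<epsilon> (x j)"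
    have "vge \<epsilon> (pexp (x j) - 1)" by (rule vge_pexp_1) (use e x in auto)
    then show "vge \<epsilon> (h - (pexp (x j) - 1 - x j))" 
      using x[of j] e(2) by (blast intro: vge_diff)
  next
    fix x y :: "unit \<Rightarrow> puiseux" and j \<alpha>
    assume x: "\<And>j. vge \<epsilon> (x j)" "\<And>j. vge \<epsilon> (y j)" "\<epsilon> \<le> \<alpha>" "\<And>j. vge \<alpha> (x j - y j)"
    have "vge (\<alpha> + \<epsilon>) (- (pexp (x j) - pexp (y j) - (x j - y j)))"
      by (rule vge_minus[OF pexp_diff_estimate[OF e(1) x]])
    then show "vge (\<alpha> + \<epsilon>) (h - (pexp (x j) - 1 - x j) - (h - (pexp (y j) - 1 - y j)))"
      by (simp add: algebra_simps)
  qed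
  then obtain x :: "unit \<Rightarrow> puiseux" where x: "vge \<epsilon> (x ())" "(\<lambda>j. h - (pexp (x j) - 1 - x j)) = x"
    by blast
  have "h - (pexp (x ()) - 1 - x ()) = x ()" using fun_cong[OF x(2), of "()"] .
  then have "pexp (x ()) = 1 + h" by (simp add: algebra_simps)
  moreover have "x () \<in> max_ideal" using x e max_ideal_iff by blast
  ultimately show ?thesis by blast
qed

text \<open>When the exponentials agree, \<open>pexp_diff_estimate\<close> bounds
  \<open>a - b\<close> itself, so any bound on its order improves by \<epsilon> without end.\<close>

lemma pexp_inj:
  assumes "a \<in> max_ideal" "b \<in> max_ideal" "pexp a = pexp b"
  shows "a = b"
proof -
  obtain \<epsilon> where e: "\<epsilon> > 0" "vge \<epsilon> a" "vge \<epsilon> b"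
    using common_vge[of "{a, b}" id] assms by auto
  have "vge (real (Suc n) * \<epsilon>) (a - b)" for n
  proof (induction n)
    case 0
    then show ?case using e by (simp add: vge_diff)
  next
    case (Suc n)
    have "vge (real (Suc n) * \<epsilon> + \<epsilon>) (pexp a - pexp b - (a - b))"
      by (rule pexp_diff_estimate) (use e Suc in auto)
    then show ?case using assms(3) by (simp add: algebra_simps vge_minus_commute)
  qed
  then have "vge (real n * \<epsilon>) (a - b)" for n
    by (rule vge_mono[of "real (Suc n) * \<epsilon>"]) (use e in auto)
  then show ?thesis using vge_eq_0[OF e(1), of "a - b"] by simp
qed

section \<open>Hensel's lemma\<close>

lemma pcoeff_scaleR_of_real: "pcoeff (r *\<^sub>R f) x = of_real r * pcoeff f x"
  unfolding pcoeff_scaleR by (rule scaleR_conv_of_real)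

text \<open>The hypothesis \<open>lin\<close> says that the Jacobian of the system at the origin is
  the identity modulo the maximal ideal. Hence subtracting the system from its argument is a
  contraction.\<close>

lemma linear_system_estimate:
  fixes C :: "'b \<Rightarrow> 'i \<Rightarrow> puiseux" and A :: "'i \<Rightarrow> 'b \<Rightarrow> real"
  assumes B: "finite B"
    and C0: "\<And>b i. b \<in> B \<Longrightarrow> i \<in> I \<Longrightarrow> vge 0 (C b i)"
    and lin: "\<And>b l. b \<in> B \<Longrightarrow> l \<in> B \<Longrightarrow>
        (\<Sum>i\<in>I. pcoeff (C b i) 0 * of_real (A i l)) = (if l = b then 1 else 0)"
    and e: "\<epsilon> > 0" "\<epsilon> \<le> \<alpha>"
    and C: "\<And>b i. b \<in> B \<Longrightarrow> i \<in> I \<Longrightarrow> vge \<epsilon> (C b i - monom (pcoeff (C b i) 0) 0)"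
    and X: "\<And>b. b \<in> B \<Longrightarrow> vge \<epsilon> (X b)" "\<And>b. b \<in> B \<Longrightarrow> vge \<epsilon> (Y b)"
      "\<And>b. b \<in> B \<Longrightarrow> vge \<alpha> (X b - Y b)"
    and b: "b \<in> B"
  shows "vge (\<alpha> + \<epsilon>) (X b - Y b - ((\<Sum>i\<in>I. C b i * pexp (\<Sum>l\<in>B. A i l *\<^sub>R X l)) -
    (\<Sum>i\<in>I. C b i * pexp (\<Sum>l\<in>B. A i l *\<^sub>R Y l))))"
proof -
  define F where "F X i = pexp (\<Sum>l\<in>B. A i l *\<^sub>R X l)" for X i
  define m where "m i = pcoeff (C b i) 0" for i
  define \<delta> where "\<delta> i = (\<Sum>l\<in>B. A i l *\<^sub>R X l) - (\<Sum>l\<in>B. A i l *\<^sub>R Y l)" for i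
  have \<delta>: "\<delta> i = (\<Sum>l\<in>B. A i l *\<^sub>R (X l - Y l))" for i
    by (simp add: \<delta>_def sum_subtractf scaleR_diff_right)
  have \<delta>v: "vge \<alpha> (\<delta> i)" for i
    unfolding \<delta> by (intro vge_sum vge_scaleR X)
  \<comment> \<open>The residues of the coefficients, applied to the differences of the exponents,
    reproduce \<open>X - Y\<close> exactly; only error terms remain.\<close>
  have main: "(\<Sum>i\<in>I. monom (m i) 0 * \<delta> i) = X b - Y b"
  proof (rule puiseux_eqI)
    fix x
    let ?d = "\<lambda>l. pcoeff (X l - Y l) x"
    have "pcoeff (\<Sum>i\<in>I. monom (m i) 0 * \<delta> i) x = (\<Sum>i\<in>I. m i * (\<Sum>l\<in>B. of_real (A i l) * ?d l))"
      by (simp add: pcoeff_sum \<delta> pcoeff_scaleR_of_real del: pcoeff_diff pcoeff_scaleR)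
    also have "\<dots> = (\<Sum>l\<in>B. (\<Sum>i\<in>I. m i * of_real (A i l)) * ?d l)"
      unfolding sum_distrib_left sum_distrib_right by (subst sum.swap) (simp add: mult.assoc)
    also have "\<dots> = (\<Sum>l\<in>B. if l = b then ?d l else 0)"
      by (intro sum.cong refl) (simp add: m_def lin[OF b])
    also have "\<dots> = ?d b" using B b by simp
    finally show "pcoeff (\<Sum>i\<in>I. monom (m i) 0 * \<delta> i) x = ?d b" .
  qed
  \<comment> \<open>Two errors remain: replacing a coefficient by its residue, and replacing
    \<open>pexp\<close> by its linear part. Each gains \<epsilon>.\<close>
  have eq: "X b - Y b - ((\<Sum>i\<in>I. C b i * F X i) - (\<Sum>i\<in>I. C b i * F Y i)) =
      - (\<Sum>i\<in>I. (C b i - monom (m i) 0) * \<delta> i + C b i * (F X i - F Y i - \<delta> i))"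
    unfolding main[symmetric]
    by (simp add: algebra_simps sum.distrib sum_subtractf)
  show ?thesis
    unfolding F_def[symmetric] eq
  proof (intro vge_minus vge_sum vge_add)
    fix i assume i: "i \<in> I"
    show "vge (\<alpha> + \<epsilon>) ((C b i - monom (m i) 0) * \<delta> i)"
      using vge_mult[OF C[OF b i] \<delta>v[of i]] by (simp add: m_def add.commute)
    have "vge (\<alpha> + \<epsilon>) (F X i - F Y i - \<delta> i)"
      unfolding F_def \<delta>_def
      by (rule pexp_diff_estimate[OF e(1) _ _ e(2)])
        (use \<delta>v[of i] in \<open>auto simp: \<delta>_def intro!: vge_sum vge_scaleR X\<close>)
    then show "vge (\<alpha> + \<epsilon>) (C b i * (F X i - F Y i - \<delta> i))"
      by (rule vge_mult_left[OF C0[OF b i]])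
  qed
qed

text \<open>Modulo \<open>\<mm>\<close> and terms of second order, the system below reads \<open>X = 0\<close>.\<close>

lemma hensel_exists:
  fixes C :: "'b \<Rightarrow> 'i \<Rightarrow> puiseux" and A :: "'i \<Rightarrow> 'b \<Rightarrow> real"
  assumes B: "finite B" and I: "finite I"
    and C0: "\<And>b i. b \<in> B \<Longrightarrow> i \<in> I \<Longrightarrow> vge 0 (C b i)"
    and const: "\<And>b. b \<in> B \<Longrightarrow> (\<Sum>i\<in>I. pcoeff (C b i) 0) = 0"
    and lin: "\<And>b l. b \<in> B \<Longrightarrow> l \<in> B \<Longrightarrow>
        (\<Sum>i\<in>I. pcoeff (C b i) 0 * of_real (A i l)) = (if l = b then 1 else 0)"
  shows "\<exists>X. (\<forall>b. X b \<in> max_ideal) \<and>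
    (\<forall>b\<in>B. (\<Sum>i\<in>I. C b i * pexp (\<Sum>l\<in>B. A i l *\<^sub>R X l)) = 0)"
proof -
  let ?D = "\<lambda>b i. C b i - monom (pcoeff (C b i) 0) 0"
  have "\<exists>\<epsilon>>0. \<forall>p\<in>B \<times> I. vge \<epsilon> (case p of (b, i) \<Rightarrow> ?D b i)"
    by (rule common_vge) (use B I C0 vge_0_split in auto)
  then obtain \<epsilon> where e: "\<epsilon> > 0" "\<And>b i. b \<in> B \<Longrightarrow> i \<in> I \<Longrightarrow> vge \<epsilon> (?D b i)"
    by auto
  define G where "G X b = (\<Sum>i\<in>I. C b i * pexp (\<Sum>l\<in>B. A i l *\<^sub>R X l))" for X b
  \<comment> \<open>Newton iteration with the identity in place of the inverse Jacobian. The value 0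
    off \<open>B\<close> makes the bounds hold for every index, as the fixed point lemma
    demands.\<close>
  define \<Phi> where "\<Phi> X b = (if b \<in> B then X b - G X b else 0)" for X b
  note est = linear_system_estimate[OF B C0 lin e(1) _ e(2), folded G_def]
  \<comment> \<open>By \<open>const\<close> the residues cancel at the origin, so the iteration
    starts with an error in the maximal ideal. Together with the contraction this shows that
    \<open>\<Phi>\<close> preserves order \<epsilon>.\<close>
  have \<Phi>0: "vge \<epsilon> (\<Phi> (\<lambda>_. 0) b)" for b
  proof (cases "b \<in> B")
    case True
    have "(\<Sum>i\<in>I. monom (pcoeff (C b i) 0) 0) = 0"
    proof (rule puiseux_eqI)
      show "pcoeff (\<Sum>i\<in>I. monom (pcoeff (C b i) 0) 0) x = pcoeff 0 x" for x
        using const[OF True] by (cases "x = 0") (simp_all add: pcoeff_sum pcoeff_monom)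
    qed
    then have "G (\<lambda>_. 0) b = (\<Sum>i\<in>I. ?D b i)"
      by (simp add: G_def sum_subtractf)
    then have "vge \<epsilon> (G (\<lambda>_. 0) b)" using e(2) True by (auto intro: vge_sum)
    then show ?thesis using True by (simp add: \<Phi>_def vge_minus)
  qed (simp add: \<Phi>_def)
  have contr: "vge (\<alpha> + \<epsilon>) (\<Phi> X b - \<Phi> Y b)"
    if "\<And>b. vge \<epsilon> (X b)" "\<And>b. vge \<epsilon> (Y b)" "\<epsilon> \<le> \<alpha>" "\<And>b. vge \<alpha> (X b - Y b)" for X Y :: "'b \<Rightarrow> puiseux" and \<alpha> b
  proof (cases "b \<in> B")
    case True
    have "vge (\<alpha> + \<epsilon>) (X b - Y b - (G X b - G Y b))" by (rule est) (use that True in auto)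
    then show ?thesis using True by (simp add: \<Phi>_def algebra_simps)
  qed (simp add: \<Phi>_def)
  have "\<exists>X. (\<forall>b. vge \<epsilon> (X b)) \<and> \<Phi> X = X"
  proof (rule ultrametric_fixed_point[OF e(1) _ contr])
    fix X :: "'b \<Rightarrow> puiseux" and b assume X: "\<And>b. vge \<epsilon> (X b)"
    have "vge (\<epsilon> + \<epsilon>) (\<Phi> X b - \<Phi> (\<lambda>_. 0) b)" by (rule contr) (use X in auto)
    then have "vge \<epsilon> (\<Phi> X b - \<Phi> (\<lambda>_. 0) b)" by (rule vge_mono) (use e in simp)
    from vge_add[OF this \<Phi>0[of b]] show "vge \<epsilon> (\<Phi> X b)" by simp
  qed auto
  then obtain X where X: "\<And>b. vge \<epsilon> (X b)" "\<Phi> X = X" by blast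
  have "G X b = 0" if "b \<in> B" for b
    using fun_cong[OF X(2), of b] that by (simp add: \<Phi>_def)
  then show ?thesis using X(1) e(1) max_ideal_iff by (intro exI[of _ X]) (auto simp: G_def)
qed

text \<open>At two solutions the system takes the same value 0, so the contraction estimate applies
  to \<open>X - Y\<close> alone and raises its order indefinitely.\<close>

lemma hensel_unique:
  fixes C :: "'b \<Rightarrow> 'i \<Rightarrow> puiseux" and A :: "'i \<Rightarrow> 'b \<Rightarrow> real"
  assumes B: "finite B" and I: "finite I"
    and C0: "\<And>b i. b \<in> B \<Longrightarrow> i \<in> I \<Longrightarrow> vge 0 (C b i)"
    and lin: "\<And>b l. b \<in> B \<Longrightarrow> l \<in> B \<Longrightarrow>
        (\<Sum>i\<in>I. pcoeff (C b i) 0 * of_real (A i l)) = (if l = b then 1 else 0)"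
    and X: "\<And>b. b \<in> B \<Longrightarrow> X b \<in> max_ideal"
      "\<And>b. b \<in> B \<Longrightarrow> (\<Sum>i\<in>I. C b i * pexp (\<Sum>l\<in>B. A i l *\<^sub>R X l)) = 0"
    and Y: "\<And>b. b \<in> B \<Longrightarrow> Y b \<in> max_ideal"
      "\<And>b. b \<in> B \<Longrightarrow> (\<Sum>i\<in>I. C b i * pexp (\<Sum>l\<in>B. A i l *\<^sub>R Y l)) = 0"
    and b: "b \<in> B"
  shows "X b = Y b"
proof -
  let ?D = "\<lambda>b i. C b i - monom (pcoeff (C b i) 0) 0"
  have "\<exists>\<epsilon>>0. \<forall>p\<in>B \<times> I. vge \<epsilon> (case p of (b, i) \<Rightarrow> ?D b i)"
    by (rule common_vge) (use B I C0 vge_0_split in auto)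
  then obtain \<epsilon>1 where e1: "\<epsilon>1 > 0" "\<And>b i. b \<in> B \<Longrightarrow> i \<in> I \<Longrightarrow> vge \<epsilon>1 (?D b i)"
    by auto
  obtain \<epsilon>2 where e2: "\<epsilon>2 > 0" "\<And>b. b \<in> B \<Longrightarrow> vge \<epsilon>2 (X b)"
    using common_vge[OF B, of X] X(1) by blast
  obtain \<epsilon>3 where e3: "\<epsilon>3 > 0" "\<And>b. b \<in> B \<Longrightarrow> vge \<epsilon>3 (Y b)"
    using common_vge[OF B, of Y] Y(1) by blast
  define \<epsilon> where "\<epsilon> = Min {\<epsilon>1, \<epsilon>2, \<epsilon>3}"
  have \<epsilon>: "0 < \<epsilon>" "\<epsilon> \<le> \<epsilon>1" "\<epsilon> \<le> \<epsilon>2" "\<epsilon> \<le> \<epsilon>3"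
    using e1 e2 e3 by (auto simp: \<epsilon>_def)
  have e: "\<epsilon> > 0" "\<And>b i. b \<in> B \<Longrightarrow> i \<in> I \<Longrightarrow> vge \<epsilon> (?D b i)"
      "\<And>b. b \<in> B \<Longrightarrow> vge \<epsilon> (X b)" "\<And>b. b \<in> B \<Longrightarrow> vge \<epsilon> (Y b)"
    using \<epsilon> vge_mono[OF e1(2)] vge_mono[OF e2(2)] vge_mono[OF e3(2)] by auto
  have v: "vge (real (Suc n) * \<epsilon>) (X b - Y b)" if "b \<in> B" for n b
    using that
  proof (induction n arbitrary: b)
    case 0
    then show ?case using e(3,4) by (simp add: vge_diff)
  next
    case (Suc n)
    have "vge (real (Suc n) * \<epsilon> + \<epsilon>) (X b - Y b - ((\<Sum>i\<in>I. C b i * pexp (\<Sum>l\<in>B. A i l *\<^sub>R X l)) -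
        (\<Sum>i\<in>I. C b i * pexp (\<Sum>l\<in>B. A i l *\<^sub>R Y l))))"
      by (rule linear_system_estimate[OF B C0 lin e(1) _ e(2)]) (use e Suc in auto)
    then show ?case using Suc.prems by (simp add: X(2) Y(2) algebra_simps)
  qed
  have "vge (real n * \<epsilon>) (X b - Y b)" for n
    by (rule vge_mono[OF v[OF b, of n]]) (use e in auto)
  then show ?thesis using vge_eq_0[OF e(1), of "X b - Y b"] by simp
qed

section \<open>Points of the torus\<close>

lemma monom_mult: "monom a \<mu> * monom b \<nu> = monom (a * b) (\<mu> + \<nu>)"
  by (rule puiseux_eqI) (auto simp: pcoeff_monom)

lemma monom_1_0: "monom 1 0 = 1"
  by (simp add: one_puiseux_def)

lemma vge_pexp_max_ideal: "c \<in> max_ideal \<Longrightarrow> vge 0 (pexp c)"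
  using vge_pexp by (auto simp: max_ideal_iff)

lemma polar_lowest:
  assumes "m \<in> max_ideal"
  shows "vge \<delta> (monom (of_real (exp a)) \<delta> * pexp m)"
    and "pcoeff (monom (of_real (exp a)) \<delta> * pexp m) \<delta> = of_real (exp a)"
    and "Val (monom (of_real (exp a)) \<delta> * pexp m) = \<delta>"
    and "monom (of_real (exp a)) \<delta> * pexp m \<in> Kpos"
proof -
  let ?c = "monom (of_real (exp a)) \<delta> * pexp m"
  show v: "vge \<delta> ?c"
    using vge_mult[OF vge_monom vge_pexp_max_ideal[OF assms], of \<delta> "of_real (exp a)"] by simp
  show c: "pcoeff ?c \<delta> = of_real (exp a)" by (simp add: pcoeff_pexp_0[OF assms])
  have nz: "complex_of_real (exp a) \<noteq> 0" by (simp only: of_real_eq_0_iff exp_not_eq_zero not_False_eq_True)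
  show V: "Val ?c = \<delta>" by (rule Val_eqI[OF v]) (simp only: c nz not_False_eq_True)
  have "?c \<noteq> 0" using c nz pcoeff_0 by metis
  then show "?c \<in> Kpos" unfolding Kpos_def using c V by (intro CollectI conjI exI[of _ "exp a"]) auto
qed

text \<open>Dividing by the leading term leaves an element of 1 plus the maximal ideal, which is the
  image of \<open>pexp\<close>; the positive leading coefficient is a real exponential.\<close>

lemma Kpos_polar:
  assumes "c \<in> Kpos"
  shows "\<exists>a \<delta>. \<exists>m\<in>max_ideal. c = monom (of_real (exp a)) \<delta> * pexp m"
proof -
  obtain r where r: "r > 0" "pcoeff c (Val c) = complex_of_real r" using assms by (auto simp: Kpos_def)
  define h where "h = monom (of_real (1 / r)) (- Val c) * c"
  have "vge (- Val c + Val c) h" unfolding h_def by (rule vge_mult[OF vge_monom vge_Val])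
  moreover have h0: "pcoeff h 0 = 1" using r by (simp add: h_def flip: of_real_mult)
  ultimately have "h - 1 \<in> max_ideal" using vge_0_split[of h] by (simp add: monom_1_0)
  then obtain m where m: "m \<in> max_ideal" "pexp m = h" using pexp_surj[of "h - 1"] by auto
  have "monom (of_real r) (Val c) * monom (of_real (1 / r)) (- Val c) = 1"
    using r by (simp add: monom_mult monom_1_0 flip: of_real_mult)
  then have "c = monom (of_real (exp (ln r))) (Val c) * pexp m"
    using r by (simp add: m h_def flip: mult.assoc)
  then show ?thesis using m by blast
qed

text \<open>The lowest exponent recovers \<delta> and its coefficient recovers \<open>a\<close>;
  after cancelling the monomial, injectivity of \<open>pexp\<close> recovers
  \<open>m\<close>.\<close>

lemma polar_eq_iff:
  assumes "m \<in> max_ideal" "m' \<in> max_ideal"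
    and eq: "monom (of_real (exp a)) \<delta> * pexp m = monom (of_real (exp a')) \<delta>' * pexp m'"
  shows "a = a' \<and> \<delta> = \<delta>' \<and> m = m'"
proof -
  have d: "\<delta> = \<delta>'" using polar_lowest(3)[OF assms(1)] polar_lowest(3)[OF assms(2)] eq by metis
  then have "complex_of_real (exp a) = of_real (exp a')"
    using polar_lowest(2)[OF assms(1)] polar_lowest(2)[OF assms(2)] eq by metis
  then have a: "a = a'" by (simp only: of_real_eq_iff exp_inj_iff)
  have "monom (of_real (exp (- a))) (- \<delta>) * monom (of_real (exp a)) \<delta> = 1"
    by (simp add: monom_mult monom_1_0 flip: of_real_mult exp_add)
  then have cancel: "x = y" if "monom (of_real (exp a)) \<delta> * x = monom (of_real (exp a)) \<delta> * y" for x y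
    using that by (metis mult.assoc mult_1)
  have "pexp m = pexp m'" by (rule cancel) (use eq a d in simp)
  then show ?thesis using a d pexp_inj[OF assms(1,2)] by simp
qed

lemma torus_exp_props:
  assumes "range w \<subseteq> max_ideal"
  shows "vge (d v) (torus_exp u d w v)" "pcoeff (torus_exp u d w v) (d v) = of_real (exp (u v))"
    and "Val (torus_exp u d w v) = d v" "torus_exp u d w v \<in> Kpos"
proof -
  have "w v \<in> max_ideal" using assms by blast
  then show "vge (d v) (torus_exp u d w v)" "pcoeff (torus_exp u d w v) (d v) = of_real (exp (u v))"
    "Val (torus_exp u d w v) = d v" "torus_exp u d w v \<in> Kpos"
    unfolding torus_exp_def by (rule polar_lowest)+
qed

lemma torus_exp_add:
  assumes "linear u" "linear d" "linear w" "range w \<subseteq> max_ideal"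
  shows "torus_exp u d w (x + y) = torus_exp u d w x * torus_exp u d w y"
proof -
  have "monom (of_real (exp (u (x + y)))) (d (x + y)) =
      monom (of_real (exp (u x))) (d x) * monom (of_real (exp (u y))) (d y)"
    by (simp add: linear_add assms exp_add monom_mult)
  moreover have "pexp (w (x + y)) = pexp (w x) * pexp (w y)"
    using assms by (simp add: linear_add pexp_add range_subsetD)
  ultimately show ?thesis by (simp add: torus_exp_def mult_ac)
qed

lemma character_lattice_basis:
  assumes "character_lattice M"
  obtains B where "finite B" "independent B" "span B = UNIV" "B \<subseteq> M"
    "M = {\<Sum>b\<in>B. real_of_int (k b) *\<^sub>R b | k. True}"
proof -
  obtain B where B: "finite B" "independent B" "span B = UNIV"
    "M = {\<Sum>b\<in>B. real_of_int (k b) *\<^sub>R b | k. True}"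
    using assms by (auto simp: character_lattice_def)
  have "b \<in> M" if "b \<in> B" for b
  proof -
    have "(\<Sum>b'\<in>B. real_of_int (if b' = b then 1 else 0) *\<^sub>R b') = (\<Sum>b'\<in>B. if b' = b then b' else 0)"
      by (rule sum.cong) auto
    also have "\<dots> = b" using that B(1) by simp
    finally show ?thesis
      unfolding B(4) by (intro CollectI exI[of _ "\<lambda>b'. if b' = b then 1 else 0"]) simp
  qed
  then have "B \<subseteq> M" by blast
  then show ?thesis using B by (intro that)
qed

lemma character_lattice_group:
  assumes "character_lattice M"
  shows "0 \<in> M" "\<And>x y. x \<in> M \<Longrightarrow> y \<in> M \<Longrightarrow> x + y \<in> M" "\<And>x. x \<in> M \<Longrightarrow> - x \<in> M"
proof -
  obtain B where M: "M = {\<Sum>b\<in>B. real_of_int (k b) *\<^sub>R b | k. True}"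
    using assms by (rule character_lattice_basis)
  have eq: "(\<Sum>b\<in>B. real_of_int (k b) *\<^sub>R b) \<in> M" for k unfolding M by blast
  show "0 \<in> M" using eq[of "\<lambda>_. 0"] by simp
  show "x + y \<in> M" if xy: "x \<in> M" "y \<in> M" for x y
  proof -
    obtain k l where "x = (\<Sum>b\<in>B. real_of_int (k b) *\<^sub>R b)" "y = (\<Sum>b\<in>B. real_of_int (l b) *\<^sub>R b)"
      using xy unfolding M by blast
    then show ?thesis using eq[of "\<lambda>b. k b + l b"] by (simp add: scaleR_add_left sum.distrib)
  qed
  show "- x \<in> M" if x: "x \<in> M" for x
  proof -
    obtain k where "x = (\<Sum>b\<in>B. real_of_int (k b) *\<^sub>R b)" using x unfolding M by blast
    then show ?thesis using eq[of "\<lambda>b. - k b"] by (simp add: sum_negf)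
  qed
qed

lemma linear_eq_on_lattice:
  assumes "character_lattice M" "linear f" "linear g" "\<And>x. x \<in> M \<Longrightarrow> f x = g x"
  shows "f = g"
proof -
  obtain B where B: "span B = UNIV" "B \<subseteq> M" using character_lattice_basis[OF assms(1)] by metis
  have "f x = g x" for x
    by (rule linear_eq_on_span[OF assms(2,3), of B x]) (use B assms(4) in auto)
  then show ?thesis by auto
qed

text \<open>The points where \<open>f\<close> is 1 form a subgroup. Applied to a quotient of two
  homomorphisms, this shows that they agree on the lattice as soon as they agree on a basis.\<close>

lemma lattice_hom_eq_1:
  fixes f :: "'m::real_normed_vector \<Rightarrow> 'a::field"
  assumes M: "character_lattice M" and B: "finite B" "B \<subseteq> M"
    and hom: "\<And>x y. x \<in> M \<Longrightarrow> y \<in> M \<Longrightarrow> f (x + y) = f x * f y"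
    and nz: "\<And>x. x \<in> M \<Longrightarrow> f x \<noteq> 0"
    and 1: "\<And>b. b \<in> B \<Longrightarrow> f b = 1"
  shows "f (\<Sum>b\<in>B. real_of_int (k b) *\<^sub>R b) = 1"
proof -
  note gr = character_lattice_group[OF M]
  define H where "H = {x \<in> M. f x = 1}"
  have "f 0 * f 0 = f 0" using hom[OF gr(1) gr(1)] by simp
  then have 0: "0 \<in> H" using nz[OF gr(1)] gr(1) by (simp add: H_def)
  have add: "x + y \<in> H" if "x \<in> H" "y \<in> H" for x y using that gr(2) hom by (simp add: H_def)
  have neg: "- x \<in> H" if "x \<in> H" for x
    using that hom[of x "- x"] gr(3)[of x] 0 by (simp add: H_def)
  have nat: "real j *\<^sub>R b \<in> H" if "b \<in> H" for b j
    by (induction j) (use 0 add that in \<open>auto simp: scaleR_add_left\<close>)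
  have int: "real_of_int j *\<^sub>R b \<in> H" if "b \<in> H" for b j
  proof (cases j rule: int_cases2)
    case (nonneg n) then show ?thesis using nat[OF that] by simp
  next
    case (nonpos n) then show ?thesis using neg[OF nat[OF that]] by simp
  qed
  have "(\<Sum>b\<in>A. real_of_int (k b) *\<^sub>R b) \<in> H" if "finite A" "A \<subseteq> B" for A
    using that
  proof (induction A rule: finite_induct)
    case (insert a A)
    then have "a \<in> H" using 1 B by (auto simp: H_def)
    then show ?case using insert add int by auto
  qed (simp add: 0)
  then show ?thesis using B(1) by (simp add: H_def)
qed

text \<open>The polar coordinates of \<open>p\<close> at a lattice basis are extended linearly.
  Since the maximal ideal is a real subspace, the extension \<open>w\<close> keeps its values
  there.\<close>

lemma torus_rep_exists:
  assumes M: "character_lattice M" and p: "p \<in> torus_pos M"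
  shows "\<exists>u d w. torus_rep M p (u, d, w)"
proof -
  obtain B where B: "finite B" "independent B" "span B = UNIV" "B \<subseteq> M"
    "M = {\<Sum>b\<in>B. real_of_int (k b) *\<^sub>R b | k. True}" by (rule character_lattice_basis[OF M])
  have pK: "p x \<in> Kpos" if "x \<in> M" for x using p that by (auto simp: torus_pos_def)
  have "\<forall>b\<in>B. \<exists>a \<delta> m. m \<in> max_ideal \<and> p b = monom (of_real (exp a)) \<delta> * pexp m"
    using Kpos_polar pK B(4) by (meson subsetD)
  then obtain a \<delta> m where am: "\<And>b. b \<in> B \<Longrightarrow> m b \<in> max_ideal"
    "\<And>b. b \<in> B \<Longrightarrow> p b = monom (of_real (exp (a b))) (\<delta> b) * pexp (m b)" by metis
  obtain u :: "'a \<Rightarrow> real" where u: "linear u" "\<forall>b\<in>B. u b = a b" using linear_independent_extend[OF B(2)] by blast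
  obtain d :: "'a \<Rightarrow> real" where d: "linear d" "\<forall>b\<in>B. d b = \<delta> b" using linear_independent_extend[OF B(2)] by blast
  obtain w where w: "linear w" "\<forall>b\<in>B. w b = m b" using linear_independent_extend[OF B(2)] by blast
  have rw: "range w \<subseteq> max_ideal"
  proof -
    have "span (w ` B) \<subseteq> max_ideal" using w am by (intro span_minimal subspace_max_ideal) auto
    then show ?thesis using linear_span_image[OF w(1), of B] B(3) by simp
  qed
  have nz: "torus_exp u d w x \<noteq> 0" for x using torus_exp_props(4)[OF rw] by (auto simp: Kpos_def)
  have "p x = torus_exp u d w x" if "x \<in> M" for x
  proof -
    obtain k where k: "x = (\<Sum>b\<in>B. real_of_int (k b) *\<^sub>R b)" using \<open>x \<in> M\<close> B(5) by blast
    have "p x / torus_exp u d w x = 1"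
      unfolding k
    proof (rule lattice_hom_eq_1[OF M B(1,4), of "\<lambda>x. p x / torus_exp u d w x"])
      show "p (x + y) / torus_exp u d w (x + y) = p x / torus_exp u d w x * (p y / torus_exp u d w y)"
        if "x \<in> M" "y \<in> M" for x y
        using p that torus_exp_add[OF u(1) d(1) w(1) rw] by (simp add: torus_pos_def)
      show "p x / torus_exp u d w x \<noteq> 0" if "x \<in> M" for x
        using pK[OF that] nz by (auto simp: Kpos_def)
      show "p b / torus_exp u d w b = 1" if "b \<in> B" for b
        using that u d w am(2)[OF that] nz[of b] by (simp add: torus_exp_def)
    qed
    then show ?thesis by (simp add: nz)
  qed
  then show ?thesis using u d w rw unfolding torus_rep_def by blast
qed

lemma torus_rep_unique:
  assumes M: "character_lattice M"
    and r: "torus_rep M p (u, d, w)" "torus_rep M p (u', d', w')"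
  shows "(u, d, w) = (u', d', w')"
proof -
  have "u x = u' x \<and> d x = d' x \<and> w x = w' x" if "x \<in> M" for x
  proof (rule polar_eq_iff)
    show "w x \<in> max_ideal" "w' x \<in> max_ideal" using r by (auto simp: torus_rep_def)
    have "p x = torus_exp u d w x" "p x = torus_exp u' d' w' x"
      using r that by (simp_all add: torus_rep_def)
    then show "monom (of_real (exp (u x))) (d x) * pexp (w x) =
        monom (of_real (exp (u' x))) (d' x) * pexp (w' x)" by (simp only: torus_exp_def)
  qed
  then have "u = u'" "d = d'" "w = w'"
    using r linear_eq_on_lattice[OF M, of u u'] linear_eq_on_lattice[OF M, of d d']
      linear_eq_on_lattice[OF M, of w w'] by (simp_all add: torus_rep_def)
  then show ?thesis by simp
qed

text \<open>Uniqueness of the representation gives the definite description in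
  \<open>torus_pow\<close> its intended value.\<close>

lemma torus_pow_eq:
  assumes "character_lattice M" "torus_rep M p (u, d, w)"
  shows "torus_pow M p v = torus_exp u d w v"
proof -
  have "(THE x. torus_rep M p x) = (u, d, w)"
  proof (rule the_equality[of "torus_rep M p", OF assms(2)])
    show "x = (u, d, w)" if "torus_rep M p x" for x
    proof (cases x)
      case (fields u' d' w')
      then show ?thesis using torus_rep_unique[OF assms(1) _ assms(2)] that by blast
    qed
  qed
  then show ?thesis by (simp add: torus_pow_def)
qed

lemma torus_rep_restrict:
  assumes M: "character_lattice M" and "linear u" "linear d" "linear w" "range w \<subseteq> max_ideal"
  shows "restrict (torus_exp u d w) M \<in> torus_pos M"
    and "torus_rep M (restrict (torus_exp u d w) M) (u, d, w)"
proof -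
  show "restrict (torus_exp u d w) M \<in> torus_pos M"
    unfolding torus_pos_def
    using torus_exp_props(4)[OF assms(5)] torus_exp_add[OF assms(2-5)] character_lattice_group(2)[OF M]
    by (simp add: restrict_PiE_iff)
  show "torus_rep M (restrict (torus_exp u d w) M) (u, d, w)"
    using assms by (simp add: torus_rep_def)
qed

lemma Val_T_eq:
  assumes M: "character_lattice M" and r: "torus_rep M p (u, d, w)"
  shows "Val_T M p = d"
  unfolding Val_T_def
proof (rule the_equality)
  have d: "linear d" and v: "\<And>x. x \<in> M \<Longrightarrow> Val (p x) = d x"
    using r torus_exp_props(3)[of w] by (simp_all add: torus_rep_def)
  show "linear d \<and> (\<forall>x\<in>M. Val (p x) = d x)" using d v by blast
  show "\<delta> = d" if "linear \<delta> \<and> (\<forall>x\<in>M. Val (p x) = \<delta> x)" for \<delta>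
    using linear_eq_on_lattice[OF M _ d, of \<delta>] that v by auto
qed

section \<open>Linear functionals and bases\<close>

text \<open>A purely algebraic separation: extend a functional from the image of \<open>x\<close> in
  the quotient by \<open>L\<close> and pull it back.\<close>

lemma separating_functional:
  fixes x :: "'a::real_vector"
  assumes L: "subspace L" and x: "x \<notin> L"
  shows "\<exists>\<phi>::'a \<Rightarrow> real. linear \<phi> \<and> (\<forall>y\<in>L. \<phi> y = 0) \<and> \<phi> x = 1"
proof -
  let ?q = "quot_map L"
  have q0: "?q y = 0 \<longleftrightarrow> y \<in> L" for y
    using quot_map(3)[OF L, of y 0] linear_0[OF quot_map(1)[OF L]] by simp
  have "independent {?q x}" using x q0 by simp
  then obtain \<psi> :: "'a \<Rightarrow> real" where \<psi>: "linear \<psi>" "\<psi> (?q x) = 1"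
    using linear_independent_extend[of "{?q x}" "\<lambda>_. 1"] by auto
  have "linear (\<psi> \<circ> ?q)" using \<psi>(1) quot_map(1)[OF L] by (rule linear_compose[rotated])
  moreover have "(\<psi> \<circ> ?q) y = 0" if "y \<in> L" for y
  proof -
    have "?q y = 0" using that q0 by blast
    then show ?thesis using linear_0[OF \<psi>(1)] by simp
  qed
  ultimately show ?thesis using \<psi>(2) by (intro exI[of _ "\<psi> \<circ> ?q"]) simp
qed

text \<open>A subspace is the common kernel of the functionals that vanish on it. Vector relations
  modulo \<open>L\<close> thus become scalar equations, which can be differentiated or compared
  coefficient by coefficient.\<close>

lemma subspace_mem_iff:
  fixes x :: "'a::real_vector"
  assumes "subspace L"
  shows "x \<in> L \<longleftrightarrow> (\<forall>\<phi>::'a \<Rightarrow> real. linear \<phi> \<longrightarrow> (\<forall>y\<in>L. \<phi> y = 0) \<longrightarrow> \<phi> x = 0)"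
proof
  assume *: "\<forall>\<phi>::'a \<Rightarrow> real. linear \<phi> \<longrightarrow> (\<forall>y\<in>L. \<phi> y = 0) \<longrightarrow> \<phi> x = 0"
  show "x \<in> L"
  proof (rule ccontr)
    assume "x \<notin> L"
    then obtain \<phi> :: "'a \<Rightarrow> real" where \<phi>: "linear \<phi>" "\<forall>y\<in>L. \<phi> y = 0" "\<phi> x = 1"
      using separating_functional[OF assms] by blast
    then show False using *[rule_format, of \<phi>] by simp
  qed
qed blast

lemma span_Un_image:
  fixes v :: "'i \<Rightarrow> 'a::real_vector"
  assumes L: "subspace L" and S: "finite S" and x: "x \<in> span (L \<union> v ` S)"
  shows "\<exists>r. x - (\<Sum>i\<in>S. r i *\<^sub>R v i) \<in> L"
  using x
proof (rule span_induct)
  show "subspace {x. \<exists>r. x - (\<Sum>i\<in>S. r i *\<^sub>R v i) \<in> L}"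
    unfolding subspace_def
  proof (intro conjI ballI allI)
    show "0 \<in> {x. \<exists>r. x - (\<Sum>i\<in>S. r i *\<^sub>R v i) \<in> L}"
      using subspace_0[OF L] by (intro CollectI exI[of _ "\<lambda>_. 0"]) simp
    fix x assume "x \<in> {x. \<exists>r. x - (\<Sum>i\<in>S. r i *\<^sub>R v i) \<in> L}"
    then obtain r where r: "x - (\<Sum>i\<in>S. r i *\<^sub>R v i) \<in> L" by blast
    show "c *\<^sub>R x \<in> {x. \<exists>r. x - (\<Sum>i\<in>S. r i *\<^sub>R v i) \<in> L}" for c
      using subspace_scale[OF L r, of c]
      by (intro CollectI exI[of _ "\<lambda>i. c * r i"]) (simp add: scaleR_diff_right scaleR_sum_right)
    fix y assume "y \<in> {x. \<exists>r. x - (\<Sum>i\<in>S. r i *\<^sub>R v i) \<in> L}"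
    then obtain s where s: "y - (\<Sum>i\<in>S. s i *\<^sub>R v i) \<in> L" by blast
    show "x + y \<in> {x. \<exists>r. x - (\<Sum>i\<in>S. r i *\<^sub>R v i) \<in> L}"
      using subspace_add[OF L r s]
      by (intro CollectI exI[of _ "\<lambda>i. r i + s i"]) (simp add: scaleR_add_left sum.distrib algebra_simps)
  qed
  fix x assume "x \<in> L \<union> v ` S"
  then show "\<exists>r. x - (\<Sum>i\<in>S. r i *\<^sub>R v i) \<in> L"
  proof
    assume "x \<in> L"
    then show ?thesis by (intro exI[of _ "\<lambda>_. 0"]) simp
  next
    assume "x \<in> v ` S"
    then obtain j where j: "j \<in> S" "x = v j" by blast
    have "(\<Sum>i\<in>S. (if i = j then 1 else 0) *\<^sub>R v i) = (\<Sum>i\<in>S. if i = j then v i else 0)"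
      by (rule sum.cong) auto
    also have "\<dots> = x" using j S by simp
    finally show ?thesis using subspace_0[OF L] by (intro exI[of _ "\<lambda>i. if i = j then 1 else 0"]) simp
  qed
qed

text \<open>Values can be prescribed as soon as they respect every relation modulo \<open>L\<close>.
  When a vector is added, either it depends on the earlier ones and its value is forced by such a
  relation, or a separating functional corrects the value freely.\<close>

lemma interpolating_functional:
  fixes v :: "'i \<Rightarrow> 'a::real_vector"
  assumes L: "subspace L" and "finite S"
    and "\<And>r. (\<Sum>i\<in>S. r i *\<^sub>R v i) \<in> L \<Longrightarrow> (\<Sum>i\<in>S. r i * z i) = (0::real)"
  shows "\<exists>y::'a \<Rightarrow> real. linear y \<and> (\<forall>x\<in>L. y x = 0) \<and> (\<forall>i\<in>S. y (v i) = z i)"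
  using assms(2,3)
proof (induction S rule: finite_induct)
  case empty
  show ?case by (intro exI[of _ "\<lambda>_. 0"]) (auto intro: linearI)
next
  case (insert i S)
  have "(\<Sum>j\<in>S. r j * z j) = 0" if r: "(\<Sum>j\<in>S. r j *\<^sub>R v j) \<in> L" for r
  proof -
    let ?r = "r(i := 0)"
    have "(\<Sum>j\<in>insert i S. ?r j *\<^sub>R v j) = (\<Sum>j\<in>S. r j *\<^sub>R v j)"
      using insert.hyps by (auto intro: sum.cong)
    moreover have "(\<Sum>j\<in>insert i S. ?r j * z j) = (\<Sum>j\<in>S. r j * z j)"
      using insert.hyps by (auto intro: sum.cong)
    ultimately show ?thesis using insert.prems[of ?r] r by simp
  qed
  then obtain y :: "'a \<Rightarrow> real" where y: "linear y" "\<And>x. x \<in> L \<Longrightarrow> y x = 0" "\<And>j. j \<in> S \<Longrightarrow> y (v j) = z j"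
    using insert.IH by blast
  show ?case
  proof (cases "v i \<in> span (L \<union> v ` S)")
    case True
    then obtain r where r: "v i - (\<Sum>j\<in>S. r j *\<^sub>R v j) \<in> L"
      using span_Un_image[OF L insert.hyps(1)] by blast
    let ?r = "\<lambda>j. if j = i then 1 else - r j"
    have "(\<Sum>j\<in>insert i S. ?r j *\<^sub>R v j) = v i + (\<Sum>j\<in>S. - (r j *\<^sub>R v j))"
      using insert.hyps by (auto intro!: sum.cong)
    then have "(\<Sum>j\<in>insert i S. ?r j * z j) = 0" using r by (intro insert.prems) (simp add: sum_negf)
    moreover have "(\<Sum>j\<in>insert i S. ?r j * z j) = z i + (\<Sum>j\<in>S. - (r j * z j))"
      using insert.hyps by (auto intro!: sum.cong)
    ultimately have zi: "z i = (\<Sum>j\<in>S. r j * z j)" by (simp add: sum_negf)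
    have "y (v i) = y (\<Sum>j\<in>S. r j *\<^sub>R v j)" using y(2)[OF r] linear_diff[OF y(1)] by simp
    also have "\<dots> = z i" using y(3) by (simp add: zi linear_sum[OF y(1)] linear_scale[OF y(1)])
    finally show ?thesis using y by blast
  next
    case False
    then obtain \<psi> :: "'a \<Rightarrow> real" where \<psi>: "linear \<psi>" "\<forall>x\<in>span (L \<union> v ` S). \<psi> x = 0" "\<psi> (v i) = 1"
      using separating_functional[OF subspace_span] by blast
    have 0: "\<psi> x = 0" if "x \<in> L \<union> v ` S" for x using \<psi>(2) span_base[OF that] by blast
    let ?c = "z i - y (v i)"
    have "linear (\<lambda>x. y x + ?c * \<psi> x)"
      using y(1) \<psi>(1) by (auto intro!: linearI simp: linear_add linear_scale algebra_simps)
    moreover have "\<forall>x\<in>L. y x + ?c * \<psi> x = 0" using y(2) 0 by simp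
    moreover have "\<forall>j\<in>insert i S. y (v j) + ?c * \<psi> (v j) = z j" using y(3) 0 \<psi>(3) by simp
    ultimately show ?thesis by blast
  qed
qed

section \<open>Coordinates with respect to a basis\<close>

lemma linear_representation:
  assumes "independent B" "span B = UNIV"
  shows "linear (\<lambda>x. representation B x b)"
  using assms by (intro linearI) (auto simp: representation_add representation_scale)

lemma representation_eq_0_outside:
  assumes "independent B" "B0 \<subseteq> B" "x \<in> span B0" "b \<notin> B0"
  shows "representation B x b = 0"
  using representation_extend[OF assms(1,3,2)] representation_ne_zero[of B0 x b] assms(4) by auto

lemma mem_span_if_representation_0:
  assumes B: "independent B" "B1 \<subseteq> B" and x: "x \<in> span B1"
    and 0: "\<And>b. b \<in> B1 - B0 \<Longrightarrow> representation B x b = 0"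
  shows "x \<in> span B0"
proof -
  have "x = (\<Sum>b | representation B x b \<noteq> 0. representation B x b *\<^sub>R b)"
    using x span_mono[OF B(2)] sum_nonzero_representation_eq[OF B(1)] by (metis subsetD)
  also have "\<dots> \<in> span B0"
  proof (intro span_sum span_scale span_base)
    fix b assume "b \<in> {b. representation B x b \<noteq> 0}"
    then show "b \<in> B0" using representation_eq_0_outside[OF B x] 0 by blast
  qed
  finally show ?thesis .
qed

lemma finite_basis_subset:
  assumes "finite F" "span F = (UNIV :: 'a::real_vector set)" "independent (B :: 'a set)"
  shows "finite B"
  using independent_span_bound[of F B] assms by simp

text \<open>A matrix whose rows and columns are indexed by the vectors of a basis is an endomorphism
  of the space, and in finite dimension an injective endomorphism is invertible.\<close>

lemma square_matrix_inverse:
  fixes A :: "'a::real_vector \<Rightarrow> 'a \<Rightarrow> real"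
  assumes B: "finite B" "independent B" "span B = (UNIV :: 'a set)"
    and inj: "\<And>y. (\<And>b. b \<in> B \<Longrightarrow> (\<Sum>l\<in>B. A b l * y l) = 0) \<Longrightarrow> (\<forall>l\<in>B. y l = 0)"
  shows "\<exists>N. (\<forall>l\<in>B. \<forall>m\<in>B. (\<Sum>b\<in>B. N l b * A b m) = (if m = l then 1 else 0)) \<and>
    (\<forall>b\<in>B. \<forall>c\<in>B. (\<Sum>l\<in>B. A b l * N l c) = (if c = b then 1 else 0))"
proof -
  \<comment> \<open>The type carries only a real vector space structure; the given basis supplies
    the finite dimension that makes \<open>T\<close> surjective.\<close>
  interpret finite_dimensional_vector_space scaleR B
    using B by unfold_locales (simp_all add: dependent_raw_def span_raw_def)
  define rep where "rep x b = representation B x b" for x b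
  have rep_lin: "linear (\<lambda>x. rep x b)" for b unfolding rep_def by (rule linear_representation[OF B(2,3)])
  have rep_sum: "(\<Sum>b\<in>B. rep x b *\<^sub>R b) = x" for x
    unfolding rep_def using B by (intro sum_representation_eq) auto
  have rep_comb: "rep (\<Sum>b\<in>B. f b *\<^sub>R b) c = f c" if "c \<in> B" for f c
  proof -
    have "rep (\<Sum>b\<in>B. f b *\<^sub>R b) c = (\<Sum>b\<in>B. f b * rep b c)"
      by (simp add: linear_sum[OF rep_lin] linear_scale[OF rep_lin])
    also have "\<dots> = (\<Sum>b\<in>B. if c = b then f b else 0)"
      by (rule sum.cong) (auto simp: rep_def representation_basis[OF B(2)])
    finally show ?thesis using that B(1) by simp
  qed
  have rep_basis: "rep b c = (if c = b then 1 else 0)" if "b \<in> B" for b c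
    by (simp add: rep_def representation_basis[OF B(2) that])
  define T where "T z = (\<Sum>b\<in>B. (\<Sum>l\<in>B. A b l * rep z l) *\<^sub>R b)" for z
  have T: "linear T"
    unfolding T_def
    by (intro linearI) (simp_all add: linear_add[OF rep_lin] linear_scale[OF rep_lin] scaleR_add_left
        sum.distrib distrib_left scaleR_sum_right sum_distrib_left mult.left_commute)
  have "z = 0" if "T z = 0" for z
  proof -
    have "(\<Sum>l\<in>B. A b l * rep z l) = 0" if "b \<in> B" for b
      using rep_comb[OF that, of "\<lambda>b. \<Sum>l\<in>B. A b l * rep z l"] \<open>T z = 0\<close> linear_0[OF rep_lin]
      by (simp add: T_def)
    then have "\<forall>l\<in>B. rep z l = 0" by (rule inj)
    then show ?thesis using rep_sum[of z] by simp
  qed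
  then have "inj T" using linear_injective_0[OF T] by blast
  then have "surj T" using linear_inj_imp_surj[of T] T by (simp add: linear_def)
  obtain g where g: "linear g" "g \<circ> T = id" using linear_injective_left_inverse[OF T \<open>inj T\<close>] by blast
  have gT: "g (T x) = x" for x using fun_cong[OF g(2), of x] by simp
  have Tg: "T (g x) = x" for x using \<open>surj T\<close> gT by (metis surj_def)
  define N where "N l b = rep (g b) l" for l b
  have "(\<Sum>b\<in>B. N l b * A b m) = (if m = l then 1 else 0)" if "l \<in> B" "m \<in> B" for l m
  proof -
    have "T m = (\<Sum>b\<in>B. A b m *\<^sub>R b)"
      unfolding T_def using B(1) that(2) by (simp add: rep_basis if_distrib[of "(*) _"] cong: if_cong)
    then have "rep (g (T m)) l = (\<Sum>b\<in>B. A b m * rep (g b) l)"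
      by (simp add: linear_sum[OF g(1)] linear_scale[OF g(1)] linear_sum[OF rep_lin] linear_scale[OF rep_lin])
    then show ?thesis using rep_basis[OF that(2), of l] by (auto simp: gT N_def mult.commute)
  qed
  moreover have "(\<Sum>l\<in>B. A b l * N l c) = (if c = b then 1 else 0)" if "b \<in> B" "c \<in> B" for b c
  proof -
    have "rep (T (g c)) b = (\<Sum>l\<in>B. A b l * N l c)"
      using rep_comb[OF that(1)] by (simp add: T_def N_def)
    then show ?thesis using rep_basis[OF that(2), of b] by (auto simp: Tg)
  qed
  ultimately show ?thesis by blast
qed

lemma representation_sum_UNIV:
  assumes "finite B" "independent B" "span B = UNIV"
  shows "(\<Sum>b\<in>B. representation B x b *\<^sub>R b) = x"
  using assms by (intro sum_representation_eq) auto

lemma linear_eq_sum_representation: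
  assumes "finite B" "independent B" "span B = UNIV" "linear f"
  shows "f x = (\<Sum>b\<in>B. representation B x b *\<^sub>R f b)"
proof -
  have "f x = f (\<Sum>b\<in>B. representation B x b *\<^sub>R b)"
    by (simp only: representation_sum_UNIV[OF assms(1-3)])
  then show ?thesis by (simp only: linear_sum[OF assms(4)] linear_scale[OF assms(4)])
qed

section \<open>Optimisation over positive relations\<close>

text \<open>Tychonoff's theorem. Tuples are functions on the whole index type, and the boxes used
  below are the single point 0 in all coordinates outside a finite set.\<close>

lemma compact_box:
  fixes a b :: "'i \<Rightarrow> real"
  shows "compact (PiE UNIV (\<lambda>i. {a i..b i}))"
proof -
  have "compactin (product_topology (\<lambda>i::'i. euclidean) UNIV) (PiE UNIV (\<lambda>i. {a i..b i}))"
    by (subst compactin_PiE) (simp add: compactin_euclidean_iff)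
  then show ?thesis by (simp only: euclidean_product_topology compactin_euclidean_iff)
qed

lemma continuous_on_coordinate [continuous_intros]:
  "continuous_on A (\<lambda>z::'i \<Rightarrow> real. z i)"
  by (rule continuous_on_subset[OF continuous_on_product_coordinates]) simp

text \<open>The vectors live in a space without topology; testing membership in \<open>L\<close> by
  functionals gives an intersection of closed hyperplanes in the coefficients.\<close>

lemma closed_relation:
  fixes v :: "'i \<Rightarrow> 'a::real_vector"
  assumes "subspace L" "finite S"
  shows "closed {a. (\<Sum>i\<in>S. a i *\<^sub>R v i) \<in> L}"
proof -
  have "(\<Sum>i\<in>S. a i *\<^sub>R v i) \<in> L \<longleftrightarrow>
      (\<forall>\<phi>::'a \<Rightarrow> real. linear \<phi> \<longrightarrow> (\<forall>y\<in>L. \<phi> y = 0) \<longrightarrow> (\<Sum>i\<in>S. a i * \<phi> (v i)) = 0)" for a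
    by (subst subspace_mem_iff[OF assms(1)]) (auto simp: linear_sum linear_scale)
  then have "{a. (\<Sum>i\<in>S. a i *\<^sub>R v i) \<in> L} =
      (\<Inter>\<phi>\<in>{\<phi>. linear \<phi> \<and> (\<forall>y\<in>L. \<phi> y = (0::real))}. {a. (\<Sum>i\<in>S. a i * \<phi> (v i)) = 0})"
    by auto
  moreover have "closed {a::'i \<Rightarrow> real. (\<Sum>i\<in>S. a i * \<phi> (v i)) = 0}" for \<phi>
    by (intro closed_Collect_eq continuous_intros)
  ultimately show ?thesis by (simp only: closed_INT ball_simps simp_thms)
qed

text \<open>The function \<open>f\<close> is minimised over the tuples of values
  \<open>y (v i)\<close> of functionals \<open>y\<close> vanishing on \<open>L\<close>; these are
  exactly the tuples annihilated by all relations in \<open>R\<close>. The positive relation among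
  the \<open>v i\<close> bounds the sublevel sets, so a minimum exists, and its stationarity is the
  required membership in \<open>L\<close>.\<close>

lemma exp_sum_critical:
  fixes v :: "'i \<Rightarrow> 'a::real_vector"
  assumes L: "subspace L" and S: "finite S" and g: "\<And>i. i \<in> S \<Longrightarrow> (g i::real) > 0"
    and a: "\<And>i. i \<in> S \<Longrightarrow> a i > 0" "(\<Sum>i\<in>S. a i *\<^sub>R v i) \<in> L"
  shows "\<exists>y. linear y \<and> (\<forall>x\<in>L. y x = 0) \<and> (\<Sum>i\<in>S. (g i * exp (y (v i))) *\<^sub>R v i) \<in> L"
proof -
  define R where "R = {r. (\<Sum>i\<in>S. r i *\<^sub>R v i) \<in> L}"
  define f where "f z = (\<Sum>i\<in>S. g i * exp (z i))" for z :: "'i \<Rightarrow> real"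
  \<comment> \<open>Only tuples with \<open>f z \<le> G\<close> compete with the origin. For them
    each summand is at most \<open>G\<close>, which gives the upper bound \<open>\<kappa>\<close> on
    the coordinates; the relation with positive coefficients \<open>a\<close> turns it into the
    lower bound \<open>- \<kappa> * sum a S / a i\<close>. The constant \<open>K\<close> dominates
    both.\<close>
  define G where "G = f (\<lambda>_. 0)"
  define \<kappa> where "\<kappa> = (\<Sum>i\<in>S. \<bar>ln (G / g i)\<bar>)"
  define K where "K = \<kappa> + (\<Sum>i\<in>S. \<kappa> * sum a S / a i)"
  define Z where "Z = PiE UNIV (\<lambda>i. {- (if i \<in> S then K else 0)..if i \<in> S then K else 0}) \<inter>
      {z. \<forall>r\<in>R. (\<Sum>i\<in>S. r i * z i) = 0}"
  have \<kappa>0: "\<kappa> \<ge> 0" by (simp add: \<kappa>_def sum_nonneg)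
  have A0: "sum a S \<ge> 0" using a(1) by (intro sum_nonneg) (simp add: less_imp_le)
  have t0: "\<kappa> * sum a S / a i \<ge> 0" if "i \<in> S" for i using \<kappa>0 A0 a(1)[OF that] by simp
  have K: "\<kappa> \<le> K" "K \<ge> 0" using t0 \<kappa>0 sum_nonneg[of S "\<lambda>i. \<kappa> * sum a S / a i"] by (auto simp: K_def)
  have bound: "\<bar>z i\<bar> \<le> K" if z: "\<forall>r\<in>R. (\<Sum>i\<in>S. r i * z i) = 0" "f z \<le> G" and i: "i \<in> S" for z i
  proof -
    have up: "z j \<le> \<kappa>" if j: "j \<in> S" for j
    proof -
      have "g j * exp (z j) \<le> f z"
        unfolding f_def using j S g by (intro member_le_sum) (auto intro: less_imp_le mult_pos_pos)
      then have le: "exp (z j) \<le> G / g j" using z(2) g[OF j] by (simp add: field_simps)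
      then have "G / g j > 0" using exp_gt_zero[of "z j"] by linarith
      then have "z j \<le> ln (G / g j)" using le by (simp add: ln_ge_iff)
      also have "\<dots> \<le> \<bar>ln (G / g j)\<bar>" by simp
      also have "\<dots> \<le> \<kappa>" unfolding \<kappa>_def using j S by (intro member_le_sum) auto
      finally show ?thesis .
    qed
    have "(\<Sum>j\<in>S. a j * z j) = 0" using z(1) a(2) by (auto simp: R_def)
    then have "- (a i * z i) = (\<Sum>j\<in>S - {i}. a j * z j)" using S i by (simp add: sum.remove)
    also have "\<dots> \<le> (\<Sum>j\<in>S - {i}. a j * \<kappa>)"
      using up a(1) by (intro sum_mono mult_left_mono) (auto intro: less_imp_le)
    also have "\<dots> \<le> (\<Sum>j\<in>S. a j * \<kappa>)"
      using a(1) \<kappa>0 S by (intro sum_mono2) (auto simp: less_imp_le)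
    also have "\<dots> = \<kappa> * sum a S" by (simp add: sum_distrib_left mult.commute)
    finally have "- z i \<le> \<kappa> * sum a S / a i" using a(1)[OF i] by (simp add: field_simps)
    also have "\<dots> \<le> (\<Sum>i\<in>S. \<kappa> * sum a S / a i)" using i S t0 by (intro member_le_sum) auto
    also have "\<dots> \<le> K" using \<kappa>0 by (simp add: K_def)
    finally show ?thesis using up[OF i] K(1) by linarith
  qed
  have "closed {z. \<forall>r\<in>R. (\<Sum>i\<in>S. r i * z i) = 0}"
  proof -
    have "{z. \<forall>r\<in>R. (\<Sum>i\<in>S. r i * z i) = 0} = (\<Inter>r\<in>R. {z. (\<Sum>i\<in>S. r i * z i) = 0})" by auto
    moreover have "closed {z::'i \<Rightarrow> real. (\<Sum>i\<in>S. r i * z i) = 0}" for r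
      by (intro closed_Collect_eq continuous_intros)
    ultimately show ?thesis by auto
  qed
  then have "compact Z" unfolding Z_def by (intro compact_Int_closed compact_box)
  moreover have Z0: "(\<lambda>_. 0) \<in> Z" using K by (auto simp: Z_def)
  moreover have "continuous_on Z f" unfolding f_def by (intro continuous_intros)
  ultimately obtain z where z: "z \<in> Z" "\<And>z'. z' \<in> Z \<Longrightarrow> f z \<le> f z'"
    using continuous_attains_inf[of Z f] by blast
  have zR: "(\<Sum>i\<in>S. r i * z i) = 0" if "r \<in> R" for r using z(1) that by (auto simp: Z_def)
  have "\<phi> (\<Sum>i\<in>S. (g i * exp (z i)) *\<^sub>R v i) = 0" if \<phi>: "linear \<phi>" "\<forall>x\<in>L. \<phi> x = 0" for \<phi> :: "'a \<Rightarrow> real"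
  proof -
    define h where "h s = (\<Sum>i\<in>S. g i * exp (z i + s * \<phi> (v i)))" for s
    have "h 0 \<le> h s" for s
    proof -
      define z' where "z' i = (if i \<in> S then z i + s * \<phi> (v i) else 0)" for i
      have hz': "h s = f z'" by (simp add: h_def f_def z'_def)
      have R: "\<forall>r\<in>R. (\<Sum>i\<in>S. r i * z' i) = 0"
      proof
        fix r assume r: "r \<in> R"
        have "(\<Sum>i\<in>S. r i * z' i) = (\<Sum>i\<in>S. r i * z i) + s * (\<Sum>i\<in>S. r i * \<phi> (v i))"
          by (simp add: z'_def sum.distrib sum_distrib_left algebra_simps)
        also have "(\<Sum>i\<in>S. r i * \<phi> (v i)) = \<phi> (\<Sum>i\<in>S. r i *\<^sub>R v i)"
          by (simp add: linear_sum[OF \<phi>(1)] linear_scale[OF \<phi>(1)])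
        also have "\<dots> = 0" using r \<phi>(2) by (simp add: R_def)
        finally show "(\<Sum>i\<in>S. r i * z' i) = 0" using zR[OF r] by simp
      qed
      show ?thesis
      \<comment> \<open>A variation may leave the box, but then its value exceeds \<open>G\<close>,
        the value at the origin, which is at least the minimum.\<close>
      proof (cases "f z' \<le> G")
        case True
        then have "- K \<le> z' i \<and> z' i \<le> K" if "i \<in> S" for i
          using bound[OF R _ that] by (auto simp: abs_le_iff)
        then have "z' \<in> Z" using R by (auto simp: Z_def z'_def)
        then show ?thesis using z(2) by (simp add: hz') (simp add: h_def f_def)
      next
        case False
        then have "f z \<le> f z'" using z(2)[OF Z0] by (simp add: G_def)
        then show ?thesis by (simp add: hz') (simp add: h_def f_def)
      qed
    qed
    moreover have "(h has_real_derivative (\<Sum>i\<in>S. g i * (exp (z i + 0 * \<phi> (v i)) * \<phi> (v i)))) (at 0)"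
      unfolding h_def by (auto intro!: derivative_eq_intros sum.cong)
    ultimately have "(\<Sum>i\<in>S. g i * (exp (z i + 0 * \<phi> (v i)) * \<phi> (v i))) = 0"
      by (intro DERIV_local_min[of h _ 0 1]) auto
    then show ?thesis by (simp add: linear_sum[OF \<phi>(1)] linear_scale[OF \<phi>(1)] mult.assoc)
  qed
  then have mem: "(\<Sum>i\<in>S. (g i * exp (z i)) *\<^sub>R v i) \<in> L"
    using subspace_mem_iff[OF L] by blast
  obtain y where y: "linear y" "\<forall>x\<in>L. y x = 0" "\<forall>i\<in>S. y (v i) = z i"
    using interpolating_functional[OF L S, of v z] zR by (auto simp: R_def)
  have "(\<Sum>i\<in>S. (g i * exp (y (v i))) *\<^sub>R v i) = (\<Sum>i\<in>S. (g i * exp (z i)) *\<^sub>R v i)"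
    using y(3) by (intro sum.cong) auto
  then show ?thesis using y mem by auto
qed

text \<open>Linear programming over normalised nonnegative relations modulo \<open>L\<close> with
  costs \<open>c\<close>: \<open>\<tau>\<close> is the optimal value and \<open>S\<close> the
  support of an optimal solution. Choosing that support as large as possible yields strict
  complementarity, so a direction \<open>b\<close> with zero reduced cost must vanish off
  \<open>S\<close>.\<close>

lemma optimal_relation:
  fixes v :: "'i \<Rightarrow> 'a::real_vector" and c :: "'i \<Rightarrow> real"
  assumes L: "subspace L" and J: "finite J"
    and feas: "\<forall>j\<in>J. a0 j \<ge> 0" "sum a0 J > 0" "(\<Sum>j\<in>J. a0 j *\<^sub>R v j) \<in> L"
  shows "\<exists>\<tau> S a. S \<subseteq> J \<and> S \<noteq> {} \<and> (\<forall>i\<in>S. a i > 0) \<and> (\<Sum>i\<in>S. a i *\<^sub>R v i) \<in> L \<and>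
    (\<forall>b. (\<forall>j\<in>J - S. b j \<ge> 0) \<longrightarrow> (\<Sum>j\<in>J. b j *\<^sub>R v j) \<in> L \<longrightarrow>
      (\<Sum>j\<in>J. b j * (c j - \<tau>)) \<ge> 0 \<and>
      ((\<Sum>j\<in>J. b j * (c j - \<tau>)) = 0 \<longrightarrow> (\<forall>j\<in>J - S. b j = 0)))"
proof -
  define P where "P = PiE UNIV (\<lambda>i. {0..if i \<in> J then 1 else 0::real}) \<inter>
      ({a. sum a J = 1} \<inter> {a. (\<Sum>j\<in>J. a j *\<^sub>R v j) \<in> L})"
  define f where "f a = (\<Sum>j\<in>J. a j * c j)" for a
  have "closed {a::'i \<Rightarrow> real. sum a J = 1}"
    by (intro closed_Collect_eq continuous_intros)
  then have "compact P"
    unfolding P_def by (intro compact_Int_closed compact_box closed_Int closed_relation L J)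
  have PI: "(\<lambda>j. if j \<in> J then a j / sum a J else 0) \<in> P"
    if "\<And>j. j \<in> J \<Longrightarrow> a j \<ge> 0" "sum a J > 0" "(\<Sum>j\<in>J. a j *\<^sub>R v j) \<in> L" for a
  proof -
    have "a j / sum a J \<le> 1" if "j \<in> J" for j
      using member_le_sum[of j J a] that J \<open>\<And>j. j \<in> J \<Longrightarrow> a j \<ge> 0\<close> \<open>sum a J > 0\<close> by simp
    moreover have "(\<Sum>j\<in>J. a j / sum a J) = 1"
      using that(2) by (simp flip: sum_divide_distrib)
    moreover have "(\<Sum>j\<in>J. (a j / sum a J) *\<^sub>R v j) = (1 / sum a J) *\<^sub>R (\<Sum>j\<in>J. a j *\<^sub>R v j)"
      by (simp add: scaleR_sum_right)
    then have "(\<Sum>j\<in>J. (a j / sum a J) *\<^sub>R v j) \<in> L" using that(3) L by (simp only: subspace_scale)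
    ultimately show ?thesis using that(1,2) by (auto simp: P_def)
  qed
  have PD: "\<And>j. a j \<ge> 0" "sum a J = 1" "(\<Sum>j\<in>J. a j *\<^sub>R v j) \<in> L" if "a \<in> P" for a
    using that by (auto simp: P_def)
  have "P \<noteq> {}" using PI[of a0] feas by blast
  moreover have "continuous_on P f" unfolding f_def by (intro continuous_intros)
  ultimately obtain a1 where a1: "a1 \<in> P" "\<And>a. a \<in> P \<Longrightarrow> f a1 \<le> f a"
    using continuous_attains_inf[of P f] \<open>compact P\<close> by blast
  define \<tau> where "\<tau> = f a1"
  define supp where "supp a = {j \<in> J. a j > 0}" for a :: "'i \<Rightarrow> real"
  have cardJ: "card (supp a) \<le> card J" for a
    using J by (intro card_mono) (auto simp: supp_def)
  \<comment> \<open>Among the optimal solutions one of largest support is taken. Averaging with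
    another optimal solution unites the supports, so this support contains all the others.\<close>
  obtain a where a: "a \<in> P" "f a = \<tau>" "\<And>a'. a' \<in> P \<Longrightarrow> f a' = \<tau> \<Longrightarrow> card (supp a') \<le> card (supp a)"
    using ex_has_greatest_nat[of "\<lambda>a. a \<in> P \<and> f a = \<tau>" a1 "\<lambda>a. card (supp a)" "Suc (card J)"] a1(1) cardJ[THEN le_imp_less_Suc]
    by (auto simp: \<tau>_def)
  have max: "supp a' \<subseteq> supp a" if "a' \<in> P" "f a' = \<tau>" for a'
  proof -
    define m where "m j = (if j \<in> J then (a j + a' j) / sum (\<lambda>j. a j + a' j) J else 0)" for j
    have s: "sum (\<lambda>j. a j + a' j) J = 2" using PD(2)[OF a(1)] PD(2)[OF that(1)] by (simp add: sum.distrib)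
    have m: "m j = (if j \<in> J then (a j + a' j) / 2 else 0)" for j unfolding m_def s by simp
    have "m \<in> P" unfolding m_def
      using PD(1,3)[OF a(1)] PD(1,3)[OF that(1)] s L
      by (intro PI) (auto simp: scaleR_add_left sum.distrib subspace_add)
    moreover have "f m = \<tau>"
    proof -
      have "f m = (f a + f a') / 2"
        by (simp add: f_def m add_divide_distrib distrib_right sum.distrib sum_divide_distrib)
      then show ?thesis using a(2) that(2) by simp
    qed
    ultimately have "card (supp m) \<le> card (supp a)" by (rule a(3))
    moreover have "supp m = supp a \<union> supp a'"
      using PD(1)[OF a(1)] PD(1)[OF that(1)]
      by (auto simp: supp_def m_def s zero_less_divide_iff add_pos_nonneg add_nonneg_pos dest: antisym
          intro: order_neq_le_trans)
    moreover have "finite (supp m)" using J by (simp add: supp_def)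
    ultimately have "supp m = supp a" by (metis card_seteq sup_ge1)
    then show ?thesis using \<open>supp m = supp a \<union> supp a'\<close> by blast
  qed
  have a0: "a j = 0" if "j \<in> J - supp a" for j
    using that PD(1)[OF a(1), of j] by (auto simp: supp_def)
  have "supp a \<noteq> {}"
  proof
    assume "supp a = {}"
    then have "sum a J = 0" using a0 by (intro sum.neutral) auto
    then show False using PD(2)[OF a(1)] by simp
  qed
  moreover have "(\<Sum>i\<in>supp a. a i *\<^sub>R v i) \<in> L"
  proof -
    have "(\<Sum>i\<in>supp a. a i *\<^sub>R v i) = (\<Sum>i\<in>J. a i *\<^sub>R v i)"
      by (rule sum.mono_neutral_left) (use J a0 in \<open>auto simp: supp_def\<close>)
    then show ?thesis using PD(3)[OF a(1)] by simp
  qed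
  moreover have "(\<Sum>j\<in>J. b j * (c j - \<tau>)) \<ge> 0 \<and>
      ((\<Sum>j\<in>J. b j * (c j - \<tau>)) = 0 \<longrightarrow> (\<forall>j\<in>J - supp a. b j = 0))"
    if b: "\<forall>j\<in>J - supp a. b j \<ge> 0" "(\<Sum>j\<in>J. b j *\<^sub>R v j) \<in> L" for b
  proof -
    \<comment> \<open>The first entry keeps the total mass of \<open>a + \<epsilon> b\<close>
      positive, the others keep it nonnegative on the support of \<open>a\<close>. The added 1
      covers vanishing denominators.\<close>
    define \<epsilon> where "\<epsilon> = Min (insert (1 / (\<bar>sum b J\<bar> + 1)) ((\<lambda>j. a j / (\<bar>b j\<bar> + 1)) ` supp a))"
    have fs: "finite (supp a)" using J by (simp add: supp_def)
    have e0: "\<epsilon> > 0" unfolding \<epsilon>_def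
      using fs by (subst Min_gr_iff) (auto simp: supp_def intro!: divide_pos_pos add_nonneg_pos)
    have e1: "\<epsilon> * \<bar>sum b J\<bar> < 1"
    proof -
      have "\<epsilon> \<le> 1 / (\<bar>sum b J\<bar> + 1)" unfolding \<epsilon>_def using fs by (intro Min_le) auto
      then have "\<epsilon> * (\<bar>sum b J\<bar> + 1) \<le> 1" by (simp add: field_simps)
      then show ?thesis using e0 by (simp add: algebra_simps)
    qed
    have nn: "a j + \<epsilon> * b j \<ge> 0" if j: "j \<in> J" for j
    proof (cases "j \<in> supp a")
      case True
      have "\<epsilon> \<le> a j / (\<bar>b j\<bar> + 1)" unfolding \<epsilon>_def using fs True by (intro Min_le) auto
      then have "\<epsilon> * (\<bar>b j\<bar> + 1) \<le> a j" by (simp add: field_simps)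
      moreover have "- (\<epsilon> * b j) \<le> \<epsilon> * \<bar>b j\<bar>" using e0 by (simp add: abs_if)
      ultimately show ?thesis using e0 by (simp add: algebra_simps)
    next
      case False
      then show ?thesis using b(1) j e0 a0 by simp
    qed
    define s where "s = sum (\<lambda>j. a j + \<epsilon> * b j) J"
    have s: "s = 1 + \<epsilon> * sum b J"
      using PD(2)[OF a(1)] by (simp add: s_def sum.distrib sum_distrib_left)
    have "- (\<epsilon> * sum b J) \<le> \<epsilon> * \<bar>sum b J\<bar>" using e0 by (simp add: abs_if)
    then have s0: "s > 0" using e1 s by linarith
    have "(\<Sum>j\<in>J. (a j + \<epsilon> * b j) *\<^sub>R v j) = (\<Sum>j\<in>J. a j *\<^sub>R v j) + \<epsilon> *\<^sub>R (\<Sum>j\<in>J. b j *\<^sub>R v j)"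
      by (simp add: scaleR_add_left sum.distrib scaleR_sum_right)
    then have "(\<Sum>j\<in>J. (a j + \<epsilon> * b j) *\<^sub>R v j) \<in> L"
      using PD(3)[OF a(1)] b(2) L by (simp add: subspace_add subspace_scale)
    then have "(\<lambda>j. if j \<in> J then (a j + \<epsilon> * b j) / sum (\<lambda>j. a j + \<epsilon> * b j) J else 0) \<in> P"
      using nn s0 by (intro PI) (simp_all add: s_def)
    then have mP: "(\<lambda>j. if j \<in> J then (a j + \<epsilon> * b j) / s else 0) \<in> P" (is "?m \<in> P")
      unfolding s_def .
    have fm: "f ?m = (\<tau> + \<epsilon> * (\<Sum>j\<in>J. b j * c j)) / s"
      by (simp add: f_def flip: sum_divide_distrib a(2)) (simp add: algebra_simps sum.distrib sum_distrib_left)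
    \<comment> \<open>Up to the positive factors \<open>\<epsilon>\<close> and \<open>s\<close>, the
      reduced cost of \<open>b\<close> is the change of the objective at the normalised
      perturbation.\<close>
    have eq: "\<epsilon> * (\<Sum>j\<in>J. b j * (c j - \<tau>)) = s * (f ?m - \<tau>)"
      using s0 by (simp add: fm field_simps) (simp add: s algebra_simps sum_subtractf sum_distrib_left)
    have "f ?m \<ge> \<tau>" using a1(2)[OF mP] by (simp add: \<tau>_def)
    then have "\<epsilon> * (\<Sum>j\<in>J. b j * (c j - \<tau>)) \<ge> 0" using eq s0 by simp
    then have "(\<Sum>j\<in>J. b j * (c j - \<tau>)) \<ge> 0" using e0 by (simp add: zero_le_mult_iff)
    moreover have "b j = 0" if "(\<Sum>j\<in>J. b j * (c j - \<tau>)) = 0" "j \<in> J - supp a" for j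
    proof -
      have "f ?m = \<tau>" using eq that(1) s0 by simp
      then have "supp ?m \<subseteq> supp a" by (rule max[OF mP])
      then have "\<not> (a j + \<epsilon> * b j) / s > 0" using that(2) by (auto simp: supp_def)
      then have "\<not> b j > 0" using a0[OF that(2)] e0 s0 by (simp add: zero_less_divide_iff zero_less_mult_iff)
      then show ?thesis using b(1) that(2) by force
    qed
    ultimately show ?thesis by blast
  qed
  ultimately show ?thesis
    by (intro exI[of _ \<tau>] exI[of _ "supp a"] exI[of _ a]) (auto simp: supp_def)
qed

section \<open>Balanced flags\<close>

text \<open>The Newton recursion seen inside one fixed space, with \<open>L\<close> the part already
  divided out. Requiring the relation \<open>a\<close> to be positive on all of \<open>S\<close>
  expresses that the point \<eta>(\<mu>) is in the relative interior of the hull of the points of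
  \<open>S\<close>, so that the minimal face uses all of them.\<close>

inductive balanced_flag :: "'i set \<Rightarrow> ('i \<Rightarrow> 'a::real_vector) \<Rightarrow> ('i \<Rightarrow> real) \<Rightarrow> 'a set \<Rightarrow> bool"
  for I v \<nu> where
  full: "balanced_flag I v \<nu> UNIV"
| step: "\<lbrakk>L \<noteq> UNIV; S = {i \<in> I. v i \<notin> L \<and> \<nu> i = \<mu>}; \<forall>i\<in>I. v i \<notin> L \<longrightarrow> \<mu> \<le> \<nu> i; S \<noteq> {};
    \<forall>i\<in>S. a i > 0; (\<Sum>i\<in>S. a i *\<^sub>R v i) \<in> L; balanced_flag I v \<nu> (span (L \<union> v ` S))\<rbrakk>
    \<Longrightarrow> balanced_flag I v \<nu> L"

lemma balanced_flagE:
  assumes "balanced_flag I v \<nu> L" "L \<noteq> UNIV"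
  obtains S \<mu> a where "S = {i \<in> I. v i \<notin> L \<and> \<nu> i = \<mu>}" "\<forall>i\<in>I. v i \<notin> L \<longrightarrow> \<mu> \<le> \<nu> i" "S \<noteq> {}"
    "\<forall>i\<in>S. a i > 0" "(\<Sum>i\<in>S. a i *\<^sub>R v i) \<in> L"
  using assms(1)
proof cases
  case full
  then show ?thesis using assms(2) by simp
next
  case (step S \<mu> a)
  show ?thesis by (rule that) (fact step)+
qed

text \<open>The measure for building flags by induction: each stage absorbs at least one further
  vector.\<close>

lemma card_outside_span_less:
  assumes "finite I" "S \<subseteq> {i \<in> I. v i \<notin> L}" "S \<noteq> {}"
  shows "card {i \<in> I. v i \<notin> span (L \<union> v ` S)} < card {i \<in> I. v i \<notin> L}"
proof (rule psubset_card_mono)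
  show "finite {i \<in> I. v i \<notin> L}" using assms by simp
  obtain s where s: "s \<in> S" using assms by blast
  have "v s \<in> span (L \<union> v ` S)" using s by (intro span_base) auto
  moreover have "L \<subseteq> span (L \<union> v ` S)" using span_superset by blast
  ultimately show "{i \<in> I. v i \<notin> span (L \<union> v ` S)} \<subset> {i \<in> I. v i \<notin> L}"
    using s assms(2) by blast
qed

lemma exists_outside_subspace:
  assumes "subspace L" "L \<noteq> UNIV" "span (v ` I) = UNIV"
  shows "\<exists>i\<in>I. v i \<notin> L"
proof (rule ccontr)
  assume "\<not> ?thesis"
  then have "span (v ` I) \<subseteq> L" using assms(1) by (intro span_minimal) auto
  then show False using assms by blast
qed

text \<open>A functional that vanishes on \<open>L\<close> removes the terms with
  \<open>v i \<in> L\<close>, whatever their order, so its equation starts with the terms of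
  \<open>S\<close>. Letting the functional vary, the leading coefficients \<open>h\<close>
  themselves form the positive relation modulo \<open>L\<close>.\<close>

lemma balanced_flag_of_critical:
  fixes v :: "'i \<Rightarrow> 'a::real_vector"
  assumes I: "finite I" and sp: "span (v ` I) = UNIV" and h: "\<And>i. i \<in> I \<Longrightarrow> h i > 0"
    and crit: "\<And>\<phi> \<mu>. linear \<phi> \<Longrightarrow> (\<And>i. i \<in> I \<Longrightarrow> \<phi> (v i) \<noteq> (0::real) \<Longrightarrow> \<mu> \<le> \<nu> i) \<Longrightarrow>
        (\<Sum>i | i \<in> I \<and> \<nu> i = \<mu>. h i * \<phi> (v i)) = 0"
    and "subspace L"
  shows "balanced_flag I v \<nu> L"
  using \<open>subspace L\<close>
proof (induction "card {i \<in> I. v i \<notin> L}" arbitrary: L rule: less_induct)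
  case less
  show ?case
  proof (cases "L = UNIV")
    case False
    define J where "J = {i \<in> I. v i \<notin> L}"
    have J: "finite J" "J \<noteq> {}" using exists_outside_subspace[OF less.prems False sp] I by (auto simp: J_def)
    define \<mu> where "\<mu> = Min (\<nu> ` J)"
    define S where "S = {i \<in> I. v i \<notin> L \<and> \<nu> i = \<mu>}"
    have le: "\<mu> \<le> \<nu> i" if "i \<in> I" "v i \<notin> L" for i
      unfolding \<mu>_def using that J by (intro Min_le) (auto simp: J_def)
    have "\<mu> \<in> \<nu> ` J" unfolding \<mu>_def using J by (intro Min_in) auto
    then have S: "S \<noteq> {}" by (auto simp: S_def J_def)
    have "\<phi> (\<Sum>i\<in>S. h i *\<^sub>R v i) = 0" if \<phi>: "linear \<phi>" "\<forall>y\<in>L. \<phi> y = 0" for \<phi> :: "'a \<Rightarrow> real"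
    proof -
      have "(\<Sum>i\<in>S. h i * \<phi> (v i)) = (\<Sum>i | i \<in> I \<and> \<nu> i = \<mu>. h i * \<phi> (v i))"
        by (rule sum.mono_neutral_left) (use I \<phi> in \<open>auto simp: S_def\<close>)
      also have "\<dots> = 0" using \<phi> le by (intro crit) auto
      finally show ?thesis by (simp add: linear_sum[OF \<phi>(1)] linear_scale[OF \<phi>(1)])
    qed
    then have "(\<Sum>i\<in>S. h i *\<^sub>R v i) \<in> L" using subspace_mem_iff[OF less.prems] by blast
    moreover have "balanced_flag I v \<nu> (span (L \<union> v ` S))"
    proof (rule less.hyps)
      show "card {i \<in> I. v i \<notin> span (L \<union> v ` S)} < card {i \<in> I. v i \<notin> L}"
        using I S by (intro card_outside_span_less) (auto simp: S_def)
    qed (rule subspace_span)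
    ultimately show ?thesis using False S_def S le h
      by (intro balanced_flag.step[of L S I v \<nu> \<mu> h]) (auto simp: S_def)
  qed (simp add: balanced_flag.full)
qed

text \<open>The functional is built along the flag: on \<open>span (L \<union> v ` S)\<close> it is the dual certificate of
  the linear programme whose optimal support is \<open>S\<close>.\<close>

lemma balanced_flag_exists:
  fixes v :: "'i \<Rightarrow> 'a::real_vector" and c :: "'i \<Rightarrow> real"
  assumes I: "finite I" and sp: "span (v ` I) = UNIV"
    and pos: "\<And>j. j \<in> I \<Longrightarrow> \<exists>a. (\<forall>i\<in>I. a i \<ge> 0) \<and> a j > (0::real) \<and> (\<Sum>i\<in>I. a i *\<^sub>R v i) = 0"
    and "subspace L" "linear d0"
  shows "\<exists>d. linear d \<and> (\<forall>x\<in>L. d x = d0 x) \<and> balanced_flag I v (\<lambda>i. c i + d (v i)) L"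
  using assms(4,5)
proof (induction "card {i \<in> I. v i \<notin> L}" arbitrary: L d0 rule: less_induct)
  case less
  note L = less.prems(1) and d0 = less.prems(2)
  show ?case
  proof (cases "L = UNIV")
    case True
    then show ?thesis using d0 balanced_flag.full by blast
  next
    case False
    define J where "J = {i \<in> I. v i \<notin> L}"
    have J: "finite J" using I by (simp add: J_def)
    have vJ: "v j \<in> L" if "j \<in> I - J" for j using that by (simp add: J_def)
    obtain j where j: "j \<in> J" using exists_outside_subspace[OF L False sp] by (auto simp: J_def)
    then obtain a0 where a0: "\<And>i. i \<in> I \<Longrightarrow> a0 i \<ge> 0" "a0 j > 0" "(\<Sum>i\<in>I. a0 i *\<^sub>R v i) = 0"
      using pos[of j] by (auto simp: J_def)
    have "(\<Sum>i\<in>I. a0 i *\<^sub>R v i) = (\<Sum>i\<in>I - J. a0 i *\<^sub>R v i) + (\<Sum>i\<in>J. a0 i *\<^sub>R v i)"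
      using I by (intro sum.subset_diff) (auto simp: J_def)
    then have "(\<Sum>i\<in>J. a0 i *\<^sub>R v i) = - (\<Sum>i\<in>I - J. a0 i *\<^sub>R v i)"
      using a0(3) by (simp add: eq_neg_iff_add_eq_0 add.commute)
    also have "\<dots> \<in> L" using vJ L by (intro subspace_neg subspace_sum subspace_scale) auto
    finally have a0L: "(\<Sum>i\<in>J. a0 i *\<^sub>R v i) \<in> L" .
    have a0s: "sum a0 J > 0" using J j a0(1,2) by (intro sum_pos2[of _ j]) (auto simp: J_def)
    have a0J: "\<forall>j\<in>J. a0 j \<ge> 0" using a0(1) by (simp add: J_def)
    obtain \<tau> S a where S: "S \<subseteq> J" "S \<noteq> {}" "\<forall>i\<in>S. a i > 0" "(\<Sum>i\<in>S. a i *\<^sub>R v i) \<in> L"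
      and opt: "\<forall>b. (\<forall>j\<in>J - S. b j \<ge> 0) \<longrightarrow> (\<Sum>j\<in>J. b j *\<^sub>R v j) \<in> L \<longrightarrow>
          (\<Sum>j\<in>J. b j * (c j + d0 (v j) - \<tau>)) \<ge> 0 \<and>
          ((\<Sum>j\<in>J. b j * (c j + d0 (v j) - \<tau>)) = 0 \<longrightarrow> (\<forall>j\<in>J - S. b j = 0))"
      using optimal_relation[OF L J a0J a0s a0L, of "\<lambda>j. c j + d0 (v j)"]
      by (elim exE conjE) (rule that)
    have fS: "finite S" using S(1) J finite_subset by blast
    have restr: "(\<Sum>j\<in>J. (if j \<in> S then r j else 0) *\<^sub>R f j) = (\<Sum>j\<in>S. r j *\<^sub>R f j)"
      for r :: "'i \<Rightarrow> real" and f :: "'i \<Rightarrow> 'b::real_vector"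
      using S(1) J by (intro sum.mono_neutral_cong_right) auto
    \<comment> \<open>A relation supported on \<open>S\<close> is an admissible direction with both
      signs, so the optimality inequality is an equality. This is the compatibility needed to
      prescribe the value \<open>\<tau>\<close> on all of \<open>S\<close>.\<close>
    have "(\<Sum>i\<in>S. r i * (\<tau> - c i - d0 (v i))) = 0" if r: "(\<Sum>i\<in>S. r i *\<^sub>R v i) \<in> L" for r
    proof -
      let ?f = "\<lambda>j. c j + d0 (v j) - \<tau>"
      have "(\<Sum>j\<in>J. (if j \<in> S then r j else 0) * ?f j) \<ge> 0"
        using opt[THEN spec, of "\<lambda>j. if j \<in> S then r j else 0"] r by (simp add: restr)
      moreover have "(\<Sum>j\<in>J. (if j \<in> S then - r j else 0) * ?f j) \<ge> 0"
        using opt[THEN spec, of "\<lambda>j. if j \<in> S then - r j else 0"] subspace_neg[OF L r]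
          restr[of "\<lambda>j. - r j" v] by (simp add: sum_negf)
      ultimately have "(\<Sum>j\<in>S. r j * ?f j) = 0"
        using restr[of r ?f] restr[of "\<lambda>j. - r j" ?f] by (simp add: sum_negf)
      moreover have "(\<Sum>i\<in>S. r i * (\<tau> - c i - d0 (v i))) = - (\<Sum>j\<in>S. r j * ?f j)"
        by (simp add: algebra_simps flip: sum_negf)
      ultimately show ?thesis by simp
    qed
    then obtain y :: "'a \<Rightarrow> real" where y: "linear y" "\<forall>x\<in>L. y x = 0" "\<forall>i\<in>S. y (v i) = \<tau> - c i - d0 (v i)"
      using interpolating_functional[OF L fS, of v "\<lambda>i. \<tau> - c i - d0 (v i)"] by auto
    define L' where "L' = span (L \<union> v ` S)"
    have L': "subspace L'" "L \<subseteq> L'" "\<And>i. i \<in> S \<Longrightarrow> v i \<in> L'"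
      unfolding L'_def by (auto intro: span_base)
    \<comment> \<open>This stage fixes the functional only on \<open>L'\<close>; the induction
      hypothesis for \<open>d0 + y\<close> extends it without changing it there.\<close>
    have "linear (\<lambda>x. d0 x + y x)" using d0 y(1) by (rule linear_compose_add)
    moreover have "card {i \<in> I. v i \<notin> L'} < card {i \<in> I. v i \<notin> L}"
      unfolding L'_def using I S(1,2) by (intro card_outside_span_less) (auto simp: J_def)
    ultimately obtain d where d: "linear d" "\<And>x. x \<in> L' \<Longrightarrow> d x = d0 x + y x"
      "balanced_flag I v (\<lambda>i. c i + d (v i)) L'"
      using less.hyps[of L' "\<lambda>x. d0 x + y x"] L'(1) by blast
    define \<nu> where "\<nu> = (\<lambda>i. c i + d (v i))"
    have dL: "d x = d0 x" if "x \<in> L" for x using that d(2) L'(2) y(2) by auto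
    have \<nu>S: "\<nu> i = \<tau>" if "i \<in> S" for i using that d(2)[OF L'(3)] y(3) by (simp add: \<nu>_def)
    \<comment> \<open>Optimality was proved with \<open>d0\<close>. It carries over to
      \<open>d\<close> because the combination formed with \<open>b\<close> lies in
      \<open>L\<close>, where the two functionals agree.\<close>
    have opt': "(\<Sum>j\<in>J. b j * (\<nu> j - \<tau>)) \<ge> 0 \<and>
        ((\<Sum>j\<in>J. b j * (\<nu> j - \<tau>)) = 0 \<longrightarrow> (\<forall>j\<in>J - S. b j = 0))"
      if "\<And>j. j \<in> J - S \<Longrightarrow> b j \<ge> 0" "(\<Sum>j\<in>J. b j *\<^sub>R v j) \<in> L" for b
    proof -
      have "(\<Sum>j\<in>J. b j * d (v j)) = (\<Sum>j\<in>J. b j * d0 (v j))"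
        using dL[OF that(2)] by (simp add: linear_sum[OF d(1)] linear_scale[OF d(1)] linear_sum[OF d0] linear_scale[OF d0])
      then have "(\<Sum>j\<in>J. b j * (\<nu> j - \<tau>)) = (\<Sum>j\<in>J. b j * (c j + d0 (v j) - \<tau>))"
        by (simp add: \<nu>_def algebra_simps sum.distrib sum_subtractf)
      then show ?thesis using opt that by simp
    qed
    have split: "(\<Sum>j\<in>J. b j *\<^sub>R f j) = (\<Sum>j\<in>J - S. b j *\<^sub>R f j) + (\<Sum>j\<in>S. b j *\<^sub>R f j)"
      for b :: "'i \<Rightarrow> real" and f :: "'i \<Rightarrow> 'b::real_vector"
      by (rule sum.subset_diff[OF S(1) J])
    \<comment> \<open>Strict complementarity makes the inequality strict. If
      \<open>v i \<in> L'\<close>, the test direction has coefficient 1 at \<open>i\<close> and is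
      otherwise supported on \<open>S\<close>, so its reduced cost is
      \<open>\<nu> i - \<tau>\<close>.\<close>
    have gt: "\<tau> < \<nu> i" if i: "i \<in> J - S" for i
    proof (cases "v i \<in> L'")
      case True
      then obtain r where r: "v i - (\<Sum>j\<in>S. r j *\<^sub>R v j) \<in> L"
        using span_Un_image[OF L fS] unfolding L'_def by blast
      define b where "b j = (if j \<in> S then - r j else if j = i then 1 else 0)" for j
      have "(\<Sum>j\<in>J - S. b j *\<^sub>R f j) = (\<Sum>j\<in>J - S. if j = i then f j else 0)"
        for f :: "'i \<Rightarrow> 'b::real_vector" by (rule sum.cong) (auto simp: b_def)
      then have bi: "(\<Sum>j\<in>J - S. b j *\<^sub>R f j) = f i" for f :: "'i \<Rightarrow> 'b::real_vector"
        using i J by simp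
      have bS: "(\<Sum>j\<in>S. b j *\<^sub>R f j) = - (\<Sum>j\<in>S. r j *\<^sub>R f j)" for f :: "'i \<Rightarrow> 'b::real_vector"
        by (simp add: b_def flip: sum_negf)
      have bL: "(\<Sum>j\<in>J. b j *\<^sub>R v j) \<in> L" using r by (simp add: split bi bS)
      have b0: "b j \<ge> 0" if "j \<in> J - S" for j using that by (simp add: b_def)
      have *: "(\<Sum>j\<in>J. b j *\<^sub>R (\<nu> j - \<tau>)) \<ge> 0 \<and>
        ((\<Sum>j\<in>J. b j *\<^sub>R (\<nu> j - \<tau>)) = 0 \<longrightarrow> (\<forall>j\<in>J - S. b j = 0))" using opt'[OF b0 bL] by simp
      have eq: "(\<Sum>j\<in>J. b j *\<^sub>R (\<nu> j - \<tau>)) = \<nu> i - \<tau>"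
        unfolding split bi bS using \<nu>S by simp
      have "b i \<noteq> 0" using i by (simp add: b_def)
      then have "\<nu> i - \<tau> \<noteq> 0" using * i unfolding eq by blast
      then show ?thesis using * unfolding eq by linarith
    next
      case False
      have "v i \<notin> L'" by (rule False)
      then have "L' \<noteq> UNIV" by blast
      \<comment> \<open>Outside \<open>L'\<close> it suffices to bound the minimum
        \<open>\<mu>'\<close> of the next stage. Its positive relation modulo \<open>L'\<close> is
        corrected by vectors of \<open>S\<close> to a relation modulo \<open>L\<close>, and the
        reduced cost of the latter is a positive multiple of \<open>\<mu>' - \<tau>\<close>.\<close>
      with d(3) obtain S' \<mu>' a' where S': "S' = {i \<in> I. v i \<notin> L' \<and> \<nu> i = \<mu>'}"
        "\<forall>i\<in>I. v i \<notin> L' \<longrightarrow> \<mu>' \<le> \<nu> i" "S' \<noteq> {}" "\<forall>i\<in>S'. a' i > 0" "(\<Sum>i\<in>S'. a' i *\<^sub>R v i) \<in> L'"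
        unfolding \<nu>_def by (rule balanced_flagE)
      have S'J: "S' \<subseteq> J - S" using S'(1) L'(2,3) by (auto simp: J_def)
      obtain r where r: "(\<Sum>i\<in>S'. a' i *\<^sub>R v i) - (\<Sum>j\<in>S. r j *\<^sub>R v j) \<in> L"
        using span_Un_image[OF L fS, of "\<Sum>i\<in>S'. a' i *\<^sub>R v i" v] S'(5) unfolding L'_def by blast
      define b where "b j = (if j \<in> S then - r j else if j \<in> S' then a' j else 0)" for j
      have bi: "(\<Sum>j\<in>J - S. b j *\<^sub>R f j) = (\<Sum>j\<in>S'. a' j *\<^sub>R f j)" for f :: "'i \<Rightarrow> 'b::real_vector"
        using S'J J by (intro sum.mono_neutral_cong_right) (auto simp: b_def)
      have bS: "(\<Sum>j\<in>S. b j *\<^sub>R f j) = - (\<Sum>j\<in>S. r j *\<^sub>R f j)" for f :: "'i \<Rightarrow> 'b::real_vector"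
        by (simp add: b_def flip: sum_negf)
      have bL: "(\<Sum>j\<in>J. b j *\<^sub>R v j) \<in> L" using r by (simp add: split bi bS)
      have b0: "b j \<ge> 0" if "j \<in> J - S" for j using that S'(4) by (auto simp: b_def less_imp_le)
      have *: "(\<Sum>j\<in>J. b j *\<^sub>R (\<nu> j - \<tau>)) \<ge> 0 \<and>
        ((\<Sum>j\<in>J. b j *\<^sub>R (\<nu> j - \<tau>)) = 0 \<longrightarrow> (\<forall>j\<in>J - S. b j = 0))" using opt'[OF b0 bL] by simp
      have "(\<Sum>j\<in>J. b j *\<^sub>R (\<nu> j - \<tau>)) = (\<Sum>j\<in>S'. a' j *\<^sub>R (\<nu> j - \<tau>))"
        unfolding split bi bS using \<nu>S by simp
      also have "\<dots> = sum a' S' * (\<mu>' - \<tau>)" using S'(1) by (simp add: sum_distrib_right)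
      finally have eq: "(\<Sum>j\<in>J. b j *\<^sub>R (\<nu> j - \<tau>)) = sum a' S' * (\<mu>' - \<tau>)" .
      have fS': "finite S'" using S'(1) I by simp
      have pos': "sum a' S' > 0" using S'(3,4) fS' by (intro sum_pos) auto
      obtain k where k: "k \<in> S'" using S'(3) by blast
      have "b k \<noteq> 0" using k S'J S'(4) by (auto simp: b_def)
      then have "sum a' S' * (\<mu>' - \<tau>) \<noteq> 0" using * k S'J unfolding eq by blast
      then have "\<mu>' \<noteq> \<tau>" by simp
      moreover have "\<mu>' \<ge> \<tau>" using * pos' unfolding eq by (simp add: zero_le_mult_iff)
      ultimately show ?thesis using S'(2)[rule_format, of i] False i by (simp add: J_def)
    qed
    have "i \<in> S \<longleftrightarrow> i \<in> I \<and> v i \<notin> L \<and> \<nu> i = \<tau>" for i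
      using S(1) \<nu>S[of i] gt[of i] by (cases "i \<in> S") (auto simp: J_def)
    then have "S = {i \<in> I. v i \<notin> L \<and> \<nu> i = \<tau>}" by auto
    moreover have "\<forall>i\<in>I. v i \<notin> L \<longrightarrow> \<tau> \<le> \<nu> i"
    proof (intro ballI impI)
      fix i assume "i \<in> I" "v i \<notin> L"
      then show "\<tau> \<le> \<nu> i" using \<nu>S[of i] gt[of i] by (cases "i \<in> S") (auto simp: J_def)
    qed
    ultimately have "balanced_flag I v \<nu> L"
      using d(3) S(2-4) False by (intro balanced_flag.step[of L S I v \<nu> \<tau> a]) (auto simp: L'_def \<nu>_def)
    then show ?thesis using d(1) dL by (auto simp: \<nu>_def)
  qed
qed

text \<open>A basis adapted to the flag. In the dual basis the linearisation of the critical point equations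
  is block triangular, and its diagonal blocks are positive definite.\<close>

definition adapted ::
    "'i set \<Rightarrow> ('i \<Rightarrow> 'a::real_vector) \<Rightarrow> ('i \<Rightarrow> real) \<Rightarrow> 'a set \<Rightarrow> 'a set \<Rightarrow> 'a set \<Rightarrow> ('a \<Rightarrow> real) \<Rightarrow> bool" where
  "adapted I v \<nu> L B0 B \<mu> \<longleftrightarrow> B0 \<subseteq> B \<and> independent B \<and> span B = UNIV \<and>
    (\<forall>b\<in>B - B0. \<forall>i\<in>I. representation B (v i) b \<noteq> 0 \<longrightarrow> \<mu> b \<le> \<nu> i) \<and>
    (\<forall>h y x. (\<forall>i\<in>I. h i > 0) \<longrightarrow> linear y \<longrightarrow> (\<forall>x\<in>L. y x = 0) \<longrightarrow>
      (\<forall>b\<in>B - B0. (\<Sum>i | i \<in> I \<and> \<nu> i = \<mu> b. h i * y (v i) * representation B (v i) b) = 0) \<longrightarrow>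
      y x = (0::real)) \<and>
    (\<forall>g u0. (\<forall>i\<in>I. g i > 0) \<longrightarrow> linear u0 \<longrightarrow> (\<exists>u. linear u \<and> (\<forall>x\<in>L. u x = u0 x) \<and>
      (\<forall>b\<in>B - B0. (\<Sum>i | i \<in> I \<and> \<nu> i = \<mu> b. g i * exp (u (v i)) * representation B (v i) b) = 0)))"

text \<open>A basis of \<open>L\<close> is extended to one of \<open>L'\<close>, and the new vectors
  receive the order of the stage. Their coordinate functionals vanish on \<open>L\<close>, so at
  that order they see only \<open>S\<close>: the equations of a stage involve the unknown functional
  only on \<open>L'\<close>, and the stages can be solved one after another.\<close>

lemma adapted_exists:
  fixes v :: "'i \<Rightarrow> 'a::real_vector"
  assumes "balanced_flag I v \<nu> L" "subspace L"
    and I: "finite I" and F: "finite F" "span F = (UNIV :: 'a set)"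
    and "independent B0" "span B0 = L"
  shows "\<exists>B \<mu>. adapted I v \<nu> L B0 B \<mu>"
  using assms(1,2,6,7)
proof (induction arbitrary: B0 rule: balanced_flag.induct)
  case full
  then show ?case unfolding adapted_def by (intro exI[of _ B0] exI[of _ "\<lambda>_. 0"]) auto
next
  case (step L S \<mu>0 a)
  note L = step.prems(1) and B0 = step.prems(2,3)
  define L' where "L' = span (L \<union> v ` S)"
  have L': "subspace L'" "L \<subseteq> L'" "\<And>i. i \<in> S \<Longrightarrow> v i \<in> L'"
    unfolding L'_def by (auto intro: span_base)
  have fS: "finite S" using I step.hyps(2) by simp
  have "B0 \<subseteq> L'" using B0(2) L'(2) span_superset by blast
  then obtain B1 where B1: "B0 \<subseteq> B1" "B1 \<subseteq> L'" "independent B1" "L' \<subseteq> span B1"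
    using maximal_independent_subset_extend[OF _ B0(1)] by metis
  have spB1: "span B1 = L'" using B1 L'(1) by (simp add: span_minimal subset_antisym)
  obtain B \<mu> where ad: "adapted I v \<nu> L' B1 B \<mu>"
    using step.IH[folded L'_def, OF L'(1) B1(3) spB1] by blast
  have B: "B1 \<subseteq> B" "independent B" "span B = UNIV"
    and ord: "\<And>b i. b \<in> B - B1 \<Longrightarrow> i \<in> I \<Longrightarrow> representation B (v i) b \<noteq> 0 \<Longrightarrow> \<mu> b \<le> \<nu> i"
    and inj: "\<And>h y x. \<forall>i\<in>I. h i > 0 \<Longrightarrow> linear y \<Longrightarrow> \<forall>x\<in>L'. y x = 0 \<Longrightarrow>
      \<forall>b\<in>B - B1. (\<Sum>i | i \<in> I \<and> \<nu> i = \<mu> b. h i * y (v i) * representation B (v i) b) = 0 \<Longrightarrow> y x = 0"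
    and ex: "\<And>g u0. \<forall>i\<in>I. g i > 0 \<Longrightarrow> linear u0 \<Longrightarrow> \<exists>u. linear u \<and> (\<forall>x\<in>L'. u x = u0 x) \<and>
      (\<forall>b\<in>B - B1. (\<Sum>i | i \<in> I \<and> \<nu> i = \<mu> b. g i * exp (u (v i)) * representation B (v i) b) = 0)"
    using ad by (simp_all add: adapted_def)
  define e where "e b x = representation B x b" for b x
  have e: "linear (e b)" for b unfolding e_def by (rule linear_representation[OF B(2,3)])
  have eL: "e b x = 0" if "x \<in> L" "b \<in> B - B0" for b x
    unfolding e_def
    by (rule representation_eq_0_outside[OF B(2) subset_trans[OF B1(1) B(1)]]) (use that B0(2) in auto)
  define \<mu>' where "\<mu>' b = (if b \<in> B1 then \<mu>0 else \<mu> b)" for b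
  \<comment> \<open>Terms of the same order that are not in \<open>S\<close> have
    \<open>v i \<in> L\<close> and are killed by the coordinate.\<close>
  have sumS: "(\<Sum>i | i \<in> I \<and> \<nu> i = \<mu>' b. f i * e b (v i)) = e b (\<Sum>i\<in>S. f i *\<^sub>R v i)"
    if "b \<in> B1 - B0" for b f
  proof -
    have "(\<Sum>i\<in>S. f i * e b (v i)) = (\<Sum>i | i \<in> I \<and> \<nu> i = \<mu>' b. f i * e b (v i))"
      by (rule sum.mono_neutral_left) (use I that B(1) eL step.hyps(2) in \<open>auto simp: \<mu>'_def\<close>)
    then show ?thesis by (simp add: linear_sum[OF e] linear_scale[OF e])
  qed
  have "\<mu>' b \<le> \<nu> i" if "b \<in> B - B0" "i \<in> I" "e b (v i) \<noteq> 0" for b i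
    using that ord[of b i] eL[of "v i" b] step.hyps(3) by (auto simp: \<mu>'_def e_def)
  moreover have "y x = 0" if h: "\<forall>i\<in>I. h i > 0" and y: "linear y" "\<forall>x\<in>L. y x = 0"
    and eq: "\<forall>b\<in>B - B0. (\<Sum>i | i \<in> I \<and> \<nu> i = \<mu>' b. h i * y (v i) * e b (v i)) = 0" for h y x
  proof -
    \<comment> \<open>The equations for \<open>B1 - B0\<close> place \<open>?s\<close> in
      \<open>L\<close>, where \<open>y\<close> is zero, while \<open>y ?s\<close> is a sum of
      squares with positive weights. This is the definiteness of the diagonal block; it makes
      \<open>y\<close> vanish on \<open>L'\<close>, which starts the next block.\<close>
    let ?s = "\<Sum>i\<in>S. (h i * y (v i)) *\<^sub>R v i"
    have e0: "representation B ?s b = 0" if "b \<in> B1 - B0" for b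
    proof -
      have "b \<in> B - B0" using that B(1) by blast
      then show ?thesis using eq sumS[OF that, of "\<lambda>i. h i * y (v i)"] by (simp add: e_def)
    qed
    have "?s \<in> span B1" unfolding spB1 using L' by (intro subspace_sum subspace_scale) auto
    then have "?s \<in> L"
      unfolding B0(2)[symmetric] by (rule mem_span_if_representation_0[OF B(2,1)]) (rule e0)
    then have "0 = y ?s" using y(2) by simp
    also have "\<dots> = (\<Sum>i\<in>S. h i * (y (v i))\<^sup>2)"
      by (simp add: linear_sum[OF y(1)] linear_scale[OF y(1)] power2_eq_square mult.assoc)
    finally have hy: "\<forall>i\<in>S. h i * (y (v i))\<^sup>2 = 0"
      using fS h step.hyps(2) sum_nonneg_eq_0_iff[of S "\<lambda>i. h i * (y (v i))\<^sup>2"] by (simp add: less_imp_le)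
    have yS: "y (v i) = 0" if "i \<in> S" for i
    proof -
      have "h i > 0" using h that step.hyps(2) by blast
      then show ?thesis using bspec[OF hy that] by simp
    qed
    have "\<forall>x\<in>L'. y x = 0"
    proof
      fix x assume "x \<in> L'"
      moreover have "L \<union> v ` S \<subseteq> {x. y x = 0}" using y(2) yS by auto
      ultimately show "y x = 0"
        unfolding L'_def using span_minimal[OF _ linear_subspace_kernel[OF y(1)]] by blast
    qed
    moreover have "\<forall>b\<in>B - B1. (\<Sum>i | i \<in> I \<and> \<nu> i = \<mu> b. h i * y (v i) * representation B (v i) b) = 0"
    proof
      fix b assume b: "b \<in> B - B1"
      then have "b \<in> B - B0" using B1(1) by blast
      with eq have "(\<Sum>i | i \<in> I \<and> \<nu> i = \<mu>' b. h i * y (v i) * e b (v i)) = 0" by blast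
      then show "(\<Sum>i | i \<in> I \<and> \<nu> i = \<mu> b. h i * y (v i) * representation B (v i) b) = 0"
        using b by (simp add: \<mu>'_def e_def)
    qed
    ultimately show ?thesis using inj[OF h y(1)] by blast
  qed
  moreover have "\<exists>u. linear u \<and> (\<forall>x\<in>L. u x = u0 x) \<and>
      (\<forall>b\<in>B - B0. (\<Sum>i | i \<in> I \<and> \<nu> i = \<mu>' b. g i * exp (u (v i)) * e b (v i)) = 0)"
    if g: "\<forall>i\<in>I. g i > 0" and u0: "linear u0" for g u0
  proof -
    \<comment> \<open>The given \<open>u0\<close> is absorbed into the weights. Later stages
      preserve the values on \<open>L'\<close>, so the equations solved here survive.\<close>
    obtain y where y: "linear y" "\<forall>x\<in>L. y x = 0"
      "(\<Sum>i\<in>S. (g i * exp (u0 (v i)) * exp (y (v i))) *\<^sub>R v i) \<in> L"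
      using exp_sum_critical[OF L fS, of "\<lambda>i. g i * exp (u0 (v i))" a v] g step.hyps(2,5,6) by auto
    have "linear (\<lambda>x. u0 x + y x)" using u0 y(1) by (rule linear_compose_add)
    then obtain u where u: "linear u" "\<forall>x\<in>L'. u x = u0 x + y x"
      "\<forall>b\<in>B - B1. (\<Sum>i | i \<in> I \<and> \<nu> i = \<mu> b. g i * exp (u (v i)) * representation B (v i) b) = 0"
      using ex[OF g] by blast
    have "(\<Sum>i\<in>S. (g i * exp (u (v i))) *\<^sub>R v i) = (\<Sum>i\<in>S. (g i * exp (u0 (v i)) * exp (y (v i))) *\<^sub>R v i)"
      using u(2) L'(3) by (intro sum.cong) (auto simp: exp_add)
    then have "(\<Sum>i\<in>S. (g i * exp (u (v i))) *\<^sub>R v i) \<in> L" using y(3) by simp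
    then have "(\<Sum>i | i \<in> I \<and> \<nu> i = \<mu>' b. g i * exp (u (v i)) * e b (v i)) = 0" if "b \<in> B1 - B0" for b
      using sumS[OF that, of "\<lambda>i. g i * exp (u (v i))"] eL that B(1) by auto
    moreover have "(\<Sum>i | i \<in> I \<and> \<nu> i = \<mu>' b. g i * exp (u (v i)) * e b (v i)) = 0" if "b \<in> B - B1" for b
      using u(3) that by (simp add: \<mu>'_def e_def)
    ultimately have "\<forall>b\<in>B - B0. (\<Sum>i | i \<in> I \<and> \<nu> i = \<mu>' b. g i * exp (u (v i)) * e b (v i)) = 0" by blast
    then show ?thesis using u(1,2) y(2) L'(2) by (intro exI[of _ u]) auto
  qed
  ultimately have "adapted I v \<nu> L B0 B \<mu>'"
    using B(2,3) subset_trans[OF B1(1) B(1)] unfolding e_def adapted_def by blast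
  then show ?case by blast
qed

section \<open>The canonical point of a Newton datum\<close>

text \<open>\<open>D\<close> is a retraction of \<eta>. Since quotients are represented by subspaces
  of the same type, one functional \<open>D\<close> can serve for all steps of the
  recursion.\<close>

definition newton_compat ::
    "('u::real_vector, 'v::real_vector) newton_datum \<Rightarrow> ('v \<Rightarrow> real) \<Rightarrow> bool" where
  "newton_compat \<Xi> D \<longleftrightarrow> linear D \<and> linear (nd_eta \<Xi>) \<and> linear (nd_beta \<Xi>) \<and> subspace (nd_V \<Xi>) \<and>
     range (nd_eta \<Xi>) = {x \<in> nd_V \<Xi>. nd_beta \<Xi> x = 0} \<and> (\<forall>c. D (nd_eta \<Xi> c) = c) \<and>
     nd_beta \<Xi> ` nd_V \<Xi> = nd_U \<Xi> \<and> finite (nd_pts' \<Xi>) \<and> nd_pts' \<Xi> \<subseteq> nd_V \<Xi>"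

text \<open>The hypotheses say that \<open>\<eta>(\<mu>)\<close> lies in the relative interior of the face of \<open>\<Delta>\<close> on which
  \<open>D\<close> is minimal; so this face is \<open>F\<close>, and \<open>\<mu>\<close> is \<open>\<tau>\<close>.\<close>

lemma newton_step_face:
  assumes D: "newton_compat \<Xi> D"
    and S: "S = {w \<in> nd_pts' \<Xi>. D w = \<mu>}" and le: "\<And>w. w \<in> nd_pts' \<Xi> \<Longrightarrow> \<mu> \<le> D w"
    and ne: "S \<noteq> {}" and a: "\<And>w. w \<in> S \<Longrightarrow> a w > 0" "(\<Sum>w\<in>S. a w *\<^sub>R nd_beta \<Xi> w) = 0"
  shows "nd_E \<Xi> \<subseteq> {x \<in> nd_V \<Xi>. D x = 0}" "nd_beta \<Xi> ` nd_E \<Xi> = span (nd_beta \<Xi> ` S)"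
proof -
  note D = D[unfolded newton_compat_def]
  define V \<eta> \<beta> P \<Delta> where "V = nd_V \<Xi>" and "\<eta> = nd_eta \<Xi>" and "\<beta> = nd_beta \<Xi>" and "P = nd_pts' \<Xi>"
    and "\<Delta> = nd_Delta \<Xi>"
  have lD: "linear D" and l\<eta>: "linear \<eta>" and l\<beta>: "linear \<beta>" and V: "subspace V"
    and rng: "range \<eta> = {x \<in> V. \<beta> x = 0}" and D\<eta>: "\<And>c. D (\<eta> c) = c" and P: "finite P" "P \<subseteq> V"
    using D by (auto simp: V_def \<eta>_def \<beta>_def P_def)
  have \<Delta>: "\<Delta> = convex hull P" by (simp add: \<Delta>_def nd_Delta_def P_def)
  have SP: "S \<subseteq> P" "finite S" and DS: "\<And>w. w \<in> S \<Longrightarrow> D w = \<mu>"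
    using S P by (auto simp: P_def)
  have le\<Delta>: "\<mu> \<le> D x" if "x \<in> \<Delta>" for x
  proof -
    have "convex {x. \<mu> \<le> D x}"
      using convex_linear_vimage[OF lD, of "{\<mu>..}"] by (simp add: vimage_def)
    then have "\<Delta> \<subseteq> {x. \<mu> \<le> D x}" unfolding \<Delta> using le by (intro hull_minimal) (auto simp: P_def)
    then show ?thesis using that by blast
  qed
  have SD: "convex hull S \<subseteq> {x. D x = \<mu>}"
  proof (rule hull_minimal)
    show "convex {x. D x = \<mu>}"
      using convex_linear_vimage[OF lD, of "{\<mu>}"] by (simp add: vimage_def)
  qed (use DS in auto)
  \<comment> \<open>In a convex combination the terms \<open>u w * (D w - \<mu>)\<close> are
    nonnegative, so their sum is zero only if all weight is on \<open>S\<close>.\<close>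
  have face: "convex hull S = {x \<in> \<Delta>. D x = \<mu>}"
  proof (intro equalityI subsetI)
    fix x assume "x \<in> convex hull S"
    then show "x \<in> {x \<in> \<Delta>. D x = \<mu>}" using SD hull_mono[OF SP(1)] by (auto simp: \<Delta>)
  next
    fix x assume x: "x \<in> {x \<in> \<Delta>. D x = \<mu>}"
    then obtain u where u: "\<And>w. w \<in> P \<Longrightarrow> u w \<ge> 0" "sum u P = 1" "(\<Sum>w\<in>P. u w *\<^sub>R w) = x"
      unfolding \<Delta> convex_hull_finite[OF P(1)] by auto
    have "(\<Sum>w\<in>P. u w * (D w - \<mu>)) = D x - \<mu> * sum u P"
      unfolding u(3)[symmetric]
      by (simp add: linear_sum[OF lD] linear_scale[OF lD] algebra_simps sum_subtractf sum_distrib_left)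
    also have "\<dots> = 0" using x u(2) by simp
    finally have "\<forall>w\<in>P. u w * (D w - \<mu>) = 0"
      using P(1) u(1) le by (subst (asm) sum_nonneg_eq_0_iff) (auto simp: P_def)
    then have 0: "u w = 0" if "w \<in> P - S" for w using that S by (auto simp: P_def)
    have "(\<Sum>w\<in>S. u w *\<^sub>R w) = x" "sum u S = 1"
      using u(2,3) sum.mono_neutral_left[OF P(1) SP(1), of "\<lambda>w. u w *\<^sub>R w"]
        sum.mono_neutral_left[OF P(1) SP(1), of u] 0 by simp_all
    then show "x \<in> convex hull S"
      unfolding convex_hull_finite[OF SP(2)] using u(1) SP(1) by blast
  qed
  define A where "A = sum a S"
  have A: "A > 0" unfolding A_def using SP(2) ne a(1) by (intro sum_pos) auto
  \<comment> \<open>The weighted barycentre of \<open>S\<close>. The relation puts it into the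
    kernel of \<beta>, hence on the line \<eta>(R), and \<open>D\<close> reads off its parameter
    \<open>\<mu>\<close>.\<close>
  define z where "z = (1 / A) *\<^sub>R (\<Sum>w\<in>S. a w *\<^sub>R w)"
  have zS: "z = (\<Sum>w\<in>S. (a w / A) *\<^sub>R w)" by (simp add: z_def scaleR_sum_right)
  have z\<eta>: "z = \<eta> \<mu>"
  proof -
    have "\<beta> z = 0"
      using a(2) by (simp add: z_def linear_scale[OF l\<beta>] linear_sum[OF l\<beta>] \<beta>_def[symmetric])
    moreover have "z \<in> V" unfolding zS using V SP(1) P(2) by (intro subspace_sum subspace_scale) auto
    ultimately obtain c where c: "z = \<eta> c" using rng by blast
    have "D z = (1 / A) * (\<Sum>w\<in>S. a w * \<mu>)"
      using DS by (simp add: z_def linear_scale[OF lD] linear_sum[OF lD])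
    also have "\<dots> = \<mu>" using A by (simp add: A_def flip: sum_distrib_right)
    finally show ?thesis using c D\<eta> by simp
  qed
  have zF: "z \<in> convex hull S"
    unfolding convex_hull_finite[OF SP(2)] zS using a(1) A
    by (intro CollectI exI[of _ "\<lambda>w. a w / A"]) (auto simp: less_imp_le A_def simp flip: sum_divide_distrib)
  have tau: "nd_tau \<Xi> = \<mu>"
    unfolding nd_tau_def
  proof (rule Least_equality)
    show "nd_eta \<Xi> \<mu> \<in> nd_Delta \<Xi>" using zF face z\<eta> by (auto simp: \<eta>_def \<Delta>_def)
    show "\<mu> \<le> c" if "nd_eta \<Xi> c \<in> nd_Delta \<Xi>" for c
      using le\<Delta>[of "\<eta> c"] that D\<eta>[of c] by (simp add: \<eta>_def \<Delta>_def)
  qed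
  have Fface: "convex hull S face_of \<Delta>"
    unfolding face_of_def
  proof (intro conjI ballI impI)
    show "convex hull S \<subseteq> \<Delta>" using face by blast
    fix x y w assume xy: "x \<in> \<Delta>" "y \<in> \<Delta>" "w \<in> convex hull S" "w \<in> open_segment x y"
    obtain s where s: "0 < s" "s < 1" "w = (1 - s) *\<^sub>R x + s *\<^sub>R y" using xy(4) by (auto simp: in_segment)
    have "(1 - s) * (D x - \<mu>) + s * (D y - \<mu>) = D w - \<mu>"
      unfolding s(3) linear_add[OF lD] linear_scale[OF lD] by (simp add: algebra_simps)
    also have "\<dots> = 0" using xy(3) SD by auto
    finally have "(1 - s) * (D x - \<mu>) + s * (D y - \<mu>) = 0" .
    moreover have "(1 - s) * (D x - \<mu>) \<ge> 0" "s * (D y - \<mu>) \<ge> 0" using s le\<Delta>[OF xy(1)] le\<Delta>[OF xy(2)] by simp_all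
    ultimately have "(1 - s) * (D x - \<mu>) = 0" "s * (D y - \<mu>) = 0" by linarith+
    then have "D x = \<mu>" "D y = \<mu>" using s by simp_all
    then show "x \<in> convex hull S" "y \<in> convex hull S" using face xy by blast+
  qed (rule convex_convex_hull)
  have nface: "nd_face \<Xi> = convex hull S"
    unfolding nd_face_def tau
  proof (rule Least_equality)
    \<comment> \<open>If the face is the whole polytope, it lies in the hyperplane where
      \<open>D\<close> is \<open>\<mu>\<close>, which misses \<open>\<eta> (\<mu> + 1)\<close>. So
      the improper face occurs only when it is allowed.\<close>
    have "affine hull \<Delta> \<noteq> V" if "convex hull S = \<Delta>"
    proof
      assume aff: "affine hull \<Delta> = V"
      have "affine {x. D x = \<mu>}"
        unfolding affine_def by (auto simp: linear_add[OF lD] linear_scale[OF lD] simp flip: distrib_right)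
      then have "affine hull \<Delta> \<subseteq> {x. D x = \<mu>}" using that SD by (intro hull_minimal) auto
      moreover have "\<eta> (\<mu> + 1) \<in> V" using rng by blast
      ultimately have "D (\<eta> (\<mu> + 1)) = \<mu>" using aff by blast
      then show False using D\<eta> by simp
    qed
    then show "convex hull S face_of nd_Delta \<Xi> \<and> nd_eta \<Xi> \<mu> \<in> convex hull S \<and>
        (convex hull S = nd_Delta \<Xi> \<longrightarrow> affine hull nd_Delta \<Xi> \<noteq> nd_V \<Xi>)"
      using Fface zF z\<eta> by (auto simp: \<Delta>_def \<eta>_def V_def)
    fix G assume G: "G face_of nd_Delta \<Xi> \<and> nd_eta \<Xi> \<mu> \<in> G \<and>
        (G = nd_Delta \<Xi> \<longrightarrow> affine hull nd_Delta \<Xi> \<noteq> nd_V \<Xi>)"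
    then have Gf: "G face_of \<Delta>" and zG: "z \<in> G" by (auto simp: \<Delta>_def z\<eta> \<eta>_def)
    \<comment> \<open>Unless it equals \<open>w\<close>, the barycentre \<open>z\<close> is strictly
      between \<open>w\<close> and the normalised barycentre \<open>y\<close> of the other points,
      so a face through \<open>z\<close> contains \<open>w\<close>.\<close>
    have "w \<in> G" if w: "w \<in> S" for w
    proof (cases "w = z")
      case False
      have zsplit: "z = (a w / A) *\<^sub>R w + (\<Sum>x\<in>S - {w}. (a x / A) *\<^sub>R x)"
        unfolding zS using SP(2) w by (simp add: sum.remove)
      have sums: "a w / A + (\<Sum>x\<in>S - {w}. a x / A) = 1"
        using SP(2) w A by (simp add: A_def sum.remove[of S w] flip: sum_divide_distrib add_divide_distrib)
      define s where "s = (\<Sum>x\<in>S - {w}. a x / A)"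
      have s0: "s \<ge> 0" unfolding s_def using a(1) A by (intro sum_nonneg) (simp add: less_imp_le)
      have "s \<noteq> 0"
      proof
        assume "s = 0"
        then have "\<forall>x\<in>S - {w}. a x / A = 0"
          unfolding s_def using SP(2) a(1) A by (subst (asm) sum_nonneg_eq_0_iff) (auto simp: less_imp_le)
        then have Sw: "S - {w} = {}" using a(1) A by force
        have "z = w" using zsplit sums unfolding Sw by simp
        then show False using False by simp
      qed
      then have s: "s > 0" "s < 1" using s0 sums a(1)[OF w] A by (auto simp: s_def[symmetric] intro: divide_pos_pos)
          (metis add_less_cancel_right add_0 divide_pos_pos)
      define y where "y = (\<Sum>x\<in>S - {w}. (a x / A / s) *\<^sub>R x)"
      have "(\<Sum>x\<in>S - {w}. a x / A / s) = (\<Sum>x\<in>S - {w}. a x / A) / s"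
        by (rule sum_divide_distrib[symmetric])
      also have "\<dots> = 1" unfolding s_def[symmetric] using s by simp
      finally have sum1: "(\<Sum>x\<in>S - {w}. a x / A / s) = 1" .
      have "\<forall>x\<in>S - {w}. a x / A / s \<ge> 0" using a(1) A s by (simp add: less_imp_le)
      then have "y \<in> convex hull (S - {w})"
        unfolding convex_hull_finite[OF finite_Diff[OF SP(2)]] y_def
        by (intro CollectI exI[of _ "\<lambda>x. a x / A / s"] conjI sum1 refl)
      then have y\<Delta>: "y \<in> \<Delta>" using hull_mono[of "S - {w}" P] SP(1) by (auto simp: \<Delta>)
      have w\<Delta>: "w \<in> \<Delta>" using w SP(1) hull_inc[of w P convex] by (auto simp: \<Delta>)
      have zy: "z = (1 - s) *\<^sub>R w + s *\<^sub>R y"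
      proof -
        have "s *\<^sub>R y = (\<Sum>x\<in>S - {w}. (a x / A) *\<^sub>R x)" using s by (simp add: y_def scaleR_sum_right)
        moreover have "1 - s = a w / A" using sums by (simp add: s_def)
        ultimately show ?thesis using zsplit by simp
      qed
      have "w \<noteq> y"
      proof
        assume "w = y"
        then have "z = w" using zy by (simp flip: scaleR_add_left)
        then show False using False by simp
      qed
      then have "z \<in> open_segment w y" using zy s by (auto simp: in_segment)
      then show "w \<in> G" using Gf w\<Delta> y\<Delta> zG unfolding face_of_def by blast
    qed (use zG in simp)
    moreover have "convex G" using Gf by (simp add: face_of_def)
    ultimately show "convex hull S \<subseteq> G" by (intro hull_minimal) auto
  qed
  have E: "nd_E \<Xi> = span ((\<lambda>x. x - z) ` (convex hull S))"
    by (simp add: nd_E_def nface tau z\<eta> \<eta>_def)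
  have zV: "z \<in> V" using z\<eta> rng by blast
  have \<Delta>V: "\<Delta> \<subseteq> V" unfolding \<Delta> using P(2) V by (intro hull_minimal subspace_imp_convex)
  show "nd_E \<Xi> \<subseteq> {x \<in> nd_V \<Xi>. D x = 0}"
    unfolding E
  proof (rule span_minimal)
    have "D z = \<mu>" using SD zF by blast
    then show "(\<lambda>x. x - z) ` (convex hull S) \<subseteq> {x \<in> nd_V \<Xi>. D x = 0}"
      using face \<Delta>V zV V by (auto simp: linear_diff[OF lD] subspace_diff V_def)
    have "{x \<in> nd_V \<Xi>. D x = 0} = V \<inter> {x. D x = 0}" by (auto simp: V_def)
    then show "subspace {x \<in> nd_V \<Xi>. D x = 0}" using V linear_subspace_kernel[OF lD] by (simp add: subspace_inter)
  qed
  have "\<beta> z = 0" using z\<eta> rng by blast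
  then have "\<beta> ` (\<lambda>x. x - z) ` (convex hull S) = \<beta> ` (convex hull S)"
    by (simp add: image_image linear_diff[OF l\<beta>])
  also have "\<dots> = convex hull (\<beta> ` S)" by (rule convex_hull_linear_image[OF l\<beta>])
  finally have "\<beta> ` nd_E \<Xi> = span (convex hull (\<beta> ` S))"
    unfolding E by (simp flip: linear_span_image[OF l\<beta>])
  also have "\<dots> = span (\<beta> ` S)"
  proof (rule antisym)
    have "convex hull (\<beta> ` S) \<subseteq> span (\<beta> ` S)" by (intro hull_minimal span_superset subspace_imp_convex subspace_span)
    then show "span (convex hull (\<beta> ` S)) \<subseteq> span (\<beta> ` S)" by (intro span_minimal subspace_span)
    show "span (\<beta> ` S) \<subseteq> span (convex hull (\<beta> ` S))" by (intro span_mono hull_subset)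
  qed
  finally show "nd_beta \<Xi> ` nd_E \<Xi> = span (nd_beta \<Xi> ` S)" by (simp add: \<beta>_def)
qed

section \<open>Following the recursion from one datum to the next\<close>

lemma dim_eq_0_iff:
  assumes F: "finite F" "span F = (UNIV :: 'a::real_vector set)"
  shows "dim (W :: 'a set) = 0 \<longleftrightarrow> W \<subseteq> {0}"
proof -
  obtain B where B: "B \<subseteq> W" "independent B" "W \<subseteq> span B" "card B = dim W" by (rule basis_exists)
  have fB: "finite B" using independent_span_bound[OF F(1) B(2)] F(2) by simp
  show ?thesis
  proof
    assume "dim W = 0"
    then have "B = {}" using B(4) fB by simp
    then show "W \<subseteq> {0}" using B(3) by simp
  next
    assume "W \<subseteq> {0}"
    then have "B = {}" using B(1,2) dependent_zero by blast
    then show "dim W = 0" using B(4) by simp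
  qed
qed

lemma newton_iter_Suc: "newton_iter \<Xi> (Suc k) = newton_iter (newton_step \<Xi>) k"
  by (simp add: newton_iter_def funpow_swap1)

text \<open>The definition appends the last projection, while induction along a flag has to split
  off the first.\<close>

lemma newton_proj_Suc: "newton_proj \<Xi> (Suc k) = newton_proj (newton_step \<Xi>) k \<circ> nd_sigma \<Xi>"
proof (induction k)
  case (Suc k)
  have "newton_proj \<Xi> (Suc (Suc k)) = nd_sigma (newton_iter \<Xi> (Suc k)) \<circ> newton_proj \<Xi> (Suc k)" by simp
  also have "\<dots> = nd_sigma (newton_iter (newton_step \<Xi>) k) \<circ> (newton_proj (newton_step \<Xi>) k \<circ> nd_sigma \<Xi>)"
    by (simp only: Suc newton_iter_Suc)
  finally show ?case by (simp add: comp_assoc)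
qed (simp add: newton_iter_def)

text \<open>The second hypothesis guarantees that the \<open>LEAST\<close> in
  \<open>newton_length\<close> is attained, so the length drops by exactly one.\<close>

lemma d_crit_tilde_step:
  assumes "dim (nd_U \<Xi>) \<noteq> 0" "dim (nd_U (newton_iter (newton_step \<Xi>) k)) = 0"
  shows "d_crit_tilde \<Xi> x = d_crit_tilde (newton_step \<Xi>) (nd_sigma \<Xi> x)"
proof -
  have "newton_length \<Xi> = Suc (newton_length (newton_step \<Xi>))"
    unfolding newton_length_def
    by (subst Least_Suc[of _ "Suc k"]) (use assms in \<open>simp_all add: newton_iter_Suc newton_iter_def[of _ 0]\<close>)
  then show ?thesis
    by (simp only: d_crit_tilde_def newton_iter_Suc newton_proj_Suc comp_apply)
qed

text \<open>A functional vanishing on \<open>E\<close> does not see which representatives of the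
  cosets were chosen.\<close>

lemma newton_compat_step:
  assumes D: "newton_compat \<Xi> D" and E: "nd_E \<Xi> \<subseteq> {x \<in> nd_V \<Xi>. D x = 0}"
  shows "newton_compat (newton_step \<Xi>) D" "D (nd_sigma \<Xi> x) = D x"
proof -
  note D = D[unfolded newton_compat_def]
  define \<sigma> \<rho> where "\<sigma> = nd_sigma \<Xi>" and "\<rho> = nd_rho \<Xi>"
  have lD: "linear D" and l\<eta>: "linear (nd_eta \<Xi>)" and l\<beta>: "linear (nd_beta \<Xi>)" and V: "subspace (nd_V \<Xi>)"
    and rng: "range (nd_eta \<Xi>) = {x \<in> nd_V \<Xi>. nd_beta \<Xi> x = 0}"
    and D\<eta>: "\<And>c. D (nd_eta \<Xi> c) = c" and U: "nd_beta \<Xi> ` nd_V \<Xi> = nd_U \<Xi>"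
    and P: "finite (nd_pts' \<Xi>)" "nd_pts' \<Xi> \<subseteq> nd_V \<Xi>"
    using D by auto
  have sE: "subspace (nd_E \<Xi>)" by (simp add: nd_E_def)
  have s\<beta>E: "subspace (nd_beta \<Xi> ` nd_E \<Xi>)" by (rule linear_subspace_image[OF l\<beta> sE])
  note q = quot_map[OF sE, folded nd_sigma_def, folded \<sigma>_def]
  note r = quot_map[OF s\<beta>E, folded nd_rho_def, folded \<rho>_def]
  show D\<sigma>: "D (nd_sigma \<Xi> x) = D x" for x
  proof -
    have "D (x - \<sigma> x) = 0" using q(4) E by blast
    then show ?thesis by (simp add: linear_diff[OF lD] \<sigma>_def)
  qed
  have \<beta>': "nd_beta (newton_step \<Xi>) (\<sigma> x) = \<rho> (nd_beta \<Xi> x)" for x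
    unfolding \<sigma>_def \<rho>_def by (rule newton_step_beta[OF l\<beta>])
  have "linear (nd_eta (newton_step \<Xi>))"
    using linear_compose[OF l\<eta> q(1)] by (simp add: newton_step_def \<sigma>_def)
  moreover have "linear (nd_beta (newton_step \<Xi>))"
    using linear_compose[OF l\<beta> r(1)] by (simp add: newton_step_def \<rho>_def)
  moreover have "subspace (nd_V (newton_step \<Xi>))"
    using linear_subspace_image[OF q(1) V] by (simp add: newton_step_def \<sigma>_def)
  moreover have "range (nd_eta (newton_step \<Xi>)) = {x \<in> nd_V (newton_step \<Xi>). nd_beta (newton_step \<Xi>) x = 0}"
  proof (intro equalityI subsetI)
    fix x assume "x \<in> range (nd_eta (newton_step \<Xi>))"
    then obtain c where x: "x = \<sigma> (nd_eta \<Xi> c)" by (auto simp: newton_step_def \<sigma>_def)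
    have "nd_eta \<Xi> c \<in> nd_V \<Xi>" "nd_beta \<Xi> (nd_eta \<Xi> c) = 0" using rng by blast+
    then show "x \<in> {x \<in> nd_V (newton_step \<Xi>). nd_beta (newton_step \<Xi>) x = 0}"
      using \<beta>' linear_0[OF r(1)] by (auto simp: x newton_step_def \<sigma>_def[symmetric])
  next
    \<comment> \<open>Exactness in the quotient: \<beta>(y) agrees with \<beta>(e) for some e in
      \<open>E\<close>, so y - e comes from \<eta>, and y has the same image as y - e under
      \<sigma>.\<close>
    fix x assume x: "x \<in> {x \<in> nd_V (newton_step \<Xi>). nd_beta (newton_step \<Xi>) x = 0}"
    then obtain y where y: "y \<in> nd_V \<Xi>" "x = \<sigma> y" by (auto simp: newton_step_def \<sigma>_def)
    have "\<rho> (nd_beta \<Xi> y) = \<rho> 0" using x \<beta>' y linear_0[OF r(1)] by auto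
    then have "nd_beta \<Xi> y \<in> nd_beta \<Xi> ` nd_E \<Xi>" using r(3)[of "nd_beta \<Xi> y" 0] by simp
    then obtain e where e: "e \<in> nd_E \<Xi>" "nd_beta \<Xi> y = nd_beta \<Xi> e" by blast
    have "y - e \<in> nd_V \<Xi>" using y(1) e(1) E V by (auto intro: subspace_diff)
    moreover have "nd_beta \<Xi> (y - e) = 0" using e(2) by (simp add: linear_diff[OF l\<beta>])
    ultimately obtain c where c: "y - e = nd_eta \<Xi> c" using rng by blast
    then have "y - nd_eta \<Xi> c = e" by (simp add: algebra_simps)
    then have "\<sigma> y = \<sigma> (nd_eta \<Xi> c)" using q(3) e(1) by metis
    then show "x \<in> range (nd_eta (newton_step \<Xi>))" using y(2) by (auto simp: newton_step_def \<sigma>_def)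
  qed
  moreover have "\<forall>c. D (nd_eta (newton_step \<Xi>) c) = c" using D\<sigma> D\<eta> by (simp add: newton_step_def)
  moreover have "nd_beta (newton_step \<Xi>) ` nd_V (newton_step \<Xi>) = nd_U (newton_step \<Xi>)"
  proof -
    have "nd_beta (newton_step \<Xi>) ` \<sigma> ` nd_V \<Xi> = \<rho> ` nd_beta \<Xi> ` nd_V \<Xi>"
      by (simp add: image_image \<beta>')
    then show ?thesis unfolding U by (simp add: newton_step_def \<sigma>_def \<rho>_def)
  qed
  moreover have pts: "nd_pts' (newton_step \<Xi>) \<subseteq> \<sigma> ` nd_pts' \<Xi>"
    unfolding nd_pts'_def[of "newton_step \<Xi>"] by (auto simp: newton_step_def \<sigma>_def)
  moreover have "finite (nd_pts' (newton_step \<Xi>))" using pts P(1) finite_surj by blast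
  moreover have "nd_pts' (newton_step \<Xi>) \<subseteq> nd_V (newton_step \<Xi>)"
    using pts P(2) by (auto simp: newton_step_def \<sigma>_def)
  ultimately show "newton_compat (newton_step \<Xi>) D" using lD by (simp add: newton_compat_def)
qed

text \<open>The invariant matching flag and recursion: \<open>\<rho>\<close> identifies U with the
  quotient by \<open>L\<close>, and \<open>s i\<close> is the current position of the i-th point, on
  which \<open>D\<close> still takes the value \<open>\<nu> i\<close>. At the end U is zero, V is
  the line \<eta>(R), and \<open>D\<close> inverts \<eta> there.\<close>

lemma d_crit_tilde_eq:
  fixes v :: "'i \<Rightarrow> 'a::real_vector" and \<Xi> :: "('a, 'v::real_vector) newton_datum"
  assumes "balanced_flag I v \<nu> L" and I: "finite I" and F: "finite F" "span F = (UNIV :: 'a set)"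
    and "newton_compat \<Xi> D" "linear \<rho>" "{x. \<rho> x = 0} = L" "nd_U \<Xi> = range \<rho>"
    and "nd_pts' \<Xi> = s ` {i \<in> I. v i \<notin> L}"
    and "\<And>i. i \<in> I \<Longrightarrow> v i \<notin> L \<Longrightarrow> D (s i) = \<nu> i \<and> nd_beta \<Xi> (s i) = \<rho> (v i)"
  shows "(\<exists>k. dim (nd_U (newton_iter \<Xi> k)) = 0) \<and> (\<forall>x\<in>nd_V \<Xi>. d_crit_tilde \<Xi> x = D x)"
  using assms(1,5-)
proof (induction arbitrary: \<Xi> \<rho> s rule: balanced_flag.induct)
  case full
  have "\<rho> x = 0" for x using full(3) by blast
  then have U: "nd_U \<Xi> = {0}" by (auto simp: full(4))
  then have d: "dim (nd_U (newton_iter \<Xi> 0)) = 0" by (simp add: newton_iter_def dim_eq_0_iff[OF F])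
  then have len: "newton_length \<Xi> = 0" unfolding newton_length_def by (intro Least_eq_0)
  have "d_crit_tilde \<Xi> x = D x" if x: "x \<in> nd_V \<Xi>" for x
  proof -
    have "nd_beta \<Xi> x = 0" using x U full(1) by (auto simp: newton_compat_def)
    then have "x \<in> range (nd_eta \<Xi>)" using x full(1) by (simp add: newton_compat_def)
    then obtain c where c: "x = nd_eta \<Xi> c" by blast
    have D: "D (nd_eta \<Xi> c) = c" for c using full(1) by (simp add: newton_compat_def)
    then have "inj (nd_eta \<Xi>)" by (metis injI)
    then show ?thesis using D by (simp add: d_crit_tilde_def len newton_iter_def c)
  qed
  then show ?case using d by blast
next
  case (step L S \<mu> a)
  note comp = step.prems(1) and \<rho> = step.prems(2) and ker = step.prems(3) and U = step.prems(4)
    and pts = step.prems(5) and si = step.prems(6)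
  have l\<beta>: "linear (nd_beta \<Xi>)" using comp by (simp add: newton_compat_def)
  have fS: "finite S" using I step.hyps(2) by simp
  define W where "W = {w \<in> nd_pts' \<Xi>. D w = \<mu>}"
  have W: "W = s ` S" unfolding W_def pts step.hyps(2) using si by auto
  \<comment> \<open>Distinct indices may have the same image in the quotient, so their weights are
    added.\<close>
  define aw where "aw w = (\<Sum>i | i \<in> S \<and> s i = w. a i)" for w
  have "(\<Sum>w\<in>W. aw w *\<^sub>R nd_beta \<Xi> w) = (\<Sum>w\<in>W. \<Sum>i | i \<in> S \<and> s i = w. a i *\<^sub>R nd_beta \<Xi> (s i))"
    by (simp add: aw_def scaleR_sum_left)
  also have "\<dots> = (\<Sum>i\<in>S. a i *\<^sub>R nd_beta \<Xi> (s i))"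
    unfolding W by (rule sum.image_gen[OF fS, symmetric])
  also have "\<dots> = (\<Sum>i\<in>S. a i *\<^sub>R \<rho> (v i))"
    using si step.hyps(2) by (intro sum.cong) auto
  also have "\<dots> = \<rho> (\<Sum>i\<in>S. a i *\<^sub>R v i)" by (simp add: linear_sum[OF \<rho>] linear_scale[OF \<rho>])
  also have "\<dots> = 0" using step.hyps(6) ker by blast
  finally have rel: "(\<Sum>w\<in>W. aw w *\<^sub>R nd_beta \<Xi> w) = 0" .
  have awpos: "aw w > 0" if "w \<in> W" for w
    unfolding aw_def using that fS step.hyps(5) by (intro sum_pos) (auto simp: W)
  have le: "\<mu> \<le> D w" if "w \<in> nd_pts' \<Xi>" for w
    using that step.hyps(3) si unfolding pts by auto
  have Wne: "W \<noteq> {}" using step.hyps(4) by (simp add: W)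
  note E = newton_step_face[OF comp W_def le Wne awpos rel]
  have comp': "newton_compat (newton_step \<Xi>) D" and D\<sigma>: "\<And>x. D (nd_sigma \<Xi> x) = D x"
    using newton_compat_step[OF comp E(1)] by blast+
  have "nd_beta \<Xi> ` W = \<rho> ` v ` S"
    unfolding W image_image using si step.hyps(2) by (intro image_cong) auto
  then have \<beta>E: "nd_beta \<Xi> ` nd_E \<Xi> = \<rho> ` span (v ` S)"
    using E(2) linear_span_image[OF \<rho>, of "v ` S"] by simp
  have s\<beta>E: "subspace (nd_beta \<Xi> ` nd_E \<Xi>)"
    unfolding \<beta>E by (rule linear_subspace_image[OF \<rho> subspace_span])
  note r = quot_map[OF s\<beta>E, folded nd_rho_def]
  define L' where "L' = span (L \<union> v ` S)"
  have \<rho>': "linear (nd_rho \<Xi> \<circ> \<rho>)" by (rule linear_compose[OF \<rho> r(1)])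
  have "nd_rho \<Xi> y = 0 \<longleftrightarrow> y \<in> \<rho> ` span (v ` S)" for y
    using r(3)[of y 0] linear_0[OF r(1)] \<beta>E by simp
  then have ker0: "(nd_rho \<Xi> \<circ> \<rho>) x = 0 \<longleftrightarrow> \<rho> x \<in> \<rho> ` span (v ` S)" for x by simp
  \<comment> \<open>The recursion divides U by the image of the vectors of \<open>S\<close>; pulled
    back to the fixed space, this is the next member of the flag.\<close>
  have ker': "{x. (nd_rho \<Xi> \<circ> \<rho>) x = 0} = L'"
  proof (intro equalityI subsetI)
    fix x assume "x \<in> {x. (nd_rho \<Xi> \<circ> \<rho>) x = 0}"
    then obtain y where y: "y \<in> span (v ` S)" "\<rho> x = \<rho> y" using ker0 by blast
    then have "x - y \<in> L" using ker by (auto simp: linear_diff[OF \<rho>])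
    then have "x - y \<in> L'" unfolding L'_def by (intro span_base) simp
    moreover have "y \<in> L'" using y(1) span_mono[of "v ` S" "L \<union> v ` S"] unfolding L'_def by blast
    ultimately have "(x - y) + y \<in> L'" unfolding L'_def by (rule span_add)
    then show "x \<in> L'" by simp
  next
    have "L' \<subseteq> {x. (nd_rho \<Xi> \<circ> \<rho>) x = 0}"
      unfolding L'_def
    proof (rule span_minimal)
      show "subspace {x. (nd_rho \<Xi> \<circ> \<rho>) x = 0}" by (rule linear_subspace_kernel[OF \<rho>'])
      have "\<rho> x \<in> \<rho> ` span (v ` S)" if "x \<in> L" for x
      proof -
        have "\<rho> x = \<rho> 0" using that ker linear_0[OF \<rho>] by auto
        then show ?thesis using span_zero by blast
      qed
      moreover have "\<rho> x \<in> \<rho> ` span (v ` S)" if "x \<in> v ` S" for x using that span_base by blast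
      ultimately show "L \<union> v ` S \<subseteq> {x. (nd_rho \<Xi> \<circ> \<rho>) x = 0}" using ker0 by blast
    qed
    then show "x \<in> {x. (nd_rho \<Xi> \<circ> \<rho>) x = 0}" if "x \<in> L'" for x using that by blast
  qed
  have LL': "L \<subseteq> L'" unfolding L'_def using span_superset by blast
  have U': "nd_U (newton_step \<Xi>) = range (nd_rho \<Xi> \<circ> \<rho>)"
    by (simp add: newton_step_def U image_comp)
  have \<beta>s: "nd_beta (newton_step \<Xi>) (nd_sigma \<Xi> (s i)) = (nd_rho \<Xi> \<circ> \<rho>) (v i)" if "i \<in> I" "v i \<notin> L" for i
    using si[OF that] newton_step_beta[OF l\<beta>] by simp
  have pts': "nd_pts' (newton_step \<Xi>) = (nd_sigma \<Xi> \<circ> s) ` {i \<in> I. v i \<notin> L'}"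
  proof -
    have "nd_pts' (newton_step \<Xi>) =
        {w \<in> nd_sigma \<Xi> ` s ` {i \<in> I. v i \<notin> L}. nd_beta (newton_step \<Xi>) w \<noteq> 0}"
      by (simp add: nd_pts'_def[of "newton_step \<Xi>"] pts[symmetric]) (simp add: newton_step_def)
    also have "\<dots> = (nd_sigma \<Xi> \<circ> s) ` {i \<in> I. v i \<notin> L \<and> (nd_rho \<Xi> \<circ> \<rho>) (v i) \<noteq> 0}"
      using \<beta>s by (auto simp: image_iff)
    also have "{i \<in> I. v i \<notin> L \<and> (nd_rho \<Xi> \<circ> \<rho>) (v i) \<noteq> 0} = {i \<in> I. v i \<notin> L'}"
      using ker' LL' by blast
    finally show ?thesis .
  qed
  have IH: "(\<exists>k. dim (nd_U (newton_iter (newton_step \<Xi>) k)) = 0) \<and>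
      (\<forall>x\<in>nd_V (newton_step \<Xi>). d_crit_tilde (newton_step \<Xi>) x = D x)"
  proof (rule step.IH[folded L'_def, OF comp' \<rho>' ker' U' pts'])
    show "D ((nd_sigma \<Xi> \<circ> s) i) = \<nu> i \<and> nd_beta (newton_step \<Xi>) ((nd_sigma \<Xi> \<circ> s) i) = (nd_rho \<Xi> \<circ> \<rho>) (v i)"
      if "i \<in> I" "v i \<notin> L'" for i
      using that LL' \<beta>s[of i] si[of i] D\<sigma> by auto
  qed
  then obtain k where k: "dim (nd_U (newton_iter (newton_step \<Xi>) k)) = 0" by blast
  have "dim (nd_U \<Xi>) \<noteq> 0"
  proof
    assume "dim (nd_U \<Xi>) = 0"
    then have "\<rho> x = 0" for x using U by (auto simp: dim_eq_0_iff[OF F])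
    then show False using ker step.hyps(1) by auto
  qed
  then have "d_crit_tilde \<Xi> x = D x" if "x \<in> nd_V \<Xi>" for x
    using d_crit_tilde_step[OF _ k] IH D\<sigma> that by (simp add: newton_step_def)
  then show ?case using k newton_iter_Suc by metis
qed

text \<open>The functional \<open>(c, x) \<mapsto> c + d x\<close> retracts \<eta> and restricts to
  \<open>d\<close> along the splitting. The start \<open>L = {0}\<close> matches the removal of the
  points with \<beta>(w) = 0.\<close>

lemma d_crit_newton_of_poly:
  fixes v :: "nat \<Rightarrow> 'm::real_normed_vector"
  assumes F: "finite F" "span F = (UNIV :: 'm set)" and d: "linear d"
    and bal: "balanced_flag {1..n} v (\<lambda>i. Val (\<gamma> i) + d (v i)) {0}"
  shows "d_crit (newton_of_poly n \<gamma> v) poly_splitting = d"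
proof
  fix x
  let ?\<Xi> = "newton_of_poly n \<gamma> v"
  have lid: "linear (\<lambda>x::'m. x)" by (intro linearI) auto
  define D where "D = (\<lambda>(c, x). c + d x)"
  have "linear D" unfolding D_def
    by (intro linearI) (auto simp: linear_add[OF d] linear_scale[OF d] algebra_simps)
  moreover have "linear (nd_eta ?\<Xi>)" by (auto simp: newton_of_poly_def intro!: linearI)
  moreover have "range (nd_eta ?\<Xi>) = {x \<in> nd_V ?\<Xi>. nd_beta ?\<Xi> x = 0}"
    by (auto simp: newton_of_poly_def image_iff prod_eq_iff)
  ultimately have "newton_compat ?\<Xi> D"
    using linear_0[OF d]
    by (auto simp: newton_compat_def newton_of_poly_def linear_snd D_def nd_pts'_def)
  moreover have "nd_pts' ?\<Xi> = (\<lambda>i. (Val (\<gamma> i), v i)) ` {i \<in> {1..n}. v i \<notin> {0}}"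
    by (auto simp: newton_of_poly_def nd_pts'_def)
  ultimately have "\<forall>x\<in>nd_V ?\<Xi>. d_crit_tilde ?\<Xi> x = D x"
    using d_crit_tilde_eq[OF bal finite_atLeastAtMost F, of ?\<Xi> D "\<lambda>x. x" "\<lambda>i. (Val (\<gamma> i), v i)"]
      lid
    by (simp add: newton_of_poly_def D_def)
  then show "d_crit ?\<Xi> poly_splitting x = d x"
    by (simp add: d_crit_def newton_of_poly_def poly_splitting_def D_def)
qed

section \<open>Critical points\<close>

text \<open>This compares coefficients at exponent \<open>\<mu>\<close>. Terms with
  \<open>\<phi> (v i) = 0\<close> may start lower, and this freedom is what lets the later stages of
  the flag be read off.\<close>

lemma critical_leading_coefficients:
  fixes v :: "'i \<Rightarrow> 'a" and \<phi> :: "'a \<Rightarrow> real"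
  assumes I: "finite I" and X: "\<And>i. i \<in> I \<Longrightarrow> vge (\<nu> i) (X i)" "\<And>i. i \<in> I \<Longrightarrow> pcoeff (X i) (\<nu> i) = of_real (h i)"
    and 0: "(\<Sum>i\<in>I. \<phi> (v i) *\<^sub>R X i) = 0" and le: "\<And>i. i \<in> I \<Longrightarrow> \<phi> (v i) \<noteq> 0 \<Longrightarrow> \<mu> \<le> \<nu> i"
  shows "(\<Sum>i | i \<in> I \<and> \<nu> i = \<mu>. h i * \<phi> (v i)) = 0"
proof -
  have "complex_of_real (\<Sum>i | i \<in> I \<and> \<nu> i = \<mu>. h i * \<phi> (v i)) =
      (\<Sum>i | i \<in> I \<and> \<nu> i = \<mu>. of_real (\<phi> (v i)) * pcoeff (X i) \<mu>)"
    using X(2) by (auto intro!: sum.cong)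
  also have "\<dots> = (\<Sum>i\<in>I. of_real (\<phi> (v i)) * pcoeff (X i) \<mu>)"
  proof (rule sum.mono_neutral_left)
    show "\<forall>i\<in>I - {i \<in> I. \<nu> i = \<mu>}. of_real (\<phi> (v i)) * pcoeff (X i) \<mu> = 0"
    proof
      fix i assume i: "i \<in> I - {i \<in> I. \<nu> i = \<mu>}"
      show "of_real (\<phi> (v i)) * pcoeff (X i) \<mu> = 0"
      proof (cases "\<phi> (v i) = 0")
        case False
        then have "\<mu> < \<nu> i" using le[of i] i by auto
        then show ?thesis using X(1)[of i] i by (simp add: vge_def)
      qed simp
    qed
  qed (use I in auto)
  also have "\<dots> = pcoeff (\<Sum>i\<in>I. \<phi> (v i) *\<^sub>R X i) \<mu>"
    by (simp only: pcoeff_sum pcoeff_scaleR_of_real)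
  finally show ?thesis using 0 by (simp only: pcoeff_0 of_real_eq_0_iff)
qed

text \<open>For fixed leading parameters \<open>u\<close> and \<open>d\<close>, the critical point equations written in the adapted
  basis and premultiplied by the inverse of their linearisation are of Hensel type.\<close>

lemma higher_order_terms:
  fixes v :: "'i \<Rightarrow> 'm::real_normed_vector"
  assumes I: "finite I" and B: "finite B" "independent B" "span B = (UNIV :: 'm set)"
    and ord: "\<And>b i. b \<in> B \<Longrightarrow> i \<in> I \<Longrightarrow> representation B (v i) b \<noteq> 0 \<Longrightarrow> \<mu> b \<le> \<nu> i"
    and inj: "\<And>y x. linear y \<Longrightarrow> (\<And>b. b \<in> B \<Longrightarrow>
        (\<Sum>i | i \<in> I \<and> \<nu> i = \<mu> b. h i * y (v i) * representation B (v i) b) = 0) \<Longrightarrow> y x = (0::real)"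
    and crit: "\<And>b. b \<in> B \<Longrightarrow> (\<Sum>i | i \<in> I \<and> \<nu> i = \<mu> b. h i * representation B (v i) b) = 0"
    and t: "\<And>i. i \<in> I \<Longrightarrow> vge (\<nu> i) (t i)" "\<And>i. i \<in> I \<Longrightarrow> pcoeff (t i) (\<nu> i) = of_real (h i)"
  shows "\<exists>!w. linear w \<and> range w \<subseteq> max_ideal \<and>
    (\<forall>\<phi>::'m \<Rightarrow> real. linear \<phi> \<longrightarrow> (\<Sum>i\<in>I. \<phi> (v i) *\<^sub>R (t i * pexp (w (v i)))) = 0)"
proof -
  define e where "e b x = representation B x b" for b x
  have e: "linear (e b)" for b unfolding e_def by (rule linear_representation[OF B(2,3)])
  note e_sum = linear_eq_sum_representation[OF B, folded e_def]
  have e_basis: "e b l = (if b = l then 1 else 0)" if "l \<in> B" for b l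
    by (simp add: e_def representation_basis[OF B(2) that])
  \<comment> \<open>The equation dual to \<open>b\<close>, rescaled to start at exponent 0; by
    \<open>ord\<close> no negative exponent remains.\<close>
  define C0 where "C0 b i = monom 1 (- \<mu> b) * (e b (v i) *\<^sub>R t i)" for b i
  have C0: "vge 0 (C0 b i)" "pcoeff (C0 b i) 0 = of_real (if \<nu> i = \<mu> b then h i * e b (v i) else 0)"
    if "b \<in> B" "i \<in> I" for b i
  proof -
    have p: "pcoeff (C0 b i) x = of_real (e b (v i)) * pcoeff (t i) (x + \<mu> b)" for x
      by (simp add: C0_def pcoeff_scaleR_of_real del: pcoeff_scaleR)
    have z: "pcoeff (C0 b i) x = 0" if "x + \<mu> b < \<nu> i \<or> x < 0" for x
    proof (cases "e b (v i) = 0")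
      case False
      then have "\<mu> b \<le> \<nu> i" using ord \<open>b \<in> B\<close> \<open>i \<in> I\<close> by (simp add: e_def)
      then have "x + \<mu> b < \<nu> i" using that by auto
      then show ?thesis using t(1)[OF \<open>i \<in> I\<close>] by (simp add: p vge_def)
    qed (simp add: p)
    then show "vge 0 (C0 b i)" by (simp add: vge_def)
    show "pcoeff (C0 b i) 0 = of_real (if \<nu> i = \<mu> b then h i * e b (v i) else 0)"
    proof (cases "\<nu> i = \<mu> b")
      case True
      then show ?thesis using t(2)[OF that(2)] by (simp add: p)
    next
      case False
      show ?thesis
      proof (cases "e b (v i) = 0")
        case nz: False
        then have "\<mu> b < \<nu> i" using ord[OF that] False by (simp add: e_def)
        then show ?thesis using z[of 0] False by simp
      qed (simp add: p)
    qed
  qed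
  \<comment> \<open>The Jacobian of the rescaled system at \<open>w = 0\<close>, reduced modulo the
    maximal ideal.\<close>
  define A where "A b l = (\<Sum>i | i \<in> I \<and> \<nu> i = \<mu> b. h i * e l (v i) * e b (v i))" for b l
  have Ainj: "\<forall>l\<in>B. y l = 0" if y: "\<And>b. b \<in> B \<Longrightarrow> (\<Sum>l\<in>B. A b l * y l) = 0" for y
  proof -
    \<comment> \<open>A vector in the kernel of \<open>A\<close> is read as the functional with
      these values on the basis, to which \<open>inj\<close> applies.\<close>
    define Y where "Y x = (\<Sum>l\<in>B. e l x * y l)" for x
    have "linear Y" unfolding Y_def
      by (intro linearI) (simp_all add: linear_add[OF e] linear_scale[OF e] distrib_right sum.distrib
          sum_distrib_left mult.assoc)
    moreover have "(\<Sum>i | i \<in> I \<and> \<nu> i = \<mu> b. h i * Y (v i) * representation B (v i) b) = 0" if "b \<in> B" for b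
    proof -
      have "(\<Sum>i | i \<in> I \<and> \<nu> i = \<mu> b. h i * Y (v i) * e b (v i)) = (\<Sum>l\<in>B. A b l * y l)"
        unfolding Y_def A_def sum_distrib_left sum_distrib_right
        by (subst sum.swap) (simp add: mult_ac)
      then show ?thesis using y[OF that] by (simp add: e_def)
    qed
    ultimately have Y0: "Y x = 0" for x by (rule inj)
    have "y l = Y l" if "l \<in> B" for l
      using B(1) that by (simp add: Y_def e_basis if_distrib[of "\<lambda>c. c * _"] cong: if_cong)
    then show ?thesis using Y0 by simp
  qed
  have "\<exists>N. (\<forall>l\<in>B. \<forall>m\<in>B. (\<Sum>b\<in>B. N l b * A b m) = (if m = l then 1 else 0)) \<and>
      (\<forall>b\<in>B. \<forall>c\<in>B. (\<Sum>l\<in>B. A b l * N l c) = (if c = b then 1 else 0))"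
    by (rule square_matrix_inverse[OF B]) (rule Ainj)
  then obtain N where N0: "\<forall>l\<in>B. \<forall>m\<in>B. (\<Sum>b\<in>B. N l b * A b m) = (if m = l then 1 else 0)"
      "\<forall>b\<in>B. \<forall>c\<in>B. (\<Sum>l\<in>B. A b l * N l c) = (if c = b then 1 else 0)"
    by (elim exE conjE)
  note N = N0[rule_format]
  \<comment> \<open>Premultiplying by the inverse of \<open>A\<close> makes the reduced Jacobian the
    identity, as the Hensel lemmas require.\<close>
  define C where "C l i = (\<Sum>b\<in>B. N l b *\<^sub>R C0 b i)" for l i
  have Cv: "vge 0 (C l i)" if "i \<in> I" for l i
    unfolding C_def using C0(1) that by (intro vge_sum vge_scaleR) auto
  have C: "pcoeff (C l i) 0 = of_real (\<Sum>b\<in>B. N l b * (if \<nu> i = \<mu> b then h i * e b (v i) else 0))"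
    if "i \<in> I" for l i
    unfolding C_def pcoeff_sum pcoeff_scaleR_of_real of_real_sum of_real_mult
    by (intro sum.cong refl) (simp only: C0(2)[OF _ that])
  have Csum: "(\<Sum>i\<in>I. pcoeff (C l i) 0 * of_real (f i)) =
      of_real (\<Sum>b\<in>B. N l b * (\<Sum>i | i \<in> I \<and> \<nu> i = \<mu> b. h i * f i * e b (v i)))" for l f
  proof -
    have "(\<Sum>i\<in>I. pcoeff (C l i) 0 * of_real (f i)) =
        of_real (\<Sum>i\<in>I. (\<Sum>b\<in>B. N l b * (if \<nu> i = \<mu> b then h i * e b (v i) else 0)) * f i)"
      unfolding of_real_sum using C by (intro sum.cong) (simp_all only: of_real_mult)
    also have "(\<Sum>i\<in>I. (\<Sum>b\<in>B. N l b * (if \<nu> i = \<mu> b then h i * e b (v i) else 0)) * f i) =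
        (\<Sum>b\<in>B. N l b * (\<Sum>i\<in>I. (if \<nu> i = \<mu> b then h i * e b (v i) else 0) * f i))"
      unfolding sum_distrib_right sum_distrib_left by (subst sum.swap) (simp add: mult.assoc)
    also have "\<dots> = (\<Sum>b\<in>B. N l b * (\<Sum>i | i \<in> I \<and> \<nu> i = \<mu> b. h i * f i * e b (v i)))"
    proof (rule sum.cong[OF refl])
      fix b
      have "(\<Sum>i\<in>I. (if \<nu> i = \<mu> b then h i * e b (v i) else 0) * f i) =
          (\<Sum>i | i \<in> I \<and> \<nu> i = \<mu> b. h i * f i * e b (v i))"
        by (rule sum.mono_neutral_cong_right) (use I in auto)
      then show "N l b * (\<Sum>i\<in>I. (if \<nu> i = \<mu> b then h i * e b (v i) else 0) * f i) =
          N l b * (\<Sum>i | i \<in> I \<and> \<nu> i = \<mu> b. h i * f i * e b (v i))" by simp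
    qed
    finally show ?thesis .
  qed
  have const: "(\<Sum>i\<in>I. pcoeff (C l i) 0) = 0" for l
    using Csum[of l "\<lambda>_. 1"] crit by (simp add: e_def)
  have lin: "(\<Sum>i\<in>I. pcoeff (C l i) 0 * of_real (e m (v i))) = (if m = l then 1 else 0)"
    if "l \<in> B" "m \<in> B" for l m
    unfolding Csum N(1)[OF that, unfolded A_def] by simp
  \<comment> \<open>Premultiplication by \<open>N\<close> and rescaling by powers of t are
    invertible, and every functional is a combination of coordinates, so the solutions are
    unchanged.\<close>
  have equiv: "(\<forall>l\<in>B. (\<Sum>i\<in>I. C l i * x i) = 0) \<longleftrightarrow>
      (\<forall>\<phi>::'m \<Rightarrow> real. linear \<phi> \<longrightarrow> (\<Sum>i\<in>I. \<phi> (v i) *\<^sub>R (t i * x i)) = 0)" for x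
  proof -
    define G0 where "G0 b = (\<Sum>i\<in>I. C0 b i * x i)" for b
    define H where "H b = (\<Sum>i\<in>I. e b (v i) *\<^sub>R (t i * x i))" for b
    have G: "(\<Sum>i\<in>I. C l i * x i) = (\<Sum>b\<in>B. N l b *\<^sub>R G0 b)" for l
      unfolding G0_def C_def sum_distrib_right scaleR_sum_right by (subst sum.swap) simp
    have G0H: "G0 b = monom 1 (- \<mu> b) * H b" for b
      by (simp add: G0_def H_def C0_def sum_distrib_left mult.assoc)
    have HG0: "H b = monom 1 (\<mu> b) * G0 b" for b
      by (simp add: G0H monom_mult monom_1_0 flip: mult.assoc)
    have G0N: "G0 b = (\<Sum>l\<in>B. A b l *\<^sub>R (\<Sum>c\<in>B. N l c *\<^sub>R G0 c))" if b: "b \<in> B" for b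
    proof -
      have "(\<Sum>l\<in>B. A b l *\<^sub>R (\<Sum>c\<in>B. N l c *\<^sub>R G0 c)) = (\<Sum>c\<in>B. (\<Sum>l\<in>B. A b l * N l c) *\<^sub>R G0 c)"
        unfolding scaleR_sum_right scaleR_sum_left by (subst sum.swap) simp
      also have "\<dots> = (\<Sum>c\<in>B. if c = b then G0 c else 0)"
        using N(2)[OF b] by (intro sum.cong) auto
      finally show ?thesis using B(1) b by simp
    qed
    have "(\<forall>l\<in>B. (\<Sum>i\<in>I. C l i * x i) = 0) \<longleftrightarrow> (\<forall>b\<in>B. G0 b = 0)"
    proof
      assume "\<forall>l\<in>B. (\<Sum>i\<in>I. C l i * x i) = 0"
      then have 0: "(\<Sum>c\<in>B. N l c *\<^sub>R G0 c) = 0" if "l \<in> B" for l using that by (simp add: G)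
      show "\<forall>b\<in>B. G0 b = 0"
      proof
        fix b assume "b \<in> B"
        then have "G0 b = (\<Sum>l\<in>B. A b l *\<^sub>R (\<Sum>c\<in>B. N l c *\<^sub>R G0 c))" by (rule G0N)
        also have "\<dots> = (\<Sum>l\<in>B. A b l *\<^sub>R 0)" using 0 by (intro sum.cong) auto
        finally show "G0 b = 0" by simp
      qed
    qed (simp add: G)
    also have "\<dots> \<longleftrightarrow> (\<forall>b\<in>B. H b = 0)"
    proof
      show "\<forall>b\<in>B. H b = 0" if "\<forall>b\<in>B. G0 b = 0" using that by (simp add: HG0)
      show "\<forall>b\<in>B. G0 b = 0" if "\<forall>b\<in>B. H b = 0" using that by (simp add: G0H)
    qed
    also have "\<dots> \<longleftrightarrow> (\<forall>\<phi>::'m \<Rightarrow> real. linear \<phi> \<longrightarrow> (\<Sum>i\<in>I. \<phi> (v i) *\<^sub>R (t i * x i)) = 0)"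
    proof (intro iffI allI impI ballI)
      fix \<phi> :: "'m \<Rightarrow> real" assume H: "\<forall>b\<in>B. H b = 0" and \<phi>: "linear \<phi>"
      have "(\<Sum>i\<in>I. \<phi> (v i) *\<^sub>R (t i * x i)) = (\<Sum>i\<in>I. (\<Sum>b\<in>B. e b (v i) * \<phi> b) *\<^sub>R (t i * x i))"
        by (simp only: e_sum[OF \<phi>, symmetric, unfolded real_scaleR_def])
      also have "\<dots> = (\<Sum>b\<in>B. \<phi> b *\<^sub>R H b)"
        unfolding H_def scaleR_sum_left scaleR_sum_right by (subst sum.swap) (simp add: mult.commute)
      also have "\<dots> = 0" using H by simp
      finally show "(\<Sum>i\<in>I. \<phi> (v i) *\<^sub>R (t i * x i)) = 0" .
    next
      fix b assume "\<forall>\<phi>::'m \<Rightarrow> real. linear \<phi> \<longrightarrow> (\<Sum>i\<in>I. \<phi> (v i) *\<^sub>R (t i * x i)) = 0"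
      then show "H b = 0" unfolding H_def using e by blast
    qed
    finally show ?thesis .
  qed
  show ?thesis
  proof (rule ex_ex1I)
    obtain X where X: "\<And>b. X b \<in> max_ideal" "\<forall>l\<in>B. (\<Sum>i\<in>I. C l i * pexp (\<Sum>m\<in>B. e m (v i) *\<^sub>R X m)) = 0"
      using hensel_exists[OF B(1) I Cv const lin] by blast
    let ?w = "\<lambda>x. \<Sum>m\<in>B. e m x *\<^sub>R X m"
    have "linear ?w"
      by (intro linearI) (simp_all add: linear_add[OF e] linear_scale[OF e] scaleR_add_left sum.distrib scaleR_sum_right)
    moreover have "range ?w \<subseteq> max_ideal"
      using X(1) by (auto intro!: subspace_sum[OF subspace_max_ideal] subspace_scale[OF subspace_max_ideal])
    ultimately show "\<exists>w. linear w \<and> range w \<subseteq> max_ideal \<and>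
      (\<forall>\<phi>::'m \<Rightarrow> real. linear \<phi> \<longrightarrow> (\<Sum>i\<in>I. \<phi> (v i) *\<^sub>R (t i * pexp (w (v i)))) = 0)"
      using X(2) unfolding equiv by blast
  next
    fix w w' assume w: "linear w \<and> range w \<subseteq> max_ideal \<and>
      (\<forall>\<phi>::'m \<Rightarrow> real. linear \<phi> \<longrightarrow> (\<Sum>i\<in>I. \<phi> (v i) *\<^sub>R (t i * pexp (w (v i)))) = 0)"
      and w': "linear w' \<and> range w' \<subseteq> max_ideal \<and>
      (\<forall>\<phi>::'m \<Rightarrow> real. linear \<phi> \<longrightarrow> (\<Sum>i\<in>I. \<phi> (v i) *\<^sub>R (t i * pexp (w' (v i)))) = 0)"
    have eqs: "(\<Sum>i\<in>I. C l i * pexp (\<Sum>m\<in>B. e m (v i) *\<^sub>R f m)) = 0"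
      if f: "linear f \<and> range f \<subseteq> max_ideal \<and>
      (\<forall>\<phi>::'m \<Rightarrow> real. linear \<phi> \<longrightarrow> (\<Sum>i\<in>I. \<phi> (v i) *\<^sub>R (t i * pexp (f (v i)))) = 0)" and l: "l \<in> B" for f l
    proof -
      have "\<forall>l\<in>B. (\<Sum>i\<in>I. C l i * pexp (f (v i))) = 0" using f equiv[of "\<lambda>i. pexp (f (v i))"] by blast
      moreover have "(\<Sum>m\<in>B. e m x *\<^sub>R f m) = f x" for x
        by (rule e_sum[symmetric]) (use f in blast)
      ultimately show ?thesis using l by (simp only:)
    qed
    have ww': "w b = w' b" if "b \<in> B" for b
      by (rule hensel_unique[OF B(1) I Cv lin _ eqs[OF w] _ eqs[OF w'] that]) (use w w' in auto)
    have "w x = w' x" for x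
    proof -
      have "w x = (\<Sum>b\<in>B. e b x *\<^sub>R w b)" using e_sum w by blast
      also have "\<dots> = (\<Sum>b\<in>B. e b x *\<^sub>R w' b)" by (intro sum.cong refl) (simp only: ww')
      also have "\<dots> = w' x" by (rule e_sum[symmetric]) (use w' in blast)
      finally show ?thesis .
    qed
    then show "w = w'" by auto
  qed
qed

section \<open>Consequences of completeness, and the theorem\<close>

lemma complete_poly_span:
  assumes "complete_poly n v"
  shows "span (v ` {1..n}) = UNIV"
  using assms affine_hull_subset_span[of "v ` {1..n}"] by (auto simp: complete_poly_def)

text \<open>Since 0 is interior, a small negative multiple of \<open>v j\<close> is still in the
  hull; adding the opposite multiple of \<open>v j\<close> to its convex representation gives a
  relation positive at \<open>j\<close>. Injectivity of \<open>v\<close> turns weights on points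
  into weights on indices.\<close>

lemma complete_poly_relation:
  assumes c: "complete_poly n v" and inj: "inj_on v {1..n}" and j: "j \<in> {1..n}"
  shows "\<exists>a. (\<forall>i\<in>{1..n}. a i \<ge> 0) \<and> a j > (0::real) \<and> (\<Sum>i\<in>{1..n}. a i *\<^sub>R v i) = 0"
proof -
  let ?I = "{1..n}"
  obtain \<epsilon> where \<epsilon>: "\<epsilon> > 0" "ball 0 \<epsilon> \<subseteq> convex hull (v ` ?I)"
    using c by (auto simp: complete_poly_def mem_interior)
  \<comment> \<open>The multiple must stay inside the ball of radius \<epsilon>; the summand 1
    covers \<open>v j = 0\<close>.\<close>
  define t where "t = \<epsilon> / (norm (v j) + 1)"
  have n: "norm (v j) + 1 > 0" by (simp add: add_nonneg_pos)
  have t: "t > 0" using \<epsilon>(1) n by (simp add: t_def)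
  have "t * norm (v j) < t * (norm (v j) + 1)" using t by simp
  also have "\<dots> = \<epsilon>" using n by (simp add: t_def)
  finally have "- t *\<^sub>R v j \<in> ball 0 \<epsilon>" using t by (simp add: dist_norm)
  then have "- t *\<^sub>R v j \<in> convex hull (v ` ?I)" using \<epsilon>(2) by blast
  then obtain u where u: "\<forall>x\<in>v ` ?I. u x \<ge> 0" "(\<Sum>x\<in>v ` ?I. u x *\<^sub>R x) = - t *\<^sub>R v j"
    by (auto simp: convex_hull_finite)
  define a where "a i = u (v i) + (if i = j then t else 0)" for i
  have "(\<Sum>i\<in>?I. a i *\<^sub>R v i) = (\<Sum>i\<in>?I. u (v i) *\<^sub>R v i) + (\<Sum>i\<in>?I. if i = j then t *\<^sub>R v i else 0)"
    by (simp add: a_def scaleR_add_left sum.distrib if_distrib[of "\<lambda>c. c *\<^sub>R _"] cong: if_cong)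
  also have "(\<Sum>i\<in>?I. u (v i) *\<^sub>R v i) = - t *\<^sub>R v j"
    using u(2) sum.reindex[OF inj, of "\<lambda>x. u x *\<^sub>R x"] by simp
  also have "(\<Sum>i\<in>?I. if i = j then t *\<^sub>R v i else 0) = t *\<^sub>R v j" using j by simp
  finally have "(\<Sum>i\<in>?I. a i *\<^sub>R v i) = 0" by simp
  moreover have "\<forall>i\<in>?I. a i \<ge> 0" using u(1) t by (simp add: a_def)
  moreover have "a j > 0" using u(1) t j by (simp add: a_def add_nonneg_pos)
  ultimately show ?thesis by blast
qed

theorem theorem5p2:
  fixes M :: "'m::real_normed_vector set"
    and n :: nat and \<gamma> :: "nat \<Rightarrow> puiseux" and v :: "nat \<Rightarrow> 'm"
  assumes "character_lattice M"
    and "gen_puiseux_poly n \<gamma> v"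
    and "complete_poly n v"
  shows "\<exists>p. critical_point M n \<gamma> v p \<and>
           (\<forall>q. critical_point M n \<gamma> v q \<longrightarrow> q = p) \<and>
           Val_T M p = d_crit (newton_of_poly n \<gamma> v) poly_splitting"
proof -
  note M = assms(1)
  define I where "I = {1..n}"
  define c where "c i = Val (\<gamma> i)" for i
  obtain F :: "'m set" where F: "finite F" "span F = UNIV" using character_lattice_basis[OF M] by metis
  have fI: "finite I" by (simp add: I_def)
  have sp: "span (v ` I) = UNIV" using complete_poly_span[OF assms(3)] by (simp add: I_def)
  have inj: "inj_on v {1..n}" and \<gamma>: "\<And>i. i \<in> I \<Longrightarrow> \<gamma> i \<in> Kpos"
    using assms(2) by (auto simp: gen_puiseux_poly_def I_def)
  have rel: "\<And>j. j \<in> I \<Longrightarrow> \<exists>a. (\<forall>i\<in>I. a i \<ge> 0) \<and> a j > (0::real) \<and> (\<Sum>i\<in>I. a i *\<^sub>R v i) = 0"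
    using complete_poly_relation[OF assms(3) inj] by (simp add: I_def)
  have "\<forall>i\<in>I. \<exists>r>0. pcoeff (\<gamma> i) (c i) = complex_of_real r" using \<gamma> by (simp add: Kpos_def c_def)
  then obtain g where g: "\<And>i. i \<in> I \<Longrightarrow> g i > 0" "\<And>i. i \<in> I \<Longrightarrow> pcoeff (\<gamma> i) (c i) = complex_of_real (g i)"
    by metis
  define t where "t u d i = \<gamma> i * monom (of_real (exp (u (v i)))) (d (v i))" for u d :: "'m \<Rightarrow> real" and i
  \<comment> \<open>The critical point equations in the coordinates of the torus; existence and
    uniqueness are proved for such triples and transferred to points at the end.\<close>
  define sol where "sol u d w \<longleftrightarrow> linear u \<and> linear d \<and> linear w \<and> range w \<subseteq> max_ideal \<and>
    (\<forall>\<phi>::'m \<Rightarrow> real. linear \<phi> \<longrightarrow> (\<Sum>i\<in>I. \<phi> (v i) *\<^sub>R (t u d i * pexp (w (v i)))) = 0)"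
    for u d :: "'m \<Rightarrow> real" and w
  have tv: "vge (c i + d (v i)) (t u d i)"
    "pcoeff (t u d i) (c i + d (v i)) = of_real (g i * exp (u (v i)))" if "i \<in> I" for u d i
  proof -
    note m = vge_monom[of "d (v i)" "of_real (exp (u (v i)))"]
    have cg: "vge (c i) (\<gamma> i)" unfolding c_def by (rule vge_Val)
    show "vge (c i + d (v i)) (t u d i)" unfolding t_def by (rule vge_mult[OF cg m])
    show "pcoeff (t u d i) (c i + d (v i)) = of_real (g i * exp (u (v i)))"
      unfolding t_def pcoeff_mult_lowest[OF cg m] g(2)[OF that] by (simp add: pcoeff_monom)
  qed
  have crit: "poly_deriv M n \<gamma> v \<phi> p = (\<Sum>i\<in>I. \<phi> (v i) *\<^sub>R (t u d i * pexp (w (v i))))"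
    if "torus_rep M p (u, d, w)" for \<phi> p u d w
    unfolding poly_deriv_def torus_pow_eq[OF M that] torus_exp_def t_def I_def
    by (intro sum.cong refl) (simp add: scaleR_conv_of_real mult_ac)
  have lead: "(\<Sum>i | i \<in> I \<and> c i + d (v i) = \<mu>. g i * exp (u (v i)) * \<phi> (v i)) = 0"
    if s: "sol u d w" and \<phi>: "linear \<phi>" and le: "\<And>i. i \<in> I \<Longrightarrow> \<phi> (v i) \<noteq> 0 \<Longrightarrow> \<mu> \<le> c i + d (v i)"
    for u d w \<mu> and \<phi> :: "'m \<Rightarrow> real"
  proof (rule critical_leading_coefficients[OF fI, where X = "\<lambda>i. t u d i * pexp (w (v i))"])
    fix i assume i: "i \<in> I"
    have m: "w (v i) \<in> max_ideal" using s by (auto simp: sol_def)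
    show "vge (c i + d (v i)) (t u d i * pexp (w (v i)))"
      using vge_mult[OF tv(1)[OF i] vge_pexp_max_ideal[OF m]] by simp
    show "pcoeff (t u d i * pexp (w (v i))) (c i + d (v i)) = of_real (g i * exp (u (v i)))"
      using pcoeff_mult_lowest[OF tv(1)[OF i] vge_pexp_max_ideal[OF m]] tv(2)[OF i] pcoeff_pexp_0[OF m]
      by simp
  qed (use s \<phi> le in \<open>auto simp: sol_def\<close>)
  \<comment> \<open>Every solution yields a balanced flag for its own \<open>d\<close>, and a
    balanced flag identifies \<open>d\<close> as the canonical point. This settles both the
    valuation and the uniqueness of \<open>d\<close>.\<close>
  have d_eq: "d = d_crit (newton_of_poly n \<gamma> v) poly_splitting" if s: "sol u d w" for u d w
  proof -
    have "balanced_flag I v (\<lambda>i. c i + d (v i)) {0}"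
      by (rule balanced_flag_of_critical[OF fI sp, of "\<lambda>i. g i * exp (u (v i))"])
        (use g(1) lead[OF s] in \<open>simp_all\<close>)
    then show ?thesis
      using d_crit_newton_of_poly[OF F, of d n v \<gamma>] s by (simp add: I_def c_def sol_def)
  qed
  obtain d where d: "linear d" "balanced_flag I v (\<lambda>i. c i + d (v i)) {0}"
    using balanced_flag_exists[OF fI sp rel subspace_single_0, of "\<lambda>_. 0" c] linear_zero by auto
  define \<nu> where "\<nu> = (\<lambda>i. c i + d (v i))"
  \<comment> \<open>With the zero subspace and the empty basis as start, every vector of
    \<open>B\<close> carries an equation, and a linear map vanishes on \<open>L\<close>
    automatically.\<close>
  obtain B \<mu> where ad: "adapted I v \<nu> {0} {} B \<mu>"
    using adapted_exists[OF d(2) subspace_single_0 fI F independent_empty] unfolding \<nu>_def by auto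
  have B: "independent B" "span B = UNIV" using ad by (simp_all add: adapted_def)
  have fB: "finite B" by (rule finite_basis_subset[OF F B(1)])
  have ord: "\<mu> b \<le> \<nu> i" if "b \<in> B" "i \<in> I" "representation B (v i) b \<noteq> 0" for b i
    using ad that by (simp add: adapted_def)
  have inj': "y x = 0" if "\<And>i. i \<in> I \<Longrightarrow> h i > 0" "linear y" "\<And>b. b \<in> B \<Longrightarrow>
      (\<Sum>i | i \<in> I \<and> \<nu> i = \<mu> b. h i * y (v i) * representation B (v i) b) = 0" for h y x
    by (rule ad[unfolded adapted_def, THEN conjunct2, THEN conjunct2, THEN conjunct2, THEN conjunct2,
          THEN conjunct1, rule_format, of h]) (use that linear_0[OF that(2)] in auto)
  have higher: "\<exists>!w. linear w \<and> range w \<subseteq> max_ideal \<and>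
      (\<forall>\<phi>::'m \<Rightarrow> real. linear \<phi> \<longrightarrow> (\<Sum>i\<in>I. \<phi> (v i) *\<^sub>R (t u d i * pexp (w (v i)))) = 0)"
    if u: "\<And>b. b \<in> B \<Longrightarrow> (\<Sum>i | i \<in> I \<and> \<nu> i = \<mu> b. g i * exp (u (v i)) * representation B (v i) b) = 0" for u
  proof (rule higher_order_terms[OF fI fB B ord _ u])
    show "y x = 0" if "linear y" "\<And>b. b \<in> B \<Longrightarrow>
        (\<Sum>i | i \<in> I \<and> \<nu> i = \<mu> b. g i * exp (u (v i)) * y (v i) * representation B (v i) b) = 0" for y x
      by (rule inj'[of "\<lambda>i. g i * exp (u (v i))"]) (use that g(1) in auto)
  qed (use tv in \<open>auto simp: \<nu>_def\<close>)
  obtain u where u: "linear u"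
    "\<And>b. b \<in> B \<Longrightarrow> (\<Sum>i | i \<in> I \<and> \<nu> i = \<mu> b. g i * exp (u (v i)) * representation B (v i) b) = 0"
    using ad[unfolded adapted_def, THEN conjunct2, THEN conjunct2, THEN conjunct2, THEN conjunct2,
          THEN conjunct2, rule_format, of g "\<lambda>_. 0"] g(1) linear_zero by auto
  obtain w where s: "sol u d w" using higher[OF u(2)] u(1) d(1) by (auto simp: sol_def)
  have unique: "u' = u \<and> d' = d \<and> w' = w" if s': "sol u' d' w'" for u' d' w'
  proof -
    have d': "d' = d" using d_eq[OF s'] d_eq[OF s] by simp
    note s' = s'[unfolded d']
    \<comment> \<open>The coordinate at \<open>b\<close> serves as the test functional;
      \<open>ord\<close> says that its leading exponent is at least \<open>\<mu> b\<close>.\<close>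
    have u': "(\<Sum>i | i \<in> I \<and> \<nu> i = \<mu> b. g i * exp (u' (v i)) * representation B (v i) b) = 0" if "b \<in> B" for b
      unfolding \<nu>_def
      by (rule lead[OF s' linear_representation[OF B]]) (use ord[OF that] in \<open>simp add: \<nu>_def\<close>)
    define y where "y x = u' x - u x" for x
    have y: "linear y" unfolding y_def using s' u(1) by (intro linear_compose_sub) (auto simp: sol_def)
    \<comment> \<open>the difference quotients of \<open>exp\<close> are positive weights\<close>
    define k where "k i = (if y (v i) = 0 then 1 else (exp (y (v i)) - 1) / y (v i))" for i
    have k: "k i > 0" for i
      by (cases "y (v i)" "0::real" rule: linorder_cases) (auto simp: k_def divide_pos_pos divide_neg_neg)
    have ky: "k i * y (v i) = exp (y (v i)) - 1" for i by (simp add: k_def)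
    have "y x = 0" for x
    proof (rule inj'[of "\<lambda>i. g i * exp (u (v i)) * k i", OF _ y])
      fix b assume b: "b \<in> B"
      \<comment> \<open>Subtracting the leading systems for \<open>u'\<close> and \<open>u\<close>
        gives a homogeneous linear system for \<open>y\<close> with positive weights, to which the
        injectivity of the adapted basis applies.\<close>
      have "g i * exp (u (v i)) * k i * y (v i) = g i * exp (u' (v i)) - g i * exp (u (v i))" for i
      proof -
        have "exp (u (v i)) * exp (y (v i)) = exp (u' (v i))" by (simp add: y_def flip: exp_add)
        then show ?thesis using ky[of i] by (simp add: mult.assoc) (simp add: algebra_simps)
      qed
      then show "(\<Sum>i | i \<in> I \<and> \<nu> i = \<mu> b. g i * exp (u (v i)) * k i * y (v i) * representation B (v i) b) = 0"
        using u'[OF b] u(2)[OF b] by (simp add: left_diff_distrib sum_subtractf)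
    qed (use g(1) k in simp)
    then have "u' = u" by (auto simp: y_def)
    then show ?thesis using higher[OF u(2)] s s' d' by (auto simp: sol_def)
  qed
  define p where "p = restrict (torus_exp u d w) M"
  have lin: "linear u" "linear d" "linear w" "range w \<subseteq> max_ideal" using s by (auto simp: sol_def)
  have p: "p \<in> torus_pos M" "torus_rep M p (u, d, w)"
    unfolding p_def by (rule torus_rep_restrict[OF M lin])+
  have "critical_point M n \<gamma> v p"
    using p(1) s crit[OF p(2)] by (simp add: critical_point_def sol_def)
  moreover have "q = p" if q: "critical_point M n \<gamma> v q" for q
  proof -
    have qT: "q \<in> torus_pos M" using q by (simp add: critical_point_def)
    then obtain u' d' w' where r: "torus_rep M q (u', d', w')" using torus_rep_exists[OF M] by blast
    then have "sol u' d' w'" using q crit[OF r] by (simp add: critical_point_def sol_def torus_rep_def)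
    then have "torus_rep M q (u, d, w)" using unique r by blast
    then have "q x = p x" if "x \<in> M" for x using that p(2) by (simp add: torus_rep_def)
    then show "q = p" using qT p(1) by (intro PiE_ext[of q M "\<lambda>_. Kpos" p]) (auto simp: torus_pos_def)
  qed
  moreover have "Val_T M p = d_crit (newton_of_poly n \<gamma> v) poly_splitting"
    using Val_T_eq[OF M p(2)] d_eq[OF s] by simp
  ultimately show ?thesis by blast
qed

end
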